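(* Let $k\in\mathbb{R}$. The set $\mathfrak{R}_{\sec\geq k}(4)$ is an algebraic interior with minimal defining polynomial $\mathfrak{p}_k\colon\mathrm{Sym}^2_b(\wedge^2\mathbb{R}^4)\to\mathbb{R}$ given by $$\mathfrak{p}_k(R)=\mathrm{disc}_x\big(\det(R-k\,\mathrm{Id}+x\,* )\big).$$ More precisely, $\mathfrak{R}_{\sec\geq k}(4)=\overline{\mathcal{C}_k}$, where $\mathcal{C}_k$ is the only connected component of the set $\{R\in\mathrm{Sym}^2_b(\wedge^2\mathbb{R}^4):\mathfrak{p}_k(R)>0\}$ such that $(k+1)\mathrm{Id}\in\overline{\mathcal{C}_k}$.
   Context: Equip $\mathbb{R}^4$ with its standard inner product and $\wedge^2\mathbb{R}^4$ with the induced inner product $\langle\cdot,\cdot\rangle$ (so that $e_i\wedge e_j$, $i<j$, is an orthonormal basis). $\mathrm{Sym}^2(\wedge^2\mathbb{R}^4)$ is the space of symmetric endomorphisms of $\wedge^2\mathbb{R}^4\cong\mathbb{R}^6$, and $\mathrm{Sym}^2_b(\wedge^2\mathbb{R}^4)$ is the subspace of those $R$ satisfying the first Bianchi identity $\langle R(X\wedge Y),Z\wedge W\rangle+\langle R(Y\wedge Z),X\wedge W\rangle+\langle R(Z\wedge X),Y\wedge W\rangle=0$ for all $X,Y,Z,W\in\mathbb{R}^4$. The sectional curvature of $R$ is the function $\sec_R(\sigma)=\langle R(\sigma),\sigma\rangle$ on $\mathrm{Gr}_2^+(\mathbb{R}^4)=\{X\wedge Y\in\wedge^2\mathbb{R}^4:\|X\wedge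 Y\|=1\}$, and $\mathfrak{R}_{\sec\geq k}(4)=\{R\in\mathrm{Sym}^2_b(\wedge^2\mathbb{R}^4):\sec_R\geq k\}$. The Hodge star $*\in\mathrm{Sym}^2(\wedge^2\mathbb{R}^4)$ is defined by $\langle *\alpha,\beta\rangle=\langle e_1\wedge e_2\wedge e_3\wedge e_4,\alpha\wedge\beta\rangle$ for all $\alpha,\beta\in\wedge^2\mathbb{R}^4$. For a polynomial $p(x)=a_dx^d+\dots+a_0$ of degree $d$ with complex roots $r_1,\dots,r_d$ (with multiplicity), the discriminant is $\mathrm{disc}_x(p(x))=a_d^{2d-2}\prod_{i<j}(r_i-r_j)^2$; here it is applied to $\det(R-k\,\mathrm{Id}+x\,* )$ as a polynomial of degree $6$ in $x$. A closed subset $S$ of a finite-dimensional real vector space $\mathbb{R}^N$ is an algebraic interior if it is the closure of a connected component of $\{x\in\mathbb{R}^N:p(x)>0\}$ for some polynomial $p\in\mathbb{R}[x_1,\dots,x_N]$; such a $p$ is called a defining polynomial of $S$. A minimal defining polynomial of $S$ is a defining polynomial of minimal degree (it is unique up to a positive constant factor). *)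

theory Defs
  imports
    "HOL-Analysis.Analysis"
    "HOL-Computational_Algebra.Fundamental_Theorem_Algebra"
    "HOL-Library.Poly_Mapping"
begin

section \<open>Bivectors of Euclidean 4-space\<close>

text \<open>
  The space of bivectors is modelled as \<open>real ^ ix\<close>: the coordinates are those with respect to
  the basis \<open>e\<^sub>i \<and> e\<^sub>j\<close>, \<open>i < j\<close>, so that this basis is orthonormal for the standard inner product
  of \<open>real ^ ix\<close>. The induced inner product is confirmed in \<open>inner_wedge\<close> below.
\<close>

datatype ix = I12 | I13 | I14 | I23 | I24 | I34

lemma UNIV_ix: "UNIV = {I12, I13, I14, I23, I24, I34}"
  by (auto intro: ix.exhaust)

instance ix :: finite
  by standard (simp add: UNIV_ix)

lemma sum_ix:
  fixes f :: "ix \<Rightarrow> 'a::comm_monoid_add"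
  shows "(\<Sum>I\<in>UNIV. f I) = f I12 + f I13 + f I14 + f I23 + f I24 + f I34"
  by (simp add: UNIV_ix add.assoc)

primrec lo :: "ix \<Rightarrow> 4" where
  "lo I12 = 1" | "lo I13 = 1" | "lo I14 = 1" | "lo I23 = 2" | "lo I24 = 2" | "lo I34 = 3"

primrec hi :: "ix \<Rightarrow> 4" where
  "hi I12 = 2" | "hi I13 = 3" | "hi I14 = 4" | "hi I23 = 3" | "hi I24 = 4" | "hi I34 = 4"

definition wedge :: "real ^ 4 \<Rightarrow> real ^ 4 \<Rightarrow> real ^ ix" where
  "wedge X Y = (\<chi> I. X $ lo I * Y $ hi I - X $ hi I * Y $ lo I)"

lemma wedge_axis: "wedge (axis (lo I) 1) (axis (hi I) 1) = axis I 1"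
proof -
  have "wedge (axis (lo I) 1) (axis (hi I) 1) $ J = axis I 1 $ J" for J
    by (cases I; cases J) (simp_all add: wedge_def axis_def)
  then show ?thesis by (simp add: vec_eq_iff)
qed

lemma inner_wedge:
  "wedge X Y \<bullet> wedge Z W = (X \<bullet> Z) * (Y \<bullet> W) - (X \<bullet> W) * (Y \<bullet> Z)"
  by (simp add: wedge_def inner_vec_def sum_ix sum_4 algebra_simps)

text \<open>The coefficient of \<open>\<alpha> \<and> \<beta>\<close> with respect to \<open>e\<^sub>1 \<and> e\<^sub>2 \<and> e\<^sub>3 \<and> e\<^sub>4\<close>;
  on decomposable bivectors it is a determinant (\<open>wedge_vol_wedge\<close>).\<close>

definition wedge_vol :: "real ^ ix \<Rightarrow> real ^ ix \<Rightarrow> real" where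
  "wedge_vol \<alpha> \<beta> =
     \<alpha> $ I12 * \<beta> $ I34 - \<alpha> $ I13 * \<beta> $ I24 + \<alpha> $ I14 * \<beta> $ I23
   + \<alpha> $ I23 * \<beta> $ I14 - \<alpha> $ I24 * \<beta> $ I13 + \<alpha> $ I34 * \<beta> $ I12"

lemma wedge_vol_wedge: "wedge_vol (wedge X Y) (wedge Z W) = det (vector [X, Y, Z, W] :: real ^ 4 ^ 4)"
proof -
  have v: "(vector [X, Y, Z, W] :: real ^ 4 ^ 4) $ 1 = X" "(vector [X, Y, Z, W] :: real ^ 4 ^ 4) $ 2 = Y"
    "(vector [X, Y, Z, W] :: real ^ 4 ^ 4) $ 3 = Z" "(vector [X, Y, Z, W] :: real ^ 4 ^ 4) $ 4 = W"
    by (simp_all add: vector_def)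
  have f: "finite {2::4, 3, 4}" "1 \<notin> {2::4, 3, 4}" "finite {3::4, 4}" "2 \<notin> {3::4, 4}"
    "finite {4::4}" "3 \<notin> {4::4}"
    by auto
  show ?thesis
    unfolding det_def UNIV_4
    unfolding sum_over_permutations_insert[OF f(1,2)]
    unfolding sum_over_permutations_insert[OF f(3,4)]
    unfolding sum_over_permutations_insert[OF f(5,6)]
    unfolding permutes_sing
    by (simp add: sign_swap_id permutation_swap_id sign_compose permutation_compose sign_id v
        wedge_def wedge_vol_def algebra_simps)
qed

section \<open>Curvature operators\<close>

text \<open>Endomorphisms of the bivectors are matrices in the above orthonormal basis.\<close>

type_synonym endo = "real ^ ix ^ ix"

text \<open>The Hodge star is the matrix of the bilinear form \<open>wedge_vol\<close>, see \<open>inner_hodge\<close>.\<close>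

definition hodge :: endo where
  "hodge = (\<chi> I J. wedge_vol (axis J 1) (axis I 1))"

lemma inner_hodge: "(hodge *v \<alpha>) \<bullet> \<beta> = wedge_vol \<alpha> \<beta>"
  by (simp add: hodge_def wedge_vol_def inner_vec_def matrix_vector_mult_def sum_ix axis_def)

definition sym2_bianchi :: "endo set" where
  "sym2_bianchi = {R. transpose R = R \<and>
     (\<forall>X Y Z W. (R *v wedge X Y) \<bullet> wedge Z W + (R *v wedge Y Z) \<bullet> wedge X W
       + (R *v wedge Z X) \<bullet> wedge Y W = 0)}"

definition Gr2 :: "(real ^ ix) set" where
  "Gr2 = {wedge X Y | X Y. norm (wedge X Y) = 1}"

definition sec :: "endo \<Rightarrow> real ^ ix \<Rightarrow> real" where
  "sec R \<sigma> = (R *v \<sigma>) \<bullet> \<sigma>"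

definition sec_ge :: "real \<Rightarrow> endo set" where
  "sec_ge k = {R \<in> sym2_bianchi. \<forall>\<sigma>\<in>Gr2. sec R \<sigma> \<ge> k}"

lemma subspace_sym2_bianchi: "subspace sym2_bianchi"
proof -
  have t: "transpose (A + B) = transpose A + transpose B" for A B :: endo
    by (simp add: transpose_def vec_eq_iff)
  have s: "(c *\<^sub>R R *v v) \<bullet> w = c * ((R *v v) \<bullet> w)" for c and R :: endo and v w
    by (simp add: scaleR_matrix_vector_assoc[symmetric])
  show ?thesis
    unfolding sym2_bianchi_def subspace_def
  proof (intro conjI ballI allI CollectI; (elim CollectE conjE)?)
    show "transpose (0 :: endo) = 0" by (simp add: transpose_def vec_eq_iff)
  next
    fix R Q :: endo and X Y Z W
    assume *: "\<forall>X Y Z W. (R *v wedge X Y) \<bullet> wedge Z W + (R *v wedge Y Z) \<bullet> wedge X W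
       + (R *v wedge Z X) \<bullet> wedge Y W = 0"
      "\<forall>X Y Z W. (Q *v wedge X Y) \<bullet> wedge Z W + (Q *v wedge Y Z) \<bullet> wedge X W
       + (Q *v wedge Z X) \<bullet> wedge Y W = 0"
    show "((R + Q) *v wedge X Y) \<bullet> wedge Z W + ((R + Q) *v wedge Y Z) \<bullet> wedge X W
       + ((R + Q) *v wedge Z X) \<bullet> wedge Y W = 0"
      using *(1)[rule_format, of X Y Z W] *(2)[rule_format, of X Y Z W]
      by (simp add: matrix_vector_mult_add_rdistrib inner_add_left)
  next
    fix R :: endo and c X Y Z W
    assume "\<forall>X Y Z W. (R *v wedge X Y) \<bullet> wedge Z W + (R *v wedge Y Z) \<bullet> wedge X W
       + (R *v wedge Z X) \<bullet> wedge Y W = 0"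
    then show "(c *\<^sub>R R *v wedge X Y) \<bullet> wedge Z W + (c *\<^sub>R R *v wedge Y Z) \<bullet> wedge X W
       + (c *\<^sub>R R *v wedge Z X) \<bullet> wedge Y W = 0"
      by (simp only: s distrib_left[symmetric] mult_zero_right)
  qed (auto simp: t transpose_scalar)
qed

section \<open>Discriminants\<close>

definition disc_of_roots :: "complex \<Rightarrow> complex list \<Rightarrow> complex" where
  "disc_of_roots a rs = a ^ (2 * length rs - 2) *
     (\<Prod>j<length rs. \<Prod>i<j. (rs ! i - rs ! j)\<^sup>2)"

text \<open>
  The enumeration of the roots is irrelevant and the value is real, so that neither the choice
  nor \<open>Re\<close> loses anything: see \<open>of_real_disc\<close> below.
\<close>

definition disc :: "real poly \<Rightarrow> real" where
  "disc p = Re (disc_of_roots (of_real (lead_coeff p))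
     (SOME rs. mset rs = proots (map_poly of_real p)))"

primrec sqdiffs :: "complex list \<Rightarrow> complex" where
  "sqdiffs [] = 1"
| "sqdiffs (r # rs) = (\<Prod>s\<leftarrow>rs. (r - s)\<^sup>2) * sqdiffs rs"

lemma prod_eq_sqdiffs: "(\<Prod>j<length rs. \<Prod>i<j. (rs ! i - rs ! j)\<^sup>2) = sqdiffs rs"
proof (induction rs)
  case (Cons r rs)
  have "(\<Prod>j<length (r # rs). \<Prod>i<j. ((r # rs) ! i - (r # rs) ! j)\<^sup>2)
      = (\<Prod>j<length rs. (r - rs ! j)\<^sup>2 * (\<Prod>i<j. (rs ! i - rs ! j)\<^sup>2))"
    by (simp add: prod.lessThan_Suc_shift del: prod.lessThan_Suc)
  also have "\<dots> = (\<Prod>s\<leftarrow>rs. (r - s)\<^sup>2) * sqdiffs rs"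
    by (simp add: prod.distrib Cons.IH prod.list_conv_set_nth atLeast0LessThan)
  finally show ?case by simp
qed simp

lemma sqdiffs_append:
  "sqdiffs (xs @ r # ys) = sqdiffs (r # xs @ ys)"
proof (induction xs)
  case (Cons x xs)
  have "(x - r)\<^sup>2 = (r - x)\<^sup>2" by (rule power2_commute)
  then show ?case using Cons by (simp add: mult_ac)
qed simp

lemma sqdiffs_cong_mset: "mset xs = mset ys \<Longrightarrow> sqdiffs xs = sqdiffs ys"
proof (induction xs arbitrary: ys)
  case (Cons x xs)
  then have "x \<in> set ys" by (metis list.set_intros(1) mset_eq_setD)
  then obtain as bs where ys: "ys = as @ x # bs" by (meson split_list)
  with Cons.prems have m: "mset xs = mset (as @ bs)" by simp
  have "(\<Prod>s\<leftarrow>xs. (x - s)\<^sup>2) = (\<Prod>s\<leftarrow>as @ bs. (x - s)\<^sup>2)"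
    by (metis m mset_map prod_mset_prod_list)
  with Cons.IH[OF m] show ?case by (simp add: ys sqdiffs_append)
qed simp

lemma cnj_sqdiffs: "cnj (sqdiffs xs) = sqdiffs (map cnj xs)"
proof (induction xs)
  case (Cons x xs)
  have "cnj (\<Prod>s\<leftarrow>xs. (x - s)\<^sup>2) = (\<Prod>s\<leftarrow>map cnj xs. (cnj x - s)\<^sup>2)" by (induction xs) auto
  with Cons show ?case by simp
qed simp

lemma of_real_disc:
  assumes rs: "mset rs = proots (map_poly of_real p)"
  shows "of_real (disc p) = disc_of_roots (of_real (lead_coeff p)) rs"
proof -
  let ?q = "map_poly of_real p :: complex poly"
  define qs where "qs = (SOME rs. mset rs = proots ?q)"
  have qs: "mset qs = proots ?q" unfolding qs_def using rs by (rule someI)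
  have len: "length qs = length rs" by (metis qs rs size_mset)
  have eq: "sqdiffs qs = sqdiffs rs" by (rule sqdiffs_cong_mset) (simp add: qs rs)
  have "mset (map cnj rs) = mset rs"
  proof (cases "p = 0")
    case True
    with rs show ?thesis by simp
  next
    case False
    then have nz: "?q \<noteq> 0" by (simp add: map_poly_eq_0_iff)
    have lc: "lead_coeff ?q \<noteq> 0" using nz by simp
    have fact: "smult (lead_coeff ?q) (\<Prod>x\<leftarrow>rs. [:-x, 1:]) = ?q"
      using complex_poly_decompose_multiset[of ?q]
      by (metis mset_map prod_mset_prod_list rs)
    have cnjp: "map_poly cnj (\<Prod>x\<leftarrow>xs. [:-x, 1:]) = (\<Prod>x\<leftarrow>map cnj xs. [:-x, 1:])" for xs
    proof (induction xs)
      case (Cons x xs)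
      have mult: "map_poly cnj (a * b) = map_poly cnj a * map_poly cnj b" for a b
        by (rule poly_eqI) (simp add: coeff_map_poly coeff_mult)
      show ?case using Cons by (simp add: mult map_poly_pCons del: mult_pCons_left)
    qed (simp add: one_pCons map_poly_pCons)
    have cq: "map_poly cnj ?q = ?q" by (rule poly_eqI) (simp add: coeff_map_poly)
    have lcr: "cnj (lead_coeff ?q) = lead_coeff ?q"
      by (simp add: coeff_map_poly)
    have "?q = map_poly cnj (smult (lead_coeff ?q) (\<Prod>x\<leftarrow>rs. [:-x, 1:]))"
      using fact cq by simp
    also have "\<dots> = smult (lead_coeff ?q) (\<Prod>x\<leftarrow>map cnj rs. [:-x, 1:])"
      by (subst cnjp[symmetric]) (rule poly_eqI, simp add: coeff_map_poly lcr[simplified])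
    finally have "proots ?q = proots (smult (lead_coeff ?q) (\<Prod>x\<leftarrow>map cnj rs. [:-x, 1:]))"
      by simp
    also have "\<dots> = proots (\<Prod>x\<leftarrow>map cnj rs. [:-x, 1:])"
      by (rule proots_smult[OF lc])
    also have "\<dots> = mset (map cnj rs)"
    proof -
      have ne: "(\<Prod>x\<leftarrow>xs. [:-x, 1:]) \<noteq> 0" for xs :: "complex list"
        by (induction xs) (auto simp del: mult_pCons_left)
      have "proots (\<Prod>x\<leftarrow>xs. [:-x, 1:]) = mset xs" for xs :: "complex list"
      proof (induction xs)
        case (Cons x xs)
        have "proots [:-x, 1:] = {#x#}"
        proof (rule multiset_eqI)
          fix y
          show "count (proots [:-x, 1:]) y = count {#x#} y"
            using order_power_n_n[of x 1] by (cases "y = x") (simp_all add: order_0I)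
        qed
        with Cons show ?case
          by (simp add: proots_mult ne del: mult_pCons_left)
      qed simp
      then show ?thesis .
    qed
    finally show ?thesis using rs by simp
  qed
  then have "cnj (sqdiffs rs) = sqdiffs rs"
    by (simp only: cnj_sqdiffs) (rule sqdiffs_cong_mset)
  then have "cnj (disc_of_roots (of_real (lead_coeff p)) rs)
      = disc_of_roots (of_real (lead_coeff p)) rs"
    by (simp add: disc_of_roots_def prod_eq_sqdiffs)
  then have "of_real (Re (disc_of_roots (of_real (lead_coeff p)) rs))
      = disc_of_roots (of_real (lead_coeff p)) rs"
    by (metis Reals_cnj_iff of_real_Re)
  moreover have "disc p = Re (disc_of_roots (of_real (lead_coeff p)) rs)"
    unfolding disc_def qs_def[symmetric] disc_of_roots_def prod_eq_sqdiffs
    unfolding len eq ..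
  ultimately show ?thesis by simp
qed

definition pencil_poly :: "real \<Rightarrow> endo \<Rightarrow> real poly" where
  "pencil_poly k R = det (\<chi> I J. [:(R - k *\<^sub>R mat 1) $ I $ J, hodge $ I $ J:])"

lemma poly_pencil_poly: "poly (pencil_poly k R) x = det (R - k *\<^sub>R mat 1 + x *\<^sub>R hodge)"
  by (simp add: pencil_poly_def det_def poly_sum poly_prod)

definition disc_poly :: "real \<Rightarrow> endo \<Rightarrow> real" where
  "disc_poly k R = disc (pencil_poly k R)"

section \<open>Polynomials on a vector space and algebraic interiors\<close>

text \<open>
  A polynomial in variables \<open>x\<^sub>0, x\<^sub>1, \<dots>\<close> is a finitely supported map from monomials (finitely
  supported exponent vectors) to coefficients.
\<close>

type_synonym mpoly = "(nat \<Rightarrow>\<^sub>0 nat) \<Rightarrow>\<^sub>0 real"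

definition mvars :: "mpoly \<Rightarrow> nat set" where
  "mvars p = (\<Union>m\<in>Poly_Mapping.keys p. Poly_Mapping.keys m)"

definition meval :: "mpoly \<Rightarrow> (nat \<Rightarrow> real) \<Rightarrow> real" where
  "meval p x = (\<Sum>m\<in>Poly_Mapping.keys p. Poly_Mapping.lookup p m *
     (\<Prod>i\<in>Poly_Mapping.keys m. x i ^ Poly_Mapping.lookup m i))"

definition mdegree :: "mpoly \<Rightarrow> nat" where
  "mdegree p = Max (insert 0
     ((\<lambda>m. \<Sum>i\<in>Poly_Mapping.keys m. Poly_Mapping.lookup m i) ` Poly_Mapping.keys p))"

definition is_basis :: "'a::euclidean_space set \<Rightarrow> (nat \<Rightarrow> 'a) \<Rightarrow> bool" where
  "is_basis V b \<longleftrightarrow> inj_on b {..<dim V} \<and> independent (b ` {..<dim V}) \<and>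
     span (b ` {..<dim V}) = V"

definition coords :: "'a::euclidean_space set \<Rightarrow> (nat \<Rightarrow> 'a) \<Rightarrow> 'a \<Rightarrow> nat \<Rightarrow> real" where
  "coords V b v i = representation (b ` {..<dim V}) v (b i)"

text \<open>
  The function \<open>f\<close> is, on the subspace \<open>V\<close>, a polynomial of total degree \<open>n\<close> in linear coordinates
  of \<open>V\<close>, i.e. under an identification of \<open>V\<close> with \<open>\<real>\<^sup>N\<close>, where \<open>N = dim V\<close>. As a change of basis
  is an invertible linear substitution, the choice of \<open>b\<close> is irrelevant; \<open>n\<close> is determined by
  \<open>f\<close> and \<open>V\<close> since a polynomial over an infinite field is determined by its values.
\<close>

definition poly_of_degree_on :: "'a::euclidean_space set \<Rightarrow> ('a \<Rightarrow> real) \<Rightarrow> nat \<Rightarrow> bool" where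
  "poly_of_degree_on V f n \<longleftrightarrow>
     (\<exists>b p. is_basis V b \<and> mvars p \<subseteq> {..<dim V} \<and> mdegree p = n \<and>
            (\<forall>v\<in>V. f v = meval p (coords V b v)))"

definition defining_polynomial ::
  "'a::euclidean_space set \<Rightarrow> 'a set \<Rightarrow> ('a \<Rightarrow> real) \<Rightarrow> bool" where
  "defining_polynomial V S f \<longleftrightarrow> (\<exists>n. poly_of_degree_on V f n) \<and>
     (\<exists>C \<in> components {v\<in>V. f v > 0}. S = closure C)"

definition algebraic_interior :: "'a::euclidean_space set \<Rightarrow> 'a set \<Rightarrow> bool" where
  "algebraic_interior V S \<longleftrightarrow> closed S \<and> (\<exists>f. defining_polynomial V S f)"

definition minimal_defining_polynomial ::
  "'a::euclidean_space set \<Rightarrow> 'a set \<Rightarrow> ('a \<Rightarrow> real) \<Rightarrow> bool" where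
  "minimal_defining_polynomial V S f \<longleftrightarrow> defining_polynomial V S f \<and>
     (\<exists>n. poly_of_degree_on V f n \<and>
          (\<forall>g m. defining_polynomial V S g \<and> poly_of_degree_on V g m \<longrightarrow> n \<le> m))"

end

theory Submission
  imports Defs
begin

text \<open>
  Write \<open>T = R - k Id\<close>. By the Finsler-Thorpe trick, \<open>R\<close> has \<open>sec \<ge> k\<close> iff some \<open>T + x *\<close> is positive
  semidefinite. If in addition the discriminant does not vanish, then a kernel vector of \<open>T + x *\<close>
  cannot be isotropic (it would produce a double root), so moving \<open>x\<close> makes the pencil positive
  definite and all its roots are real and simple. Hence \<open>{sec \<ge> k, disc > 0}\<close> is open and closed in
  \<open>{disc > 0}\<close>. It is connected: up to multiples of \<open>*\<close> its points are \<open>N\<^sup>T diag(a) N\<close>, where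
  \<open>N\<close> transforms \<open>diag(1,1,1,-1,-1,-1)\<close> into \<open>*\<close>; by Givens rotations every element of \<open>O(3,3)\<close> is
  connected to a diagonal sign matrix, which does not affect \<open>N\<^sup>T diag(a) N\<close>, and the admissible ordered
  spectra \<open>a\<close> form a convex set.

  The discriminant of a characteristic polynomial \<open>f\<close> of degree 6 with root matrix \<open>M\<close> is
  \<open>- det (f'(M))\<close>, which has degree at most 30 in the entries of \<open>M\<close>.

  Conversely, let \<open>g\<close> be a defining polynomial. It vanishes on the boundary, that is, whenever the
  pencil has a positive semidefinite member with an isotropic kernel vector. By polynomial continuation
  it vanishes whenever there is any real isotropic kernel vector, and, along rational curves of isotropic
  vectors, also at the complex kernel vectors \<open>e\<^sub>i \<plusminus> \<i> e\<^sub>j\<close>. So on a line of diagonal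
  matrices \<open>g\<close> has a double root wherever two of the six eigenvalues cross; a generic line has 15
  such crossings, and the degree is at least 30.
\<close>

section \<open>Quadratic forms and the Finsler-Thorpe trick\<close>

text \<open>Projecting along \<open>hodge\<close> onto the Bianchi operators only translates x in
  the pencil, so symmetric matrices may be treated modulo \<open>hodge\<close> throughout. The
  discriminant also vanishes in the interior of the set sec \<ge> k, wherever two roots of a
  definite pencil coincide, for instance at (k+1) Id. Hence convexity alone does not give
  connectedness, and (k+1) Id is only a closure point of the component. The boundary argument for g
  does not see these zeros: eigenvectors of equal sign span a definite plane, which contains no real
  isotropic vector. Real vectors reach only the 9 pairs of opposite sign, which would give degree
  18; the 6 pairs of equal sign require complex isotropic vectors and supply the missing 12.
  Counting double zeros on one line takes the place of a proof that the discriminant is irreducible: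
  30 = 2 * 15 from the pairs of indices meets 30 = 6 * 5 from a determinant of size 6 with entries
  of degree 5.\<close>

lemma sec_add: "sec (A + B) v = sec A v + sec B v"
  by (simp add: sec_def matrix_vector_mult_add_rdistrib inner_add_left)

lemma sec_diff: "sec (A - B) v = sec A v - sec B v"
  by (simp add: sec_def matrix_vector_mult_diff_rdistrib inner_diff_left)

lemma sec_scaleR: "sec (c *\<^sub>R A) v = c * sec A v"
  by (simp add: sec_def scaleR_matrix_vector_assoc[symmetric])

lemma sec_mat1: "sec (mat 1) v = v \<bullet> v"
  by (simp add: sec_def)

lemma sec_hodge: "sec hodge v = wedge_vol v v"
  by (simp add: sec_def inner_hodge)

lemma sec_scaleR_vec: "sec A (c *\<^sub>R v) = c\<^sup>2 * sec A v"
  by (simp add: sec_def matrix_vector_mult_scaleR power2_eq_square)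

lemmas sec_linear = sec_add sec_diff sec_scaleR sec_mat1

lemma symmetric_inner:
  fixes A :: "real^'n^'n"
  assumes "transpose A = A"
  shows "(A *v v) \<bullet> w = (A *v w) \<bullet> v"
  by (metis assms dot_lmul_matrix inner_commute vector_transpose_matrix)

lemma sec_add_vec:
  assumes "transpose A = A"
  shows "sec A (v + w) = sec A v + 2 * ((A *v v) \<bullet> w) + sec A w"
  using symmetric_inner[OF assms, of v w]
  by (simp add: sec_def matrix_vector_right_distrib inner_add_left inner_add_right)

lemma transpose_hodge: "transpose hodge = hodge"
  by (simp add: hodge_def transpose_def vec_eq_iff wedge_vol_def axis_def)

lemma hodge_involution: "hodge ** hodge = mat 1"
proof -
  have "(hodge ** hodge) $ I $ J = mat 1 $ I $ J" for I J
    by (cases I; cases J) (simp_all add: hodge_def matrix_matrix_mult_def sum_ix wedge_vol_def axis_def mat_def)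
  then show ?thesis by (simp add: vec_eq_iff)
qed

text \<open>Isotropy is the Pluecker relation. \<open>f\<close> is the skew-symmetric matrix of
  \<open>w\<close>; if its entry at (i, j) is nonzero, the relation says that column j, divided by
  this entry, and row i wedge to \<open>w\<close>.\<close>

lemma isotropic_decomposable:
  assumes "wedge_vol w w = 0"
  obtains X Y where "w = wedge X Y"
proof -
  define f where "f = (\<lambda>(i :: 4) (j :: 4). (if i = 1 then (if j = 2 then w $ I12 else if j = 3 then w $ I13 else if j = 4 then w $ I14 else 0)
     else if i = 2 then (if j = 1 then - w $ I12 else if j = 3 then w $ I23 else if j = 4 then w $ I24 else 0)
     else if i = 3 then (if j = 1 then - w $ I13 else if j = 2 then - w $ I23 else if j = 4 then w $ I34 else 0)
     else (if j = 1 then - w $ I14 else if j = 2 then - w $ I24 else if j = 3 then - w $ I34 else 0)))"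
  have pl: "w $ I12 * w $ I34 - w $ I13 * w $ I24 + w $ I14 * w $ I23 = 0"
    using assms by (simp add: wedge_vol_def algebra_simps)
  have eq: "w = wedge (\<chi> k. f k j / f i j) (\<chi> k. f i k)" if "I \<in> UNIV" "i = lo I" "j = hi I" "w $ I \<noteq> 0" for I i j
  proof -
    have "w $ J = wedge (\<chi> k. f k j / f i j) (\<chi> k. f i k) $ J" for J
      using pl that(4) unfolding that(2,3)
      by (cases I; cases J) (simp_all add: wedge_def f_def field_simps)
    then show ?thesis by (simp add: vec_eq_iff)
  qed
  show ?thesis
  proof (cases "w = 0")
    case True
    have "w = wedge 0 0" by (simp add: True wedge_def vec_eq_iff)
    then show ?thesis by (rule that)
  next
    case False
    then obtain I where "w $ I \<noteq> 0" by (auto simp: vec_eq_iff)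
    with eq that show ?thesis by blast
  qed
qed

lemma wedge_isotropic: "wedge_vol (wedge X Y) (wedge X Y) = 0"
  by (simp add: wedge_vol_def wedge_def algebra_simps)

text \<open>For symmetric \<open>R\<close> this is half the trace of the product with
  \<open>hodge\<close>, so the Bianchi operators are the symmetric matrices orthogonal to
  \<open>hodge\<close>.\<close>

definition bianchi :: "endo \<Rightarrow> real" where
  "bianchi R = R $ I12 $ I34 - R $ I13 $ I24 + R $ I14 $ I23"

lemma bianchi_add: "bianchi (A + B) = bianchi A + bianchi B"
  and bianchi_diff: "bianchi (A - B) = bianchi A - bianchi B"
  and bianchi_scaleR: "bianchi (c *\<^sub>R A) = c * bianchi A"
  and bianchi_mat1: "bianchi (mat 1) = 0"
  and bianchi_hodge: "bianchi hodge = 3"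
  by (simp_all add: bianchi_def algebra_simps mat_def hodge_def wedge_vol_def axis_def)

lemmas bianchi_linear = bianchi_add bianchi_diff bianchi_scaleR bianchi_mat1 bianchi_hodge

text \<open>The cyclic sum pairs \<open>R\<close> with the kernel \<open>K\<close>, and a symmetric
  \<open>R\<close> sees only \<open>K I J + K J I\<close>, which is a multiple of
  \<open>hodge\<close>. All instances of the Bianchi identity are thus multiples of one linear
  equation.\<close>

lemma bianchi_cyclic_sum:
  assumes s: "transpose R = R"
  shows "(R *v wedge X Y) \<bullet> wedge Z W + (R *v wedge Y Z) \<bullet> wedge X W
       + (R *v wedge Z X) \<bullet> wedge Y W = wedge_vol (wedge X Y) (wedge Z W) * bianchi R"
proof -
  define K where "K I J = wedge X Y $ J * wedge Z W $ I + wedge Y Z $ J * wedge X W $ I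
     + wedge Z X $ J * wedge Y W $ I" for I J
  define D where "D = wedge_vol (wedge X Y) (wedge Z W)"
  let ?L = "(R *v wedge X Y) \<bullet> wedge Z W + (R *v wedge Y Z) \<bullet> wedge X W + (R *v wedge Z X) \<bullet> wedge Y W"
  have sy: "R $ J $ I = R $ I $ J" for I J by (metis s transpose_def vec_lambda_beta)
  have KK: "K I J + K J I = hodge $ I $ J * D" for I J
    by (cases I; cases J)
      (simp_all add: K_def D_def hodge_def wedge_def wedge_vol_def axis_def algebra_simps)
  have L: "?L = (\<Sum>I\<in>UNIV. \<Sum>J\<in>UNIV. R $ I $ J * K I J)"
    by (simp add: K_def inner_vec_def matrix_vector_mult_def sum_distrib_left sum_distrib_right sum.distrib distrib_left mult_ac)
  also have "\<dots> = (\<Sum>I\<in>UNIV. \<Sum>J\<in>UNIV. R $ J $ I * K J I)"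
    by (rule sum.swap)
  finally have L': "?L = (\<Sum>I\<in>UNIV. \<Sum>J\<in>UNIV. R $ I $ J * K J I)" by (simp add: sy)
  have "?L + ?L = (\<Sum>I\<in>UNIV. \<Sum>J\<in>UNIV. R $ I $ J * (K I J + K J I))"
    unfolding distrib_left sum.distrib L[symmetric] L'[symmetric] ..
  also have "\<dots> = 2 * (D * bianchi R)"
    unfolding KK by (simp add: sum_ix hodge_def wedge_vol_def axis_def bianchi_def sy[of I34 I12] sy[of I24 I13] sy[of I23 I14] algebra_simps)
  finally show ?thesis by (simp add: D_def)
qed

lemma mem_sym2_bianchi: "R \<in> sym2_bianchi \<longleftrightarrow> transpose R = R \<and> bianchi R = 0"
proof -
  have "(\<forall>X Y Z W. (R *v wedge X Y) \<bullet> wedge Z W + (R *v wedge Y Z) \<bullet> wedge X W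
       + (R *v wedge Z X) \<bullet> wedge Y W = 0) \<longleftrightarrow> bianchi R = 0" if s: "transpose R = R"
  proof
    assume "\<forall>X Y Z W. (R *v wedge X Y) \<bullet> wedge Z W + (R *v wedge Y Z) \<bullet> wedge X W
       + (R *v wedge Z X) \<bullet> wedge Y W = 0"
    then have *: "(R *v wedge (axis 1 1) (axis 2 1)) \<bullet> wedge (axis 3 1) (axis 4 1)
       + (R *v wedge (axis 2 1) (axis 3 1)) \<bullet> wedge (axis 1 1) (axis 4 1)
       + (R *v wedge (axis 3 1) (axis 1 1)) \<bullet> wedge (axis 2 1) (axis 4 1) = 0"
      by blast
    have w: "wedge (axis 1 1) (axis 2 1) = axis I12 1" "wedge (axis 3 1) (axis 4 1) = axis I34 1"
      "wedge (axis 2 1) (axis 3 1) = axis I23 1" "wedge (axis 1 1) (axis 4 1) = axis I14 1"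
      "wedge (axis 2 1) (axis 4 1) = axis I24 1"
      using wedge_axis[of I12] wedge_axis[of I34] wedge_axis[of I23] wedge_axis[of I14] wedge_axis[of I24] by simp_all
    have w': "wedge (axis 3 1) (axis 1 1) = - axis I13 1"
      using wedge_axis[of I13] by (simp add: wedge_def vec_eq_iff algebra_simps)
    have "(R *v axis I 1) \<bullet> axis J 1 = R $ J $ I" for I J
      by (simp add: inner_axis matrix_vector_mul_component inner_vec_def axis_def if_distrib cong: if_cong)
    then have "R $ I34 $ I12 + R $ I14 $ I23 - R $ I24 $ I13 = 0"
      using * by (simp add: w w' linear_neg[OF matrix_vector_mul_linear])
    moreover have "R $ I34 $ I12 = R $ I12 $ I34" "R $ I24 $ I13 = R $ I13 $ I24"
      by (metis s transpose_def vec_lambda_beta)+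
    ultimately show "bianchi R = 0" by (simp add: bianchi_def)
  next
    assume b: "bianchi R = 0"
    show "\<forall>X Y Z W. (R *v wedge X Y) \<bullet> wedge Z W + (R *v wedge Y Z) \<bullet> wedge X W
       + (R *v wedge Z X) \<bullet> wedge Y W = 0"
      unfolding bianchi_cyclic_sum[OF s] b by simp
  qed
  then show ?thesis unfolding sym2_bianchi_def by blast
qed

text \<open>A vector with \<open>sec B v > 0\<close> bounds \<open>t\<close> from below, one with
  \<open>sec B v < 0\<close> from above. No lower bound exceeds an upper bound, so the supremum of
  the lower bounds works; \<open>u0\<close> and \<open>w0\<close> make it the supremum of a nonempty
  bounded set.\<close>

lemma finsler:
  assumes A: "transpose A = A" and B: "transpose B = B"
    and nn: "\<And>v. sec B v = 0 \<Longrightarrow> sec A v \<ge> 0"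
    and u0: "sec B u0 > 0" and w0: "sec B w0 < 0"
  shows "\<exists>t. \<forall>v. sec (A + t *\<^sub>R B) v \<ge> 0"
proof -
  \<comment> \<open>The plane spanned by \<open>u\<close> and \<open>w\<close> contains the isotropic vectors \<open>r u + w\<close> and \<open>u - r w\<close>;
    the mixed terms cancel in the sum of their \<open>A\<close>-values.\<close>
  have key1: "sec A u + sec A w \<ge> 0" if u: "sec B u = 1" and w: "sec B w = -1" for u w
  proof -
    define m where "m = (B *v u) \<bullet> w"
    \<comment> \<open>The positive root of r^2 + 2 m r - 1 = 0, which is the isotropy condition for
      both vectors.\<close>
    define r where "r = - m + sqrt (m\<^sup>2 + 1)"
    have "sqrt (m\<^sup>2 + 1) > \<bar>m\<bar>" by (rule real_less_rsqrt) simp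
    then have r: "r > 0" by (simp add: r_def)
    have r2: "r\<^sup>2 + 2 * m * r - 1 = 0"
      by (simp add: r_def power2_eq_square algebra_simps) 
    have "sec B (r *\<^sub>R u + w) = 0"
      using r2 unfolding sec_add_vec[OF B] sec_scaleR_vec by (simp add: u w matrix_vector_mult_scaleR m_def algebra_simps)
    from nn[OF this] have 1: "r\<^sup>2 * sec A u + 2 * r * ((A *v u) \<bullet> w) + sec A w \<ge> 0"
      unfolding sec_add_vec[OF A] sec_scaleR_vec by (simp add: matrix_vector_mult_scaleR algebra_simps)
    have "sec B (u + (- r) *\<^sub>R w) = 0"
      using r2 unfolding sec_add_vec[OF B] sec_scaleR_vec by (simp add: u w matrix_vector_mult_scaleR m_def algebra_simps)
    from nn[OF this] have 2: "sec A u - 2 * r * ((A *v u) \<bullet> w) + r\<^sup>2 * sec A w \<ge> 0"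
      unfolding sec_add_vec[OF A] sec_scaleR_vec by (simp add: matrix_vector_mult_scaleR algebra_simps)
    have "(r\<^sup>2 + 1) * (sec A u + sec A w) \<ge> 0" using 1 2 by (simp add: algebra_simps)
    moreover have "r\<^sup>2 + 1 > 0" by (simp add: add_nonneg_pos)
    ultimately show ?thesis by (simp add: zero_le_mult_iff)
  qed
  have key: "- sec A u / sec B u \<le> sec A w / (- sec B w)" if u: "sec B u > 0" and w: "sec B w < 0" for u w
  proof -
    let ?u = "(1 / sqrt (sec B u)) *\<^sub>R u" and ?w = "(1 / sqrt (- sec B w)) *\<^sub>R w"
    have "sec A ?u + sec A ?w \<ge> 0"
      by (rule key1) (use u w in \<open>simp_all add: sec_scaleR_vec power_divide\<close>)
    then show ?thesis using u w by (simp add: sec_scaleR_vec power_divide)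
  qed
  define t where "t = Sup {- sec A u / sec B u | u. sec B u > 0}"
  have bdd: "bdd_above {- sec A u / sec B u | u. sec B u > 0}"
    by (rule bdd_aboveI[of _ "sec A w0 / (- sec B w0)"]) (use key[OF _ w0] in auto)
  have "sec (A + t *\<^sub>R B) v \<ge> 0" for v
  proof (cases "sec B v" "0::real" rule: linorder_cases)
    case less
    have "t \<le> sec A v / (- sec B v)" unfolding t_def
      by (rule cSup_least) (use u0 key[OF _ less] in auto)
    then show ?thesis using less by (simp add: sec_linear field_simps)
  next
    case equal
    then show ?thesis using nn by (simp add: sec_linear)
  next
    case greater
    have "- sec A v / sec B v \<le> t" unfolding t_def by (rule cSup_upper[OF _ bdd]) (use greater in auto)
    then show ?thesis using greater by (simp add: sec_linear field_simps)
  qed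
  then show ?thesis by blast
qed

text \<open>Unit decomposable bivectors are the unit isotropic ones, and homogeneity extends the
  test to the whole isotropic cone.\<close>

lemma mem_sec_ge_iff_isotropic:
  "R \<in> sec_ge k \<longleftrightarrow> R \<in> sym2_bianchi \<and> (\<forall>v. wedge_vol v v = 0 \<longrightarrow> sec (R - k *\<^sub>R mat 1) v \<ge> 0)"
proof -
  have "sec (R - k *\<^sub>R mat 1) v \<ge> 0" if S: "\<forall>\<sigma>\<in>Gr2. sec R \<sigma> \<ge> k" and iso: "wedge_vol v v = 0" for v
  proof (cases "v = 0")
    case False
    obtain X Y where v: "v = wedge X Y" by (rule isotropic_decomposable[OF iso])
    have "(1 / norm v) *\<^sub>R v = wedge ((1 / norm v) *\<^sub>R X) Y"
      by (simp add: wedge_def vec_eq_iff v diff_divide_distrib)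
    moreover have "norm ((1 / norm v) *\<^sub>R v) = 1" using False by simp
    ultimately have "(1 / norm v) *\<^sub>R v \<in> Gr2" unfolding Gr2_def
      by (metis (mono_tags, lifting) mem_Collect_eq)
    then have "k \<le> sec R ((1 / norm v) *\<^sub>R v)" using S by blast
    then have "k \<le> sec R v / (norm v)\<^sup>2" by (simp add: sec_scaleR_vec power_divide)
    then show ?thesis using False by (simp add: sec_linear field_simps power2_norm_eq_inner)
  qed (simp add: sec_def)
  moreover have "k \<le> sec R \<sigma>" if "\<forall>v. wedge_vol v v = 0 \<longrightarrow> sec (R - k *\<^sub>R mat 1) v \<ge> 0" "\<sigma> \<in> Gr2" for \<sigma>
  proof -
    from that(2) have "wedge_vol \<sigma> \<sigma> = 0" "\<sigma> \<bullet> \<sigma> = 1"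
      by (auto simp: Gr2_def wedge_isotropic norm_eq_1)
    then show ?thesis using that(1) by (fastforce simp: sec_linear)
  qed
  ultimately show ?thesis unfolding sec_ge_def by blast
qed

lemma mem_sec_ge_iff_psd:
  "R \<in> sec_ge k \<longleftrightarrow> R \<in> sym2_bianchi \<and> (\<exists>x. \<forall>v. sec (R - k *\<^sub>R mat 1 + x *\<^sub>R hodge) v \<ge> 0)"
proof
  assume R: "R \<in> sec_ge k"
  then have "transpose R = R" by (simp add: mem_sec_ge_iff_isotropic mem_sym2_bianchi)
  then have s: "transpose (R - k *\<^sub>R mat 1) = R - k *\<^sub>R mat 1"
    by (simp add: transpose_def vec_eq_iff mat_def)
  have p: "sec hodge (axis I12 1 + axis I34 1) > 0" "sec hodge (axis I12 1 - axis I34 1) < 0"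
    by (simp_all add: sec_hodge wedge_vol_def axis_def)
  have "\<exists>x. \<forall>v. sec (R - k *\<^sub>R mat 1 + x *\<^sub>R hodge) v \<ge> 0"
    by (rule finsler[OF s transpose_hodge _ p])
      (use R in \<open>simp add: sec_hodge mem_sec_ge_iff_isotropic\<close>)
  then show "R \<in> sym2_bianchi \<and> (\<exists>x. \<forall>v. sec (R - k *\<^sub>R mat 1 + x *\<^sub>R hodge) v \<ge> 0)"
    using R by (simp add: mem_sec_ge_iff_isotropic)
next
  assume *: "R \<in> sym2_bianchi \<and> (\<exists>x. \<forall>v. sec (R - k *\<^sub>R mat 1 + x *\<^sub>R hodge) v \<ge> 0)"
  then obtain x where x: "\<And>v. sec (R - k *\<^sub>R mat 1 + x *\<^sub>R hodge) v \<ge> 0" by blast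
  have "sec (R - k *\<^sub>R mat 1) v \<ge> 0" if "wedge_vol v v = 0" for v
    using x[of v] that by (simp add: sec_add sec_scaleR[of x] sec_hodge)
  with * show "R \<in> sec_ge k" by (simp add: mem_sec_ge_iff_isotropic)
qed

text \<open>The factor 36 is the number of entries, from a crude bound of the operator norm; only
  its finiteness matters.\<close>

lemma abs_sec_le: "\<bar>sec A v\<bar> \<le> 36 * norm A * (v \<bullet> v)"
proof -
  have "\<bar>A $ i $ j\<bar> \<le> norm A" for i j
    using component_le_norm_cart[of "A $ i" j] Finite_Cartesian_Product.norm_nth_le[of A i] by simp
  from onorm_le_matrix_component[of A, OF this]
  have o: "onorm ((*v) A) \<le> 36 * norm A" by (simp add: UNIV_ix)
  have "\<bar>sec A v\<bar> \<le> norm (A *v v) * norm v" unfolding sec_def by (rule Cauchy_Schwarz_ineq2)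
  also have "\<dots> \<le> onorm ((*v) A) * norm v * norm v"
    by (rule mult_right_mono[OF onorm]) (simp_all add: matrix_vector_mul_bounded_linear)
  also have "\<dots> = onorm ((*v) A) * (v \<bullet> v)"
    by (simp only: power2_norm_eq_inner[symmetric] power2_eq_square mult.assoc)
  also have "\<dots> \<le> 36 * norm A * (v \<bullet> v)" using o by (intro mult_right_mono) auto
  finally show ?thesis .
qed

section \<open>Positive definite operators, closedness and convexity of the curvature
  condition\<close>

definition pos_def :: "endo \<Rightarrow> bool" where
  "pos_def A \<longleftrightarrow> (\<forall>v. v \<noteq> 0 \<longrightarrow> sec A v > 0)"

lemma continuous_on_sec: "continuous_on S (sec A)"
  unfolding sec_def by (intro continuous_intros linear_continuous_on matrix_vector_mul_bounded_linear)

lemma pos_def_margin: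
  assumes "pos_def A"
  obtains \<delta> where "\<delta> > 0" "\<And>v. sec A v \<ge> \<delta> * (v \<bullet> v)"
proof -
  have "\<exists>x\<in>sphere 0 1. \<forall>y\<in>sphere 0 1. sec A x \<le> sec A y"
    by (rule continuous_attains_inf[OF _ _ continuous_on_sec]) auto
  then obtain x where x: "norm x = 1" "\<And>y. norm y = 1 \<Longrightarrow> sec A x \<le> sec A y" by auto
  from x(1) have "x \<noteq> 0" by auto
  then have "sec A x > 0" using assms by (simp add: pos_def_def)
  moreover have "sec A v \<ge> sec A x * (v \<bullet> v)" for v
  proof (cases "v = 0")
    case False
    then have "sec A x \<le> sec A ((1 / norm v) *\<^sub>R v)" by (intro x) simp
    with False show ?thesis
      by (simp add: sec_scaleR_vec power_divide field_simps power2_norm_eq_inner)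
  qed (simp add: sec_def)
  ultimately show ?thesis by (rule that)
qed

lemma pos_def_open:
  assumes "pos_def A"
  obtains e where "e > 0" "\<And>B. dist B A < e \<Longrightarrow> pos_def B"
proof -
  obtain \<delta> where \<delta>: "\<delta> > 0" "\<And>v. sec A v \<ge> \<delta> * (v \<bullet> v)" using pos_def_margin[OF assms] by blast
  have "pos_def B" if "dist B A < \<delta> / 36" for B
    unfolding pos_def_def
  proof (intro allI impI)
    fix v :: "real^ix" assume "v \<noteq> 0"
    then have v: "v \<bullet> v > 0" by simp
    have "\<bar>sec (B - A) v\<bar> \<le> 36 * norm (B - A) * (v \<bullet> v)" by (rule abs_sec_le)
    also have "\<dots> < \<delta> * (v \<bullet> v)" using that v by (intro mult_strict_right_mono) (auto simp: dist_norm)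
    finally show "sec B v > 0" using \<delta>(2)[of v] by (simp add: sec_diff)
  qed
  moreover have "\<delta> / 36 > 0" using \<delta> by simp
  ultimately show ?thesis using that by blast
qed

lemma sec_ge_nhd:
  assumes "pos_def (R - k *\<^sub>R mat 1 + x *\<^sub>R hodge)"
  obtains e where "e > 0" "\<And>R'. R' \<in> sym2_bianchi \<Longrightarrow> dist R' R < e \<Longrightarrow> R' \<in> sec_ge k"
proof -
  obtain e where e: "e > 0" "\<And>B. dist B (R - k *\<^sub>R mat 1 + x *\<^sub>R hodge) < e \<Longrightarrow> pos_def B"
    using pos_def_open[OF assms] by blast
  have "R' \<in> sec_ge k" if "R' \<in> sym2_bianchi" "dist R' R < e" for R'
  proof -
    have "pos_def (R' - k *\<^sub>R mat 1 + x *\<^sub>R hodge)" using that by (intro e) (simp add: dist_norm)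
    then have "sec (R' - k *\<^sub>R mat 1 + x *\<^sub>R hodge) v \<ge> 0" for v
      by (cases "v = 0") (auto simp: pos_def_def sec_def less_eq_real_def)
    with that show ?thesis by (auto simp: mem_sec_ge_iff_psd)
  qed
  with e show ?thesis using that by blast
qed

lemma closed_sym2_bianchi: "closed sym2_bianchi"
  by (rule closed_subspace[OF subspace_sym2_bianchi])

lemma closed_sec_ge: "closed (sec_ge k)"
proof -
  have "sec_ge k = sym2_bianchi \<inter> (\<Inter>\<sigma>\<in>Gr2. {R. k \<le> sec R \<sigma>})"
    by (auto simp: sec_ge_def)
  moreover have "closed {R. k \<le> sec R \<sigma>}" for \<sigma>
  proof -
    have "linear (\<lambda>R. sec R \<sigma>)" by (rule linearI) (simp_all add: sec_linear)
    then have "continuous_on UNIV (\<lambda>R. sec R \<sigma>)"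
      by (simp add: linear_continuous_on linear_conv_bounded_linear)
    then show ?thesis by (intro closed_Collect_le continuous_intros)
  qed
  ultimately show ?thesis by (metis closed_INT closed_Int closed_sym2_bianchi)
qed

lemma convex_sec_ge: "convex (sec_ge k)"
proof (rule convexI)
  fix R Q and u v :: real
  assume R: "R \<in> sec_ge k" and Q: "Q \<in> sec_ge k" and uv: "0 \<le> u" "0 \<le> v" "u + v = 1"
  have "u *\<^sub>R R + v *\<^sub>R Q \<in> sym2_bianchi"
    using R Q subspace_sym2_bianchi by (simp add: sec_ge_def subspace_add subspace_scale)
  moreover have "k \<le> sec (u *\<^sub>R R + v *\<^sub>R Q) \<sigma>" if "\<sigma> \<in> Gr2" for \<sigma>
  proof -
    have "u * k + v * k \<le> u * sec R \<sigma> + v * sec Q \<sigma>"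
      using R Q that uv by (intro add_mono mult_left_mono) (auto simp: sec_ge_def)
    then show ?thesis using uv by (simp add: sec_linear distrib_right[symmetric])
  qed
  ultimately show "u *\<^sub>R R + v *\<^sub>R Q \<in> sec_ge k" by (simp add: sec_ge_def)
qed

section \<open>The pencil and its discriminant\<close>

lemma map_poly_of_real_mult:
  "map_poly of_real (p * q) = map_poly of_real p * (map_poly of_real q :: complex poly)"
  by (rule poly_eqI) (simp add: coeff_map_poly coeff_mult)

lemma map_poly_of_real_sum:
  "map_poly of_real (sum f A) = (\<Sum>x\<in>A. map_poly of_real (f x) :: complex poly)"
  by (rule poly_eqI) (simp add: coeff_map_poly coeff_sum)

lemma map_poly_of_real_prod:
  "map_poly of_real (prod f A) = (\<Prod>x\<in>A. map_poly of_real (f x) :: complex poly)"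
  by (induction A rule: infinite_finite_induct) (simp_all add: map_poly_of_real_mult)

lemma map_poly_of_real_det:
  fixes M :: "real poly^'n^'n"
  shows "map_poly of_real (det M) = (det (\<chi> i j. map_poly of_real (M $ i $ j)) :: complex poly)"
proof -
  have [simp]: "map_poly of_real (of_int m) = (of_int m :: complex poly)" for m
    by (simp add: of_int_poly map_poly_pCons)
  show ?thesis
    by (simp add: det_def map_poly_of_real_sum map_poly_of_real_mult map_poly_of_real_prod)
qed

lemma poly_det:
  fixes M :: "'a::comm_ring_1 poly^'n^'n"
  shows "poly (det M) x = det (\<chi> i j. poly (M $ i $ j) x)"
  by (simp add: det_def poly_sum poly_prod)

definition pencil :: "real \<Rightarrow> endo \<Rightarrow> complex \<Rightarrow> complex^ix^ix" where
  "pencil k R z = (\<chi> I J. of_real ((R - k *\<^sub>R mat 1) $ I $ J) + z * of_real (hodge $ I $ J))"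

lemma poly_complex_pencil_poly:
  "poly (map_poly of_real (pencil_poly k R)) z = det (pencil k R z)"
  by (simp add: pencil_poly_def map_poly_of_real_det poly_det map_poly_pCons pencil_def)

lemma det_eq_0_kernel:
  fixes A :: "'a::field^'n^'n"
  shows "det A = 0 \<longleftrightarrow> (\<exists>v. v \<noteq> 0 \<and> A *v v = 0)"
proof -
  have "det A = 0 \<longleftrightarrow> \<not> (\<exists>B. B ** A = mat 1)"
    using invertible_det_nz[of A] by (auto simp: invertible_def matrix_left_right_inverse)
  then show ?thesis unfolding matrix_left_invertible_ker by blast
qed

text \<open>Only the identity permutation meets x in all factors; any other one meets a constant
  entry and has smaller degree.\<close>

lemma charpoly_monic:
  fixes A :: "'a::idom^'n^'n"
  defines "q \<equiv> det (\<chi> i j. [:A $ i $ j, if i = j then 1 else 0:])"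
  shows "degree q = CARD('n)" "lead_coeff q = 1"
proof -
  let ?M = "\<chi> i j. [:A $ i $ j, if i = j then 1 else 0:]"
  define t where "t p = of_int (sign p) * (\<Prod>i\<in>UNIV. ?M $ i $ p i)" for p :: "'n \<Rightarrow> 'n"
  have q: "q = t id + (\<Sum>p\<in>{p. p permutes UNIV} - {id}. t p)"
    unfolding q_def det_def t_def by (subst sum.remove[where x=id]) (simp_all add: permutes_id finite_permutations)
  have tid: "t id = (\<Prod>i\<in>UNIV. [:A $ i $ i, 1:])" by (simp add: t_def sign_id)
  have did: "degree (t id) = CARD('n)" unfolding tid
    by (subst degree_prod_eq_sum_degree) auto
  have lid: "lead_coeff (t id) = 1" unfolding tid by (simp add: lead_coeff_prod)
  have "degree (t p) < CARD('n)" if p: "p \<in> {p. p permutes UNIV} - {id}" for p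
  proof -
    obtain i0 where i0: "p i0 \<noteq> i0" using p by (auto simp: fun_eq_iff)
    have "degree (t p) \<le> degree (\<Prod>i\<in>UNIV. ?M $ i $ p i)"
      unfolding t_def by (auto simp: sign_def)
    also have "\<dots> \<le> (\<Sum>i\<in>UNIV. degree (?M $ i $ p i))"
      by (rule order_trans[OF degree_prod_sum_le]) auto
    also have "\<dots> \<le> (\<Sum>i\<in>UNIV. if i = i0 then 0 else 1)"
      by (rule sum_mono) (use i0 in auto)
    also have "\<dots> = CARD('n) - 1"
      by (simp add: sum.If_cases Collect_neg_eq[symmetric] card_Diff_singleton Compl_eq_Diff_UNIV)
    also have "\<dots> < CARD('n)" by simp
    finally show ?thesis .
  qed
  then have "degree (\<Sum>p\<in>{p. p permutes UNIV} - {id}. t p) < CARD('n)"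
    by (intro degree_sum_less) auto
  then show "degree q = CARD('n)" "lead_coeff q = 1"
    unfolding q using did lid by (simp_all add: degree_add_eq_left coeff_eq_0)
qed

text \<open>As \<open>hodge\<close> is an involution, R - k Id + x hodge is \<open>hodge\<close>
  times (charmat + x Id). The pencil becomes an ordinary eigenvalue problem: its roots are the
  eigenvalues of \<open>- charmat k R\<close>.\<close>

definition charmat :: "real \<Rightarrow> endo \<Rightarrow> endo" where
  "charmat k R = hodge ** (R - k *\<^sub>R mat 1)"

definition charp :: "endo \<Rightarrow> real poly" where
  "charp A = det (\<chi> I J. [:A $ I $ J, if I = J then 1 else 0:])"

lemma card_ix: "CARD(ix) = 6" by (simp add: UNIV_ix)

lemma degree_charp: "degree (charp A) = 6" and lead_coeff_charp: "lead_coeff (charp A) = 1"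
  using charpoly_monic[of A] by (simp_all add: charp_def card_ix)

lemma det_const_poly:
  fixes A :: "'a::comm_ring_1^'n^'n"
  shows "det (\<chi> i j. [:A $ i $ j:]) = [:det A:]"
proof -
  have p: "(\<Prod>i\<in>S. [:f i:]) = [:prod f S:]" for f :: "'n \<Rightarrow> 'a" and S
    by (induction S rule: infinite_finite_induct) (simp_all add: one_pCons)
  have s: "(\<Sum>i\<in>S. [:f i:]) = [:sum f S:]" for f :: "('n \<Rightarrow> 'n) \<Rightarrow> 'a" and S
    by (induction S rule: infinite_finite_induct) simp_all
  show ?thesis by (simp add: det_def p s of_int_poly mult.commute)
qed

lemma pencil_poly_charp: "pencil_poly k R = smult (det hodge) (charp (charmat k R))"
proof -
  let ?T = "R - k *\<^sub>R mat 1"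
  let ?H = "\<chi> I J. [:hodge $ I $ J:]" and ?C = "\<chi> I J. [:charmat k R $ I $ J, if I = J then 1 else 0:]"
  have hc: "hodge ** charmat k R = ?T"
    by (simp add: charmat_def matrix_mul_assoc hodge_involution)
  have "(?H ** ?C) $ I $ J = [:?T $ I $ J, hodge $ I $ J:]" for I J
  proof -
    have s: "(\<Sum>i\<in>S. [:f i, g i:]) = [:sum f S, sum g S:]" for f g :: "ix \<Rightarrow> real" and S
      by (induction S rule: infinite_finite_induct) simp_all
    have "(?H ** ?C) $ I $ J = [:(hodge ** charmat k R) $ I $ J, (hodge ** mat 1) $ I $ J:]"
      unfolding matrix_matrix_mult_def by (simp add: s mat_def mult.commute)
    then show ?thesis by (simp only: hc matrix_mul_rid)
  qed
  then have "?H ** ?C = (\<chi> I J. [:?T $ I $ J, hodge $ I $ J:])" by (simp add: vec_eq_iff)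
  then have "pencil_poly k R = det (?H ** ?C)" unfolding pencil_poly_def by simp
  then show ?thesis by (simp add: det_mul det_const_poly charp_def)
qed

lemma det_hodge_sq: "(det hodge)\<^sup>2 = 1"
proof -
  have "det (hodge ** hodge) = det (mat 1 :: endo)" by (simp add: hodge_involution)
  then show ?thesis by (simp add: det_mul power2_eq_square)
qed

lemma det_hodge_nonzero: "det hodge \<noteq> 0"
  using det_hodge_sq by auto

lemma degree_pencil_poly: "degree (pencil_poly k R) = 6"
  and lead_coeff_pencil_poly: "lead_coeff (pencil_poly k R) = det hodge"
  using lead_coeff_charp[of "charmat k R"]
  by (simp_all add: pencil_poly_charp det_hodge_nonzero degree_charp)

lemma pencil_poly_nonzero: "pencil_poly k R \<noteq> 0"
  using degree_pencil_poly[of k R] by auto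

definition roots :: "real \<Rightarrow> endo \<Rightarrow> complex list" where
  "roots k R = (SOME rs. mset rs = proots (map_poly of_real (pencil_poly k R)))"

lemma mset_roots: "mset (roots k R) = proots (map_poly of_real (pencil_poly k R))"
  unfolding roots_def by (rule someI_ex) (rule ex_mset)

lemma length_roots: "length (roots k R) = 6"
proof -
  have "length (roots k R) = size (proots (map_poly complex_of_real (pencil_poly k R)))"
    by (metis mset_roots size_mset)
  then show ?thesis by (simp add: size_proots_complex degree_map_poly degree_pencil_poly)
qed

lemma set_roots: "z \<in> set (roots k R) \<longleftrightarrow> det (pencil k R z) = 0"
proof -
  have "z \<in> set (roots k R) \<longleftrightarrow> z \<in># mset (roots k R)" by simp
  also have "\<dots> \<longleftrightarrow> poly (map_poly of_real (pencil_poly k R)) z = 0"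
    unfolding mset_roots using pencil_poly_nonzero[of k R]
    by (simp add: map_poly_eq_0_iff)
  finally show ?thesis by (simp add: poly_complex_pencil_poly)
qed

text \<open>The leading coefficient \<open>det hodge\<close> has square 1 and enters with the even
  exponent 2 * 6 - 2 = 10, so it disappears.\<close>

lemma of_real_disc_poly:
  "of_real (disc_poly k R) = (\<Prod>j<6. \<Prod>i<j. (roots k R ! i - roots k R ! j)\<^sup>2)"
proof -
  have "(complex_of_real (det hodge)) ^ 10 = of_real (((det hodge)\<^sup>2) ^ 5)"
    by (simp only: of_real_power power_mult[symmetric] mult_2_right numeral_times_numeral arith_simps)
  also have "\<dots> = 1" by (simp add: det_hodge_sq)
  finally have "(complex_of_real (det hodge)) ^ 10 = 1" .
  moreover have "2 * length (roots k R) - 2 = 10" by (simp add: length_roots)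
  ultimately show ?thesis
    unfolding disc_poly_def of_real_disc[OF mset_roots] disc_of_roots_def lead_coeff_pencil_poly
    by (simp only: length_roots mult_1)
qed

lemma disc_poly_nonzero_iff: "disc_poly k R \<noteq> 0 \<longleftrightarrow> distinct (roots k R)"
proof -
  have z: "(\<Prod>j<n. \<Prod>i<j. (r i - r j)\<^sup>2) = 0 \<longleftrightarrow> (\<exists>j<n. \<exists>i<j. r i = r j)" for r :: "nat \<Rightarrow> complex" and n
    by (simp add: prod_zero_iff Bex_def)
  have "disc_poly k R \<noteq> 0 \<longleftrightarrow> \<not> (\<exists>j<6. \<exists>i<j. roots k R ! i = roots k R ! j)"
    unfolding z[symmetric] of_real_disc_poly[symmetric] by simp
  also have "\<dots> \<longleftrightarrow> distinct (roots k R)"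
  proof -
    have "(\<not> (\<exists>j<n. \<exists>i<j. f i = f j)) \<longleftrightarrow> (\<forall>i<n. \<forall>j<n. i \<noteq> j \<longrightarrow> f i \<noteq> f j)"
      for f :: "nat \<Rightarrow> complex" and n
      by (smt (verit) less_trans nat_neq_iff)
    then show ?thesis unfolding distinct_conv_nth length_roots .
  qed
  finally show ?thesis .
qed

lemma disc_poly_nonneg:
  assumes "set (roots k R) \<subseteq> \<real>"
  shows "disc_poly k R \<ge> 0"
proof -
  have "roots k R ! i = of_real (Re (roots k R ! i))" if "i < 6" for i
    using assms that by (metis length_roots nth_mem of_real_Re subsetD)
  then have "complex_of_real (disc_poly k R) = (\<Prod>j<6. \<Prod>i<j. (of_real (Re (roots k R ! i)) - of_real (Re (roots k R ! j)))\<^sup>2)"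
    unfolding of_real_disc_poly by (intro prod.cong) auto
  also have "\<dots> = of_real (\<Prod>j<6. \<Prod>i<j. (Re (roots k R ! i) - Re (roots k R ! j))\<^sup>2)"
    by (simp only: of_real_prod of_real_power of_real_diff)
  finally have "disc_poly k R = (\<Prod>j<6. \<Prod>i<j. (Re (roots k R ! i) - Re (roots k R ! j))\<^sup>2)"
    by (simp only: of_real_eq_iff)
  then show ?thesis by (simp only:) (intro prod_nonneg zero_le_power2)
qed

lemma of_real_pencil: "pencil k R (of_real x) = (\<chi> I J. of_real ((R - k *\<^sub>R mat 1 + x *\<^sub>R hodge) $ I $ J))"
  by (simp add: pencil_def)

lemma det_of_real:
  fixes A :: "real^'n^'n"
  shows "det (\<chi> i j. complex_of_real (A $ i $ j)) = of_real (det A)"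
  by (simp add: det_def)

lemma set_roots_of_real: "complex_of_real x \<in> set (roots k R) \<longleftrightarrow> det (R - k *\<^sub>R mat 1 + x *\<^sub>R hodge) = 0"
  unfolding set_roots of_real_pencil det_of_real by simp

lemma disc_poly_nonzeroI:
  assumes "card X = 6" "\<And>x. x \<in> X \<Longrightarrow> det (R - k *\<^sub>R mat 1 + x *\<^sub>R hodge) = 0"
  shows "disc_poly k R \<noteq> 0"
proof -
  have "of_real ` X \<subseteq> set (roots k R)" using assms by (auto simp: set_roots_of_real)
  then have "card (complex_of_real ` X) \<le> card (set (roots k R))" by (rule card_mono[rotated]) simp
  then have "6 \<le> card (set (roots k R))" using assms(1) by (simp add: card_image inj_on_def)
  moreover have "card (set (roots k R)) \<le> 6" using card_length[of "roots k R"] by (simp add: length_roots)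
  ultimately show ?thesis unfolding disc_poly_nonzero_iff by (intro card_distinct) (simp add: length_roots)
qed

text \<open>For a complex kernel vector v = a + i b, the Hermitian values of \<open>?A\<close> and
  \<open>hodge\<close> at v are real and the first is positive. They satisfy h_A(v) + (z - x0)
  h_hodge(v) = 0, which forces z to be real. Facts 3 to 6 are this argument in real
  coordinates.\<close>

lemma roots_real:
  assumes s: "transpose R = R" and p: "pos_def (R - k *\<^sub>R mat 1 + x0 *\<^sub>R hodge)"
  shows "set (roots k R) \<subseteq> \<real>"
proof
  fix z assume "z \<in> set (roots k R)"
  then obtain v where v: "v \<noteq> 0" "pencil k R z *v v = 0"
    unfolding set_roots det_eq_0_kernel by blast
  let ?A = "R - k *\<^sub>R mat 1 + x0 *\<^sub>R hodge"
  define a b where "a = (\<chi> i. Re (v $ i))" and "b = (\<chi> i. Im (v $ i))"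
  define x y where "x = Re z - x0" and "y = Im z"
  have sA: "transpose ?A = ?A"
    using s transpose_hodge by (simp add: transpose_def vec_eq_iff mat_def)
  have 1: "?A *v a + x *\<^sub>R (hodge *v a) - y *\<^sub>R (hodge *v b) = 0"
  proof (rule vec_eq_iff[THEN iffD2], rule allI)
    fix I
    have "Re ((pencil k R z *v v) $ I) = 0" using v by simp
    then show "(?A *v a + x *\<^sub>R (hodge *v a) - y *\<^sub>R (hodge *v b)) $ I = 0 $ I"
      by (simp add: pencil_def matrix_vector_mult_def a_def b_def x_def y_def algebra_simps sum.distrib
          sum_subtractf sum_distrib_left)
  qed
  have 2: "?A *v b + x *\<^sub>R (hodge *v b) + y *\<^sub>R (hodge *v a) = 0"
  proof (rule vec_eq_iff[THEN iffD2], rule allI)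
    fix I
    have "Im ((pencil k R z *v v) $ I) = 0" using v by simp
    then show "(?A *v b + x *\<^sub>R (hodge *v b) + y *\<^sub>R (hodge *v a)) $ I = 0 $ I"
      by (simp add: pencil_def matrix_vector_mult_def a_def b_def x_def y_def algebra_simps sum.distrib
          sum_subtractf sum_distrib_left)
  qed
  have sym: "(hodge *v b) \<bullet> a = (hodge *v a) \<bullet> b" "(?A *v b) \<bullet> a = (?A *v a) \<bullet> b"
    by (rule symmetric_inner[OF transpose_hodge]) (rule symmetric_inner[OF sA])
  have 3: "sec ?A a + x * sec hodge a - y * ((hodge *v a) \<bullet> b) = 0"
    using arg_cong[OF 1, of "\<lambda>u. u \<bullet> a"] by (simp add: sec_def inner_diff_left inner_add_left sym)
  have 4: "sec ?A b + x * sec hodge b + y * ((hodge *v a) \<bullet> b) = 0"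
    using arg_cong[OF 2, of "\<lambda>u. u \<bullet> b"] by (simp add: sec_def inner_diff_left inner_add_left sym)
  have 5: "(?A *v a) \<bullet> b + x * ((hodge *v a) \<bullet> b) - y * sec hodge b = 0"
    using arg_cong[OF 1, of "\<lambda>u. u \<bullet> b"] by (simp add: sec_def inner_diff_left inner_add_left sym)
  have 6: "(?A *v a) \<bullet> b + x * ((hodge *v a) \<bullet> b) + y * sec hodge a = 0"
    using arg_cong[OF 2, of "\<lambda>u. u \<bullet> a"] by (simp add: sec_def inner_diff_left inner_add_left sym)
  have "a \<noteq> 0 \<or> b \<noteq> 0" using v(1) by (auto simp: a_def b_def vec_eq_iff complex_eq_iff)
  then have pos: "sec ?A a + sec ?A b > 0"
    using p by (cases "a = 0"; cases "b = 0") (auto simp: pos_def_def sec_def add_pos_pos)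
  have "y * (sec hodge a + sec hodge b) = 0" using 5 6 by (simp add: algebra_simps)
  moreover have "x * (sec hodge a + sec hodge b) = - (sec ?A a + sec ?A b)" using 3 4 by (simp add: algebra_simps)
  ultimately have "y = 0" using pos by auto
  then show "z \<in> \<real>" by (simp add: y_def complex_is_Real_iff)
qed

lemma disc_poly_pos:
  assumes "transpose R = R" "pos_def (R - k *\<^sub>R mat 1 + x0 *\<^sub>R hodge)" "disc_poly k R \<noteq> 0"
  shows "disc_poly k R > 0"
  using disc_poly_nonneg[OF roots_real[OF assms(1,2)]] assms(3) by simp

text \<open>Null vectors of a semidefinite form are kernel vectors, so on the compact set of unit
  vectors with \<open>sec B v \<le> 0\<close> the form of \<open>A\<close> has a positive minimum. A
  small positive multiple of \<open>B\<close> does not outweigh it there and helps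
  elsewhere.\<close>

lemma pos_def_perturb:
  assumes A: "transpose A = A" and B: "transpose B = B"
    and psd: "\<And>v. sec A v \<ge> 0"
    and ker: "\<And>v. A *v v = 0 \<Longrightarrow> v \<noteq> 0 \<Longrightarrow> sec B v > 0"
  shows "\<exists>y. pos_def (A + y *\<^sub>R B)"
proof -
  have kernel: "A *v v = 0" if v: "sec A v = 0" for v
  proof (rule ccontr)
    assume ne: "A *v v \<noteq> 0"
    define w where "w = A *v v"
    have ww: "w \<bullet> w > 0" using ne by (simp add: w_def)
    \<comment> \<open>For a step of this length from \<open>v\<close> in the direction
      \<open>- w\<close>, the linear decrease beats the quadratic term; the summand 1 excludes
      division by zero.\<close>
    define s where "s = (w \<bullet> w) / (1 + sec A w)"
    have sp: "s > 0" "1 + sec A w > 0" using psd[of w] ww by (auto simp: s_def)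
    have "0 \<le> sec A (v + (- s) *\<^sub>R w)" by (rule psd)
    also have "\<dots> = s * (s * sec A w - 2 * (w \<bullet> w))"
      unfolding sec_add_vec[OF A] sec_scaleR_vec v by (simp add: w_def power2_eq_square algebra_simps)
    finally have "s * sec A w - 2 * (w \<bullet> w) \<ge> 0" using sp by (simp add: zero_le_mult_iff)
    moreover have "s * sec A w \<le> w \<bullet> w" using psd[of w] ww sp by (simp add: s_def field_simps)
    ultimately show False using ww by linarith
  qed
  define Z where "Z = sphere 0 1 \<inter> {v. sec B v \<le> 0}"
  have Z: "compact Z" unfolding Z_def
    by (intro compact_Int_closed compact_sphere closed_Collect_le continuous_on_sec continuous_intros)
  show ?thesis
  proof (cases "Z = {}")
    case True
    have "pos_def (A + 1 *\<^sub>R B)" unfolding pos_def_def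
    proof (intro allI impI)
      fix v :: "real^ix" assume v: "v \<noteq> 0"
      then have "(1 / norm v) *\<^sub>R v \<in> sphere 0 1" by simp
      then have "sec B ((1 / norm v) *\<^sub>R v) > 0" using True unfolding Z_def by fastforce
      then have "sec B v > 0" using v by (simp add: sec_scaleR_vec zero_less_mult_iff)
      then show "sec (A + 1 *\<^sub>R B) v > 0" using psd[of v] by (simp add: sec_add)
    qed
    then show ?thesis by blast
  next
    case False
    obtain z where z: "z \<in> Z" "\<And>v. v \<in> Z \<Longrightarrow> sec A z \<le> sec A v"
      using continuous_attains_inf[OF Z False continuous_on_sec] by blast
    have zp: "sec A z > 0"
    proof -
      have "z \<noteq> 0" "sec B z \<le> 0" using z(1) by (auto simp: Z_def)
      then have "A *v z \<noteq> 0" using ker[of z] by auto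
      then show ?thesis using kernel[of z] psd[of z] by fastforce
    qed
    define y where "y = sec A z / (1 + 36 * norm B)"
    have yp: "y > 0" unfolding y_def using zp by (intro divide_pos_pos) (auto intro: add_pos_nonneg)
    have "sec A z * (36 * norm B) < sec A z * (1 + 36 * norm B)" using zp by simp
    moreover have "1 + 36 * norm B > 0" by (intro add_pos_nonneg) auto
    ultimately have yb: "y * (36 * norm B) < sec A z" unfolding y_def by (simp add: pos_divide_less_eq)
    have unit: "sec (A + y *\<^sub>R B) v > 0" if v: "norm v = 1" for v
    proof (cases "sec B v > 0")
      case True
      then show ?thesis using yp psd[of v] by (simp add: sec_add sec_scaleR add_nonneg_pos)
    next
      case False
      with v have "v \<in> Z" by (simp add: Z_def)
      then have "sec A z \<le> sec A v" by (rule z)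
      moreover have "\<bar>sec B v\<bar> \<le> 36 * norm B"
        using abs_sec_le[of B v] v by (simp add: norm_eq_1)
      then have "y * \<bar>sec B v\<bar> \<le> y * (36 * norm B)" using yp by (intro mult_left_mono) auto
      moreover have "y * sec B v = - (y * \<bar>sec B v\<bar>)" using False by simp
      ultimately show ?thesis using yb by (simp add: sec_add sec_scaleR)
    qed
    have "pos_def (A + y *\<^sub>R B)" unfolding pos_def_def
    proof (intro allI impI)
      fix v :: "real^ix" assume v: "v \<noteq> 0"
      then have "sec (A + y *\<^sub>R B) ((1 / norm v) *\<^sub>R v) > 0" by (intro unit) simp
      then show "sec (A + y *\<^sub>R B) v > 0" using v by (simp add: sec_scaleR_vec zero_less_mult_iff)
    qed
    then show ?thesis by blast
  qed
qed

text \<open>On the kernel of \<open>A\<close> the form of \<open>B\<close> has constant sign: a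
  segment between kernel vectors of opposite sign would contain a null vector of \<open>B\<close>,
  nonzero because the end points are not proportional. So \<open>B\<close> or \<open>- B\<close>
  satisfies the one-sided version.\<close>

lemma pos_def_perturb':
  assumes A: "transpose A = A" and B: "transpose B = B"
    and psd: "\<And>v. sec A v \<ge> 0"
    and ker: "\<And>v. A *v v = 0 \<Longrightarrow> v \<noteq> 0 \<Longrightarrow> sec B v \<noteq> 0"
  shows "\<exists>y. pos_def (A + y *\<^sub>R B)"
proof -
  have same: False if vw: "A *v v = 0" "A *v w = 0" "sec B v > 0" "sec B w < 0" for v w
  proof -
    have "\<exists>t\<ge>0. t \<le> 1 \<and> sec B ((1 - t) *\<^sub>R v + t *\<^sub>R w) = 0"
    proof (rule IVT2')
      show "continuous_on {0..1} (\<lambda>t. sec B ((1 - t) *\<^sub>R v + t *\<^sub>R w))"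
        by (rule continuous_on_compose2[OF continuous_on_sec[of UNIV]]) (auto intro!: continuous_intros)
    qed (use vw in auto)
    then obtain t where t: "0 \<le> t" "t \<le> 1" "sec B ((1 - t) *\<^sub>R v + t *\<^sub>R w) = 0" by blast
    have "A *v ((1 - t) *\<^sub>R v + t *\<^sub>R w) = 0"
      by (simp add: matrix_vector_right_distrib matrix_vector_mult_scaleR vw)
    with ker t(3) have 0: "(1 - t) *\<^sub>R v + t *\<^sub>R w = 0" by blast
    then have "(1 - t) *\<^sub>R v = (- t) *\<^sub>R w" by (simp add: eq_neg_iff_add_eq_0)
    then have "(1 - t)\<^sup>2 * sec B v = t\<^sup>2 * sec B w" by (metis power2_minus sec_scaleR_vec)
    moreover have "(1 - t)\<^sup>2 * sec B v \<ge> 0" "t\<^sup>2 * sec B w \<le> 0"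
      using vw by (simp_all add: mult_nonneg_nonpos)
    ultimately have "(1 - t)\<^sup>2 * sec B v = 0" "t\<^sup>2 * sec B w = 0" by linarith+
    then show False using vw by auto
  qed
  show ?thesis
  proof (cases "\<exists>v. A *v v = 0 \<and> sec B v < 0")
    case True
    have sm: "sec (- B) v = - sec B v" for v using sec_scaleR[of "-1" B v] by simp
    have "\<exists>y. pos_def (A + y *\<^sub>R (- B))"
    proof (rule pos_def_perturb[OF A _ psd])
      show "transpose (- B) = - B" using B by (simp add: transpose_def vec_eq_iff)
      show "sec (- B) v > 0" if "A *v v = 0" "v \<noteq> 0" for v
        using same that True ker[OF that] unfolding sm by (metis linorder_neqE_linordered_idom neg_0_less_iff_less)
    qed
    then obtain y where "pos_def (A + (- y) *\<^sub>R B)" by auto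
    then show ?thesis by blast
  next
    case False
    show ?thesis by (rule pos_def_perturb[OF A B psd]) (use False ker in \<open>metis linorder_neqE_linordered_idom\<close>)
  qed
qed

text \<open>A permutation either fixes \<open>k\<close> and meets the zero entry, or it uses one
  entry of row \<open>k\<close> and another of column \<open>k\<close>, both divisible by
  \<open>d\<close>.\<close>

lemma sq_dvd_det:
  fixes B :: "'a::comm_ring_1^'n^'n"
  assumes z: "B $ k $ k = 0" and r: "\<And>j. d dvd B $ k $ j" and c: "\<And>i. d dvd B $ i $ k"
  shows "d\<^sup>2 dvd det B"
  unfolding det_def
proof (rule dvd_sum, rule dvd_mult)
  fix p assume "p \<in> {p. p permutes (UNIV :: 'n set)}"
  then have p: "p permutes UNIV" by simp
  show "d\<^sup>2 dvd (\<Prod>i\<in>UNIV. B $ i $ p i)"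
  proof (cases "p k = k")
    case True
    then have "(\<Prod>i\<in>UNIV. B $ i $ p i) = 0" using z by (intro prod_zero) (auto intro!: exI[of _ k])
    then show ?thesis by simp
  next
    case False
    obtain j where j: "p j = k" using p by (metis permutes_surj surjD)
    with False have "j \<noteq> k" by auto
    then have "(\<Prod>i\<in>{k, j}. B $ i $ p i) = B $ k $ p k * B $ j $ k" by (simp add: j)
    then have "d\<^sup>2 dvd (\<Prod>i\<in>{k, j}. B $ i $ p i)"
      using r c by (simp add: power2_eq_square mult_dvd_mono)
    also have "\<dots> dvd (\<Prod>i\<in>UNIV. B $ i $ p i)" by (rule prod_dvd_prod_subset) auto
    finally show ?thesis .
  qed
qed

lemma det_isotropic_kernel:
  assumes A: "transpose A = A" and v: "A *v v = 0" "v \<noteq> 0" "wedge_vol v v = 0"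
  obtains s where "\<And>y. det (A + y *\<^sub>R hodge) = y\<^sup>2 * poly s y"
proof -
  obtain k where k: "v $ k \<noteq> 0" using v(2) by (auto simp: vec_eq_iff)
  \<comment> \<open>In a basis starting with \<open>v\<close>, the first row and column of the pencil are multiples of \<open>y\<close>
    and their common entry vanishes.\<close>
  define M :: endo where "M = (\<chi> r c. if c = k then v $ r else if r = c then 1 else 0)"
  have Mx: "(M *v x) $ r = x $ k * v $ r + (if r = k then 0 else x $ r)" for x r
  proof -
    have "(M *v x) $ r = (\<Sum>c\<in>UNIV. (if c = k then x $ k * v $ r else 0) + (if c = r then (if r = k then 0 else x $ r) else 0))"
      unfolding matrix_vector_mult_def vec_lambda_beta by (rule sum.cong) (auto simp: M_def)
    then show ?thesis by (simp add: sum.distrib)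
  qed
  have dM: "det M \<noteq> 0"
  proof
    assume "det M = 0"
    then obtain x where x: "x \<noteq> 0" "M *v x = 0" unfolding det_eq_0_kernel by blast
    have "x $ k = 0" using Mx[of x k] x(2) k by simp
    then have "x $ r = 0" for r using Mx[of x r] x(2) by (cases "r = k") auto
    then show False using x(1) by (simp add: vec_eq_iff)
  qed
  have Mk: "M *v axis k 1 = v"
    by (simp add: vec_eq_iff Mx) (simp add: axis_def)
  define a h where "a = transpose M ** A ** M" and "h = transpose M ** hodge ** M"
  have entry: "(transpose M ** X ** M) $ i $ j = (X *v (M *v axis j 1)) \<bullet> (M *v axis i 1)" for X :: endo and i j
  proof -
    have "(transpose M ** X ** M) $ i $ j = ((transpose M ** X ** M) *v axis j 1) $ i"
      by (simp add: matrix_vector_mult_basis column_def)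
    also have "\<dots> = ((transpose M ** X ** M) *v axis j 1) \<bullet> axis i 1" by (simp add: inner_axis)
    also have "\<dots> = (transpose M *v (X *v (M *v axis j 1))) \<bullet> axis i 1"
      by (simp only: matrix_vector_mul_assoc[symmetric])
    finally show ?thesis by (metis dot_lmul_matrix vector_transpose_matrix transpose_transpose transpose_matrix_vector inner_commute)
  qed
  have ak: "a $ i $ k = 0" "a $ k $ i = 0" for i
    unfolding a_def entry Mk v using symmetric_inner[OF A, of v "M *v axis i 1"] by (simp_all add: v inner_commute)
  have hk: "h $ k $ k = 0" unfolding h_def entry Mk by (simp add: inner_hodge v)
  define B where "B = (\<chi> i j. [:a $ i $ j, h $ i $ j:])"
  have "[:0, 1:]\<^sup>2 dvd det B"
  proof (rule sq_dvd_det)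
    have x: "[:0, 1:] dvd [:0, c:]" for c :: real by (rule dvdI[of _ _ "[:c:]"]) simp
    show "B $ k $ k = 0" by (simp add: B_def ak hk)
    show "[:0, 1:] dvd B $ k $ j" "[:0, 1:] dvd B $ j $ k" for j
      using x by (simp_all add: B_def ak)
  qed
  then obtain s where s: "det B = [:0, 1:]\<^sup>2 * s" by (elim dvdE)
  have "det (A + y *\<^sub>R hodge) = y\<^sup>2 * poly (smult (1 / (det M)\<^sup>2) s) y" for y
  proof -
    have "transpose M ** (A + y *\<^sub>R hodge) ** M = (\<chi> i j. poly (B $ i $ j) y)"
    proof -
      have "(transpose M ** (A + y *\<^sub>R hodge) ** M) $ i $ j = a $ i $ j + y * h $ i $ j" for i j
        unfolding a_def h_def entry
        by (simp add: matrix_vector_mult_add_rdistrib inner_add_left scaleR_matrix_vector_assoc[symmetric])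
      then show ?thesis by (simp add: vec_eq_iff B_def)
    qed
    then have "det (transpose M ** (A + y *\<^sub>R hodge) ** M) = poly (det B) y" by (simp add: poly_det)
    then have "(det M)\<^sup>2 * det (A + y *\<^sub>R hodge) = y\<^sup>2 * poly s y"
      by (simp add: det_mul s power2_eq_square mult_ac)
    then show ?thesis using dM by (simp add: field_simps)
  qed
  then show ?thesis by (rule that)
qed

lemma double_root_disc_poly:
  assumes "\<And>y. det (R - k *\<^sub>R mat 1 + (x + y) *\<^sub>R hodge) = y\<^sup>2 * poly s y"
  shows "disc_poly k R = 0"
proof -
  let ?p = "pencil_poly k R" and ?q = "map_poly complex_of_real (pencil_poly k R)"
  have "poly ?p y = poly ([:-x, 1:]\<^sup>2 * pcompose s [:-x, 1:]) y" for y
    using assms[of "y - x"] by (simp add: poly_pencil_poly poly_pcompose)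
  then have "?p = [:-x, 1:]\<^sup>2 * pcompose s [:-x, 1:]" by (intro poly_eq_poly_eq_iff[THEN iffD1] ext)
  then have "?q = [:-of_real x, 1:]\<^sup>2 * map_poly of_real (pcompose s [:-x, 1:])"
    by (simp add: power2_eq_square map_poly_of_real_mult map_poly_pCons del: mult_pCons_left mult_pCons_right)
  then have "[:-of_real x, 1:]\<^sup>2 dvd ?q" by simp
  moreover have nz: "?q \<noteq> 0" using pencil_poly_nonzero[of k R] by (simp add: map_poly_eq_0_iff)
  ultimately have "2 \<le> order (of_real x) ?q" by (simp add: order_divides)
  then have "2 \<le> count (mset (roots k R)) (of_real x)" using nz by (simp add: mset_roots)
  moreover have "count (mset (roots k R)) (of_real x) \<le> 1" if "distinct (roots k R)"
    using that by (simp add: distinct_count_atmost_1)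
  ultimately have "\<not> distinct (roots k R)" by auto
  then show ?thesis using disc_poly_nonzero_iff by blast
qed

theorem sec_ge_disc_nonzero_pos_def:
  assumes R: "R \<in> sec_ge k" and d: "disc_poly k R \<noteq> 0"
  shows "\<exists>x. pos_def (R - k *\<^sub>R mat 1 + x *\<^sub>R hodge)"
proof -
  obtain x where x: "\<And>v. sec (R - k *\<^sub>R mat 1 + x *\<^sub>R hodge) v \<ge> 0" and Rs: "transpose R = R"
    using R by (auto simp: mem_sec_ge_iff_psd mem_sym2_bianchi)
  let ?A = "R - k *\<^sub>R mat 1 + x *\<^sub>R hodge"
  have sA: "transpose ?A = ?A"
    using Rs transpose_hodge by (simp add: transpose_def vec_eq_iff mat_def)
  have "\<exists>y. pos_def (?A + y *\<^sub>R hodge)"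
  proof (rule pos_def_perturb'[OF sA transpose_hodge x])
    fix v assume v: "?A *v v = 0" "v \<noteq> 0"
    show "sec hodge v \<noteq> 0"
    proof
      assume "sec hodge v = 0"
      then have "wedge_vol v v = 0" by (simp add: sec_hodge)
      from det_isotropic_kernel[OF sA v this] obtain s where "\<And>y. det (?A + y *\<^sub>R hodge) = y\<^sup>2 * poly s y" by blast
      then have "\<And>y. det (R - k *\<^sub>R mat 1 + (x + y) *\<^sub>R hodge) = y\<^sup>2 * poly s y"
        by (simp add: scaleR_add_left add.assoc)
      from double_root_disc_poly[OF this] d show False by simp
    qed
  qed
  then obtain y where "pos_def (R - k *\<^sub>R mat 1 + (x + y) *\<^sub>R hodge)" by (auto simp: scaleR_add_left add.assoc)
  then show ?thesis by blast
qed

section \<open>Pseudo-orthogonal groups\<close>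

definition indefinite_orthogonal :: "('n \<Rightarrow> real) \<Rightarrow> (real^'n^'n) set" where
  "indefinite_orthogonal \<epsilon> = {h. \<forall>p q. (\<Sum>r\<in>UNIV. \<epsilon> r * h $ r $ p * h $ r $ q) = (if p = q then \<epsilon> p else 0)}"

text \<open>A rotation of the rows \<open>i\<close> and \<open>j\<close> for \<sigma> = 1 and a
  hyperbolic rotation for \<sigma> = -1, provided that c^2 + \<sigma> s^2 = 1.\<close>

definition givens :: "real \<Rightarrow> 'n \<Rightarrow> 'n \<Rightarrow> real \<Rightarrow> real \<Rightarrow> real^'n^'n \<Rightarrow> real^'n^'n" where
  "givens \<sigma> i j c s h = (\<chi> r. if r = i then c *\<^sub>R h $ i - (\<sigma> * s) *\<^sub>R h $ j
     else if r = j then s *\<^sub>R h $ i + c *\<^sub>R h $ j else h $ r)"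

locale signs =
  fixes \<epsilon> :: "'n::finite \<Rightarrow> real"
  assumes signs: "\<epsilon> i = 1 \<or> \<epsilon> i = -1"
begin

abbreviation G where "G \<equiv> indefinite_orthogonal \<epsilon>"

lemma sign_sq: "\<epsilon> i * \<epsilon> i = 1" using signs[of i] by auto

lemma OD: "h \<in> G \<Longrightarrow> (\<Sum>r\<in>UNIV. \<epsilon> r * h $ r $ p * h $ r $ q) = (if p = q then \<epsilon> p else 0)"
  by (simp add: indefinite_orthogonal_def)

lemma sum_two:
  fixes f :: "'n \<Rightarrow> real"
  assumes "i \<noteq> j"
  shows "sum f UNIV = f i + f j + sum f (UNIV - {i, j})"
proof -
  have "sum f UNIV = sum f {i, j} + sum f (UNIV - {i, j})"
    using sum.subset_diff[of "{i, j}" UNIV f] by simp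
  then show ?thesis using assms by simp
qed

lemma givens_mem:
  assumes h: "h \<in> G" and ij: "i \<noteq> j" and cs: "c\<^sup>2 + \<epsilon> i * \<epsilon> j * s\<^sup>2 = 1"
  shows "givens (\<epsilon> i * \<epsilon> j) i j c s h \<in> G"
  unfolding indefinite_orthogonal_def
proof (rule CollectI, intro allI)
  fix p q
  let ?g = "givens (\<epsilon> i * \<epsilon> j) i j c s h"
  let ?\<sigma> = "\<epsilon> i * \<epsilon> j"
  have 1: "\<epsilon> i * ?g $ i $ p * ?g $ i $ q + \<epsilon> j * ?g $ j $ p * ?g $ j $ q
     = \<epsilon> i * h $ i $ p * h $ i $ q + \<epsilon> j * h $ j $ p * h $ j $ q"
  proof -
    have id: "e * (c * x - e * f * s * y) * (c * x' - e * f * s * y') + f * (s * x + c * y) * (s * x' + c * y')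
        = e * x * x' + f * y * y'"
      if "e * e = 1" "f * f = 1" "c * c + e * f * (s * s) = 1" for e f x y x' y' :: real
      using that by algebra
    show ?thesis
      using id[OF sign_sq[of i] sign_sq[of j], of "h $ i $ p" "h $ j $ p" "h $ i $ q" "h $ j $ q"] cs ij
      by (simp add: givens_def power2_eq_square)
  qed
  have 2: "(\<Sum>r\<in>UNIV - {i, j}. \<epsilon> r * ?g $ r $ p * ?g $ r $ q) = (\<Sum>r\<in>UNIV - {i, j}. \<epsilon> r * h $ r $ p * h $ r $ q)"
    by (rule sum.cong) (auto simp: givens_def)
  show "(\<Sum>r\<in>UNIV. \<epsilon> r * ?g $ r $ p * ?g $ r $ q) = (if p = q then \<epsilon> p else 0)"
    unfolding OD[OF h, symmetric] sum_two[OF ij] 1 2 ..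
qed

lemma givens_connected:
  assumes h: "h \<in> G" and ij: "i \<noteq> j" and cs: "c\<^sup>2 + \<epsilon> i * \<epsilon> j * s\<^sup>2 = 1" and c: "c \<ge> 0"
  shows "connected_component G h (givens (\<epsilon> i * \<epsilon> j) i j c s h)"
proof -
  let ?\<sigma> = "\<epsilon> i * \<epsilon> j"
  \<comment> \<open>The normalized segment from \<open>(1, 0)\<close> to \<open>(c, s)\<close> stays on the conic because \<open>c \<ge> 0\<close>.\<close>
  define n where "n t = sqrt (((1 - t) + t * c)\<^sup>2 + ?\<sigma> * (t * s)\<^sup>2)" for t
  define g where "g t = givens ?\<sigma> i j (((1 - t) + t * c) / n t) (t * s / n t) h" for t
  have rad: "((1 - t) + t * c)\<^sup>2 + ?\<sigma> * (t * s)\<^sup>2 = (1 - t)\<^sup>2 + 2 * t * (1 - t) * c + t\<^sup>2" for t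
  proof -
    have "((1 - t) + t * c)\<^sup>2 + ?\<sigma> * (t * s)\<^sup>2 = (1 - t)\<^sup>2 + 2 * t * (1 - t) * c + t\<^sup>2 * (c\<^sup>2 + ?\<sigma> * s\<^sup>2)"
      by (simp add: power2_eq_square algebra_simps)
    then show ?thesis using cs by simp
  qed
  have pos: "(1 - t)\<^sup>2 + 2 * t * (1 - t) * c + t\<^sup>2 > 0" if "t \<in> {0..1}" for t
  proof -
    have "2 * t * (1 - t) * c \<ge> 0" using that c by simp
    moreover have "(1 - t)\<^sup>2 + t\<^sup>2 > 0" by (simp add: sum_power2_gt_zero_iff)
    ultimately show ?thesis by linarith
  qed
  have n: "n t > 0" "(n t)\<^sup>2 = ((1 - t) + t * c)\<^sup>2 + ?\<sigma> * (t * s)\<^sup>2" if "t \<in> {0..1}" for t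
    using pos[OF that] unfolding n_def rad by simp_all
  have "g t \<in> G" if "t \<in> {0..1}" for t
    unfolding g_def
  proof (rule givens_mem[OF h ij])
    have "(((1 - t) + t * c) / n t)\<^sup>2 + ?\<sigma> * (t * s / n t)\<^sup>2 = (((1 - t) + t * c)\<^sup>2 + ?\<sigma> * (t * s)\<^sup>2) / (n t)\<^sup>2"
    proof -
      have "(u / m)\<^sup>2 + w * (v / m)\<^sup>2 = (u\<^sup>2 + w * v\<^sup>2) / m\<^sup>2" for u v w m :: real
        by (simp add: power_divide add_divide_distrib)
      then show ?thesis .
    qed
    also have "\<dots> = 1" unfolding n(2)[OF that, symmetric] using n(1)[OF that] by simp
    finally show "(((1 - t) + t * c) / n t)\<^sup>2 + ?\<sigma> * (t * s / n t)\<^sup>2 = 1" .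
  qed
  then have sub: "g ` {0..1} \<subseteq> G" by blast
  have "continuous_on {0..1} g"
  proof -
    have n0: "\<forall>t\<in>{0..1}. n t \<noteq> 0" using n(1) by force
    have cn: "continuous_on {0..1} n" unfolding n_def by (intro continuous_intros)
    have "continuous_on {0..1} (\<lambda>t. g t $ r)" for r
      unfolding g_def givens_def
      by (cases "r = i"; cases "r = j") (use n0 cn in \<open>auto intro!: continuous_intros\<close>)
    then have "continuous_on {0..1} (\<lambda>t. \<chi> r. g t $ r)" by (intro continuous_on_vec_lambda)
    then show ?thesis by simp
  qed
  then have con: "connected (g ` {0..1})" by (intro connected_continuous_image) auto
  have "g 0 = h" by (simp add: g_def n_def givens_def vec_eq_iff)
  moreover have "g 1 = givens ?\<sigma> i j c s h" using cs by (simp add: g_def n_def)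
  ultimately show ?thesis using con sub unfolding connected_component_def
    by (metis atLeastAtMost_iff imageI order_refl zero_le_one)
qed

text \<open>\<open>c\<close> and \<open>s\<close> are proportional to \<open>h $ q $ q\<close> and
  \<open>- h $ j $ q\<close>; the normalization divides by \<open>sqrt ?D\<close>, whence the
  positivity hypothesis. The sign \<open>s0\<close> makes \<open>c\<close> nonnegative, as
  \<open>givens_connected\<close> requires.\<close>

lemma eliminate:
  assumes h: "h \<in> G" and jq: "q \<noteq> j"
    and pos: "h $ j $ q = 0 \<or> (h $ q $ q)\<^sup>2 + \<epsilon> q * \<epsilon> j * (h $ j $ q)\<^sup>2 > 0"
  obtains h' where "connected_component G h h'" "h' $ j $ q = 0" "\<And>r. r \<noteq> q \<Longrightarrow> r \<noteq> j \<Longrightarrow> h' $ r = h $ r"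
    "\<And>p. h $ q $ p = 0 \<Longrightarrow> h $ j $ p = 0 \<Longrightarrow> h' $ q $ p = 0 \<and> h' $ j $ p = 0"
proof (cases "h $ j $ q = 0")
  case True
  show ?thesis by (rule that[of h]) (use h True in auto)
next
  case False
  let ?D = "(h $ q $ q)\<^sup>2 + \<epsilon> q * \<epsilon> j * (h $ j $ q)\<^sup>2"
  have D: "?D > 0" using pos False by blast
  define s0 where "s0 = (if h $ q $ q \<ge> 0 then 1 else -1 :: real)"
  define c where "c = s0 * h $ q $ q / sqrt ?D"
  define s where "s = - s0 * h $ j $ q / sqrt ?D"
  have s0: "s0\<^sup>2 = 1" by (simp add: s0_def)
  have "c\<^sup>2 + \<epsilon> q * \<epsilon> j * s\<^sup>2 = ?D / (sqrt ?D)\<^sup>2"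
    unfolding c_def s_def power_divide power_mult_distrib power2_minus s0 by (simp add: add_divide_distrib)
  also have "\<dots> = 1" using D by simp
  finally have cs: "c\<^sup>2 + \<epsilon> q * \<epsilon> j * s\<^sup>2 = 1" .
  have c: "c \<ge> 0" using D unfolding c_def s0_def by (auto simp: divide_nonpos_pos)
  show ?thesis
    by (rule that[OF givens_connected[OF h jq cs c]])
      (use jq in \<open>auto simp: givens_def c_def s_def\<close>)
qed

text \<open>\<open>K\<close> holds the rows to be cleared in column \<open>q\<close>,
  \<open>Z\<close> the rows already zero there, \<open>A\<close> the finished columns. The pivot row
  and the row being cleared vanish in the columns of \<open>A\<close>, and so do their
  combinations.\<close>

lemma clear_column:
  assumes "finite K" "q \<notin> K" "K \<inter> A = {}" "K \<inter> Z = {}" "q \<notin> A" "q \<notin> Z"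
    and pos: "\<And>h j. h \<in> G \<Longrightarrow> (\<forall>r\<in>Z. h $ r $ q = 0) \<Longrightarrow> j \<in> K \<Longrightarrow>
        h $ j $ q = 0 \<or> (h $ q $ q)\<^sup>2 + \<epsilon> q * \<epsilon> j * (h $ j $ q)\<^sup>2 > 0"
    and h: "h \<in> G" "\<forall>r\<in>Z. h $ r $ q = 0" "\<forall>a\<in>A. \<forall>r. r \<noteq> a \<longrightarrow> h $ r $ a = 0"
  shows "\<exists>h'. connected_component G h h' \<and> (\<forall>r\<in>Z \<union> K. h' $ r $ q = 0) \<and> (\<forall>a\<in>A. \<forall>r. r \<noteq> a \<longrightarrow> h' $ r $ a = 0)"
  using assms(1-4) pos
proof (induction K)
  case empty
  then show ?case using h by (intro exI[of _ h]) auto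
next
  case (insert j K)
  then obtain h1 where h1: "connected_component G h h1" "\<forall>r\<in>Z \<union> K. h1 $ r $ q = 0" "\<forall>a\<in>A. \<forall>r. r \<noteq> a \<longrightarrow> h1 $ r $ a = 0"
    by auto
  have "h1 \<in> G" using h1(1) connected_component_in by blast
  moreover have jq: "q \<noteq> j" using insert by auto
  moreover have "h1 $ j $ q = 0 \<or> (h1 $ q $ q)\<^sup>2 + \<epsilon> q * \<epsilon> j * (h1 $ j $ q)\<^sup>2 > 0"
    using insert.prems(4)[OF \<open>h1 \<in> G\<close>] h1(2) by blast
  ultimately obtain h' where h': "connected_component G h1 h'" "h' $ j $ q = 0" "\<And>r. r \<noteq> q \<Longrightarrow> r \<noteq> j \<Longrightarrow> h' $ r = h1 $ r"
    "\<And>p. h1 $ q $ p = 0 \<Longrightarrow> h1 $ j $ p = 0 \<Longrightarrow> h' $ q $ p = 0 \<and> h' $ j $ p = 0"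
    by (rule eliminate) blast
  have "h' $ r $ q = 0" if "r \<in> Z \<union> insert j K" for r
  proof (cases "r = j")
    case False
    then have "r \<noteq> q" "r \<in> Z \<union> K" using that insert.prems \<open>q \<notin> Z\<close> by auto
    then show ?thesis using h'(3)[of r] False h1(2) by simp
  qed (use h' in simp)
  moreover have "h' $ r $ a = 0" if "a \<in> A" "r \<noteq> a" for a r
  proof -
    have "q \<noteq> a" "j \<noteq> a" using that insert.prems \<open>q \<notin> A\<close> by auto
    then have "h1 $ q $ a = 0" "h1 $ j $ a = 0" "h1 $ r $ a = 0" using h1(3) that by auto
    then show ?thesis using h'(3)[of r] h'(4)[of a] by (cases "r = q"; cases "r = j") auto
  qed
  ultimately show ?case using connected_component_trans[OF h1(1) h'(1)] by blast
qed

text \<open>A hyperbolic elimination needs a pivot larger than the entry to be removed. Therefore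
  the rows with the sign of the pivot are cleared by rotations before the others: then the
  normalization of the column makes the pivot dominate.\<close>

lemma connected_to_diagonal_on:
  assumes "finite A" "h \<in> G"
  shows "\<exists>h'. connected_component G h h' \<and> (\<forall>a\<in>A. \<forall>r. r \<noteq> a \<longrightarrow> h' $ r $ a = 0)"
  using assms(1)
proof (induction A)
  case empty
  then show ?case using assms(2) by (intro exI[of _ h]) auto
next
  case (insert q A)
  then obtain h1 where h1: "connected_component G h h1" "\<forall>a\<in>A. \<forall>r. r \<noteq> a \<longrightarrow> h1 $ r $ a = 0" by blast
  then have h1O: "h1 \<in> G" using connected_component_in by blast
  let ?K = "{r. r \<notin> A \<and> r \<noteq> q \<and> \<epsilon> r = \<epsilon> q}"
  have "\<exists>h'. connected_component G h1 h' \<and> (\<forall>r\<in>{} \<union> ?K. h' $ r $ q = 0) \<and> (\<forall>a\<in>A. \<forall>r. r \<noteq> a \<longrightarrow> h' $ r $ a = 0)"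
  proof (rule clear_column)
    show "h $ j $ q = 0 \<or> (h $ q $ q)\<^sup>2 + \<epsilon> q * \<epsilon> j * (h $ j $ q)\<^sup>2 > 0" if "j \<in> ?K" for h j
    proof -
      have "\<epsilon> q * \<epsilon> j = 1" using that sign_sq[of q] by simp
      then show ?thesis by (cases "h $ j $ q = 0") (simp_all add: add_nonneg_pos)
    qed
  qed (use insert.hyps h1 h1O in auto)
  then obtain h2 where h2: "connected_component G h1 h2" "\<forall>r\<in>?K. h2 $ r $ q = 0"
    "\<forall>a\<in>A. \<forall>r. r \<noteq> a \<longrightarrow> h2 $ r $ a = 0" by auto
  \<comment> \<open>A finished column has one nonzero entry, so orthogonality to it already clears
    the rows of \<open>A\<close> in column \<open>q\<close>.\<close>
  have A0: "g $ a $ q = 0" if "g \<in> G" "\<forall>a\<in>A. \<forall>r. r \<noteq> a \<longrightarrow> g $ r $ a = 0" "a \<in> A" for g a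
  proof -
    have s: "(\<Sum>r\<in>UNIV. \<epsilon> r * g $ r $ a * g $ r $ x) = \<epsilon> a * g $ a $ a * g $ a $ x" for x
      by (subst sum.remove[of _ a]) (use that in \<open>auto intro!: sum.neutral\<close>)
    have "\<epsilon> a * g $ a $ a * g $ a $ a = \<epsilon> a" using OD[OF that(1), of a a] s[of a] by simp
    then have "\<epsilon> a * g $ a $ a \<noteq> 0" using signs[of a] by auto
    moreover have "\<epsilon> a * g $ a $ a * g $ a $ q = 0"
      using OD[OF that(1), of a q] s[of q] insert.hyps that(3) by auto
    ultimately show ?thesis by simp
  qed
  have h2O: "h2 \<in> G" using h2(1) connected_component_in by blast
  let ?Z = "{r. r \<noteq> q \<and> \<epsilon> r = \<epsilon> q}" and ?K' = "{r. r \<notin> A \<and> \<epsilon> r \<noteq> \<epsilon> q}"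
  have "\<exists>h'. connected_component G h2 h' \<and> (\<forall>r\<in>?Z \<union> ?K'. h' $ r $ q = 0) \<and> (\<forall>a\<in>A. \<forall>r. r \<noteq> a \<longrightarrow> h' $ r $ a = 0)"
  proof (rule clear_column)
    fix g j assume g: "g \<in> G" "\<forall>r\<in>?Z. g $ r $ q = 0" and j: "j \<in> ?K'"
    have qj: "q \<noteq> j" using j by auto
    have op: "\<epsilon> q * \<epsilon> r = -1" if "\<epsilon> r \<noteq> \<epsilon> q" for r using signs[of q] signs[of r] that by auto
    \<comment> \<open>\<open>f q\<close> is the square of the pivot and \<open>f j\<close> minus the
      square of the entry to be removed; the other terms are nonpositive and the total is 1.\<close>
    define f where "f r = \<epsilon> q * \<epsilon> r * (g $ r $ q)\<^sup>2" for r
    have "\<epsilon> q * (\<Sum>r\<in>UNIV. \<epsilon> r * g $ r $ q * g $ r $ q) = 1" using OD[OF g(1), of q q] sign_sq by simp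
    then have "sum f UNIV = 1" by (simp add: f_def sum_distrib_left power2_eq_square mult.assoc)
    then have "f q + f j + sum f (UNIV - {q, j}) = 1" unfolding sum_two[OF qj] .
    moreover have "sum f (UNIV - {q, j}) \<le> 0"
    proof (rule sum_nonpos)
      fix r assume "r \<in> UNIV - {q, j}"
      then show "f r \<le> 0" using g(2) op[of r] by (cases "\<epsilon> r = \<epsilon> q") (auto simp: f_def)
    qed
    ultimately have "f q + f j > 0" by linarith
    then show "g $ j $ q = 0 \<or> (g $ q $ q)\<^sup>2 + \<epsilon> q * \<epsilon> j * (g $ j $ q)\<^sup>2 > 0"
      by (simp add: f_def sign_sq)
  next
    show "\<forall>r\<in>?Z. h2 $ r $ q = 0" using A0[OF h2O h2(3)] h2(2) by blast
  qed (use insert.hyps(2) h2O h2(3) in \<open>simp_all (no_asm_simp) add: disjoint_iff\<close>)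
  then obtain h3 where h3: "connected_component G h2 h3" "\<forall>r\<in>?Z \<union> ?K'. h3 $ r $ q = 0"
    "\<forall>a\<in>A. \<forall>r. r \<noteq> a \<longrightarrow> h3 $ r $ a = 0" by (elim exE conjE)
  have h3O: "h3 \<in> G" using h3(1) connected_component_in by blast
  have "h3 $ r $ q = 0" if "r \<noteq> q" for r
  proof (cases "r \<in> A")
    case True
    then show ?thesis by (rule A0[OF h3O h3(3)])
  next
    case False
    then have "r \<in> ?Z \<union> ?K'" using that by blast
    then show ?thesis using h3(2) by blast
  qed
  then have "\<forall>a\<in>insert q A. \<forall>r. r \<noteq> a \<longrightarrow> h3 $ r $ a = 0" using h3(3) by auto
  moreover have "connected_component G h h3" 
    using connected_component_trans[OF connected_component_trans[OF h1(1) h2(1)] h3(1)] .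
  ultimately show ?case by blast
qed

theorem connected_to_sign_matrix:
  assumes "h \<in> G"
  obtains h' where "connected_component G h h'" "\<And>i j. i \<noteq> j \<Longrightarrow> h' $ i $ j = 0" "\<And>i. h' $ i $ i * h' $ i $ i = 1"
proof -
  obtain h' where h': "connected_component G h h'" "\<And>a r. r \<noteq> a \<Longrightarrow> h' $ r $ a = 0"
    using connected_to_diagonal_on[of UNIV, OF _ assms] by auto
  have h'G: "h' \<in> G" using h'(1) connected_component_in by blast
  have "h' $ a $ a * h' $ a $ a = 1" for a
  proof -
    have "(\<Sum>r\<in>UNIV. \<epsilon> r * h' $ r $ a * h' $ r $ a) = \<epsilon> a * h' $ a $ a * h' $ a $ a"
      by (subst sum.remove[of _ a]) (use h' in \<open>auto intro!: sum.neutral\<close>)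
    then have "\<epsilon> a * (h' $ a $ a * h' $ a $ a) = \<epsilon> a" using OD[OF h'G, of a a] by (simp add: mult.assoc)
    then show ?thesis using signs[of a] by auto
  qed
  with h' show ?thesis by (rule that)
qed

end

section \<open>Simultaneous diagonalization\<close>

definition diag :: "('n \<Rightarrow> 'a::zero) \<Rightarrow> 'a^'n^'n" where
  "diag a = (\<chi> i j. if i = j then a i else 0)"

lemma congruence_diag_nth:
  fixes H :: "real^'n^'n"
  shows "(transpose H ** diag a ** H) $ p $ q = (\<Sum>r\<in>UNIV. a r * H $ r $ p * H $ r $ q)"
proof -
  have "(diag a ** H) $ r $ q = a r * H $ r $ q" for r
    by (simp add: matrix_matrix_mult_def diag_def if_distrib if_distribR cong: if_cong)
  then have "(transpose H ** (diag a ** H)) $ p $ q = (\<Sum>r\<in>UNIV. H $ r $ p * (a r * H $ r $ q))"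
    by (simp only: matrix_matrix_mult_def[of "transpose H"] vec_lambda_beta) (simp add: transpose_def)
  then show ?thesis by (simp add: matrix_mul_assoc mult_ac)
qed

lemma mem_indefinite_orthogonal: "H \<in> indefinite_orthogonal \<epsilon> \<longleftrightarrow> transpose H ** diag \<epsilon> ** H = diag \<epsilon>"
  unfolding vec_eq_iff congruence_diag_nth by (simp add: indefinite_orthogonal_def diag_def)

primrec idx :: "ix \<Rightarrow> nat" where
  "idx I12 = 0" | "idx I13 = 1" | "idx I14 = 2" | "idx I23 = 3" | "idx I24 = 4" | "idx I34 = 5"

definition std_sign :: "ix \<Rightarrow> real" where
  "std_sign i = (if idx i < 3 then 1 else -1)"

interpretation std: signs std_sign
  by standard (simp add: std_sign_def)

lemma idx_less: "idx i < 6" by (cases i) auto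

lemma idx_inj: "idx i = idx j \<longleftrightarrow> i = j" by (cases i; cases j) auto

text \<open>The pencil of the congruence of \<open>diag a\<close> by \<open>N\<close> has the roots
  \<open>- std_sign i * a i\<close>. The strict order makes them distinct and fixes their labelling,
  so spectra can be interpolated without a collision.\<close>

definition std_pair :: "endo \<Rightarrow> (ix \<Rightarrow> real) \<Rightarrow> bool" where
  "std_pair N a \<longleftrightarrow> transpose N ** diag std_sign ** N = hodge \<and> (\<forall>i. a i > 0) \<and>
     (\<forall>i j. idx i < idx j \<longrightarrow> std_sign j * a j < std_sign i * a i)"

lemma congruence_entry:
  fixes X M :: "real^'n^'n"
  shows "(transpose M ** X ** M) $ i $ j = (X *v column j M) \<bullet> column i M"
proof -
  have "(transpose M ** X ** M) $ i $ j = (transpose M *v (X *v (M *v axis j 1))) $ i"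
    by (simp only: matrix_vector_mul_assoc) (simp add: matrix_vector_mult_basis column_def matrix_mul_assoc)
  also have "\<dots> = (X *v column j M) \<bullet> column i M"
    unfolding matrix_vector_mult_basis
    by (simp only: matrix_vector_mul_component[of "transpose M"])
      (simp add: transpose_def column_def inner_commute)
  finally show ?thesis .
qed

text \<open>Kernel vectors at distinct roots are orthogonal for both forms. They are not isotropic
  because \<open>P\<close> is definite, so they can be normalized; \<open>N\<close> is the inverse
  of the matrix of these vectors.\<close>

lemma diagonalization:
  assumes P: "transpose P = P" "pos_def P" and X: "card X = 6" "\<And>x. x \<in> X \<Longrightarrow> det (P + x *\<^sub>R hodge) = 0"
  obtains N a where "std_pair N a" "P = transpose N ** diag a ** N"
proof -
  have finX: "finite X" using X(1) card.infinite by fastforce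
  define xs where "xs = sorted_list_of_set X"
  have xs: "length xs = 6" "set xs = X" "sorted_wrt (<) xs" using X(1) finX
    by (simp_all add: xs_def strict_sorted_list_of_set)
  define x where "x i = xs ! idx i" for i
  have xX: "x i \<in> X" for i using xs idx_less[of i] by (auto simp: x_def)
  have xless: "x i < x j" if "idx i < idx j" for i j
    using sorted_wrt_nth_less[OF xs(3) that] idx_less[of j] xs(1) by (simp add: x_def)
  have xinj: "x i \<noteq> x j" if "i \<noteq> j" for i j
    using xless[of i j] xless[of j i] that idx_inj[of i j] by (metis less_irrefl nat_neq_iff)
  have "\<forall>i. \<exists>f. f \<noteq> 0 \<and> (P + x i *\<^sub>R hodge) *v f = 0"
    using X(2)[OF xX] unfolding det_eq_0_kernel by blast
  then obtain f0 where f0: "\<And>i. f0 i \<noteq> 0" "\<And>i. (P + x i *\<^sub>R hodge) *v f0 i = 0" by metis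
  define f where "f i = (1 / sqrt \<bar>sec hodge (f0 i)\<bar>) *\<^sub>R f0 i" for i
  have s0: "sec hodge (f0 i) \<noteq> 0" for i
  proof
    assume *: "sec hodge (f0 i) = 0"
    have "sec (P + x i *\<^sub>R hodge) (f0 i) = 0" by (simp add: sec_def f0)
    then have "sec P (f0 i) = 0" by (simp add: sec_add sec_scaleR *)
    then show False using P(2) f0(1)[of i] by (auto simp: pos_def_def)
  qed
  have f: "f i \<noteq> 0" "(P + x i *\<^sub>R hodge) *v f i = 0" "\<bar>sec hodge (f i)\<bar> = 1" for i
  proof -
    show "f i \<noteq> 0" using s0 f0 by (simp add: f_def)
    show "(P + x i *\<^sub>R hodge) *v f i = 0" by (simp add: f_def matrix_vector_mult_scaleR f0)
    show "\<bar>sec hodge (f i)\<bar> = 1" using s0[of i] by (simp add: f_def sec_scaleR_vec power_divide abs_mult)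
  qed
  have Pf: "P *v f i = - (x i *\<^sub>R (hodge *v f i))" for i
    using f(2)[of i] by (simp add: matrix_vector_mult_add_rdistrib scaleR_matrix_vector_assoc[symmetric] eq_neg_iff_add_eq_0)
  define \<epsilon> where "\<epsilon> i = sec hodge (f i)" for i
  have \<epsilon>: "\<epsilon> i = 1 \<or> \<epsilon> i = -1" for i using f(3)[of i] by (auto simp: \<epsilon>_def abs_if split: if_splits)
  define a where "a i = sec P (f i)" for i
  have a: "a i > 0" for i using P(2) f(1) by (simp add: a_def pos_def_def)
  have ax: "a i = - x i * \<epsilon> i" for i by (simp add: a_def \<epsilon>_def sec_def Pf)
  have \<epsilon>a: "\<epsilon> i * a i = - x i" for i using \<epsilon>[of i] by (auto simp: ax)
  have orth: "(hodge *v f i) \<bullet> f j = 0" if "i \<noteq> j" for i j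
  proof -
    have "(P *v f i) \<bullet> f j = (P *v f j) \<bullet> f i" by (rule symmetric_inner[OF P(1)])
    then have "x i * ((hodge *v f i) \<bullet> f j) = x j * ((hodge *v f i) \<bullet> f j)"
      using symmetric_inner[OF transpose_hodge, of "f i" "f j"] by (simp add: Pf)
    then show ?thesis using xinj[OF that] by simp
  qed
  define F :: endo where "F = (\<chi> r c. f c $ r)"
  have col: "column j F = f j" for j by (simp add: F_def column_def vec_eq_iff)
  have FhF: "transpose F ** hodge ** F = diag \<epsilon>"
    unfolding vec_eq_iff congruence_entry col using orth by (auto simp: diag_def \<epsilon>_def sec_def)
  have FPF: "transpose F ** P ** F = diag a"
    unfolding vec_eq_iff congruence_entry col using orth by (auto simp: diag_def a_def sec_def) (auto simp: Pf)
  have detF: "det F \<noteq> 0"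
  proof
    assume "det F = 0"
    then have "det (transpose F ** P ** F) = 0" by (simp add: det_mul)
    moreover have "det (diag a) = (\<Prod>i\<in>UNIV. a i)" by (subst det_diagonal) (auto simp: diag_def)
    moreover have "(\<Prod>i\<in>UNIV. a i) > 0" using a by (simp add: prod_pos)
    ultimately show False by (metis FPF less_irrefl)
  qed
  have secF: "sec hodge (F *v c) = (\<Sum>i\<in>UNIV. \<epsilon> i * (c $ i)\<^sup>2)" for c
  proof -
    have "sec hodge (F *v c) = ((transpose F ** hodge ** F) *v c) \<bullet> c"
      unfolding sec_def by (metis dot_lmul_matrix matrix_vector_mul_assoc vector_transpose_matrix inner_commute)
    also have "\<dots> = (\<Sum>i\<in>UNIV. \<epsilon> i * (c $ i)\<^sup>2)"
      unfolding FhF by (simp add: diag_def inner_vec_def matrix_vector_mult_def if_distrib if_distribR power2_eq_square mult.assoc cong: if_cong)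
    finally show ?thesis .
  qed
  \<comment> \<open>By \<open>ax\<close> and positivity of \<open>a\<close>, the sign
    \<open>\<epsilon> i\<close> is opposite to that of \<open>x i\<close>; the roots increase with
    \<open>idx\<close>, so the positive signs come first.\<close>
  have mono: "\<epsilon> i = 1" if "\<epsilon> j = 1" "idx i < idx j" for i j
    using xless[OF that(2)] ax[of i] a[of i] ax[of j] a[of j] \<epsilon>[of i] that(1) by auto
  \<comment> \<open>Inertia: if four of the signs were equal, a nonzero combination of the corresponding
    eigenvectors would lie in a definite 3-space of the opposite sign.\<close>
  have neg: "\<epsilon> I23 = -1"
  proof (rule ccontr)
    assume "\<epsilon> I23 \<noteq> -1"
    then have e23: "\<epsilon> I23 = 1" using \<epsilon> by blast
    then have e: "\<epsilon> I12 = 1" "\<epsilon> I13 = 1" "\<epsilon> I14 = 1" by (simp_all add: mono[OF e23])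
    \<comment> \<open>Rows I12, I13, I14 of \<open>B *v c = 0\<close> say that \<open>F *v c\<close>
      is anti-self-dual; rows I24 and I34 remove two coordinates of \<open>c\<close>. The zero row
      leaves five equations in six unknowns.\<close>
    define B :: endo where "B = (\<chi> r. case r of I12 \<Rightarrow> F $ I12 + F $ I34 | I13 \<Rightarrow> F $ I13 - F $ I24
      | I14 \<Rightarrow> F $ I14 + F $ I23 | I23 \<Rightarrow> 0 | I24 \<Rightarrow> axis I24 1 | I34 \<Rightarrow> axis I34 1)"
    have "det B = 0" by (rule det_zero_row(1)[of I23]) (simp add: B_def row_def vec_eq_iff)
    then obtain c where c: "c \<noteq> 0" "B *v c = 0" unfolding det_eq_0_kernel by blast
    have Bc: "(B *v c) $ r = B $ r \<bullet> c" for r by (simp add: matrix_vector_mul_component)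
    let ?v = "F *v c"
    have Fr: "F $ r \<bullet> c = ?v $ r" for r by (simp add: matrix_vector_mul_component)
    have v: "?v $ I12 = - ?v $ I34" "?v $ I13 = ?v $ I24" "?v $ I14 = - ?v $ I23" and c0: "c $ I24 = 0" "c $ I34 = 0"
      using Bc[of I12] Bc[of I13] Bc[of I14] Bc[of I24] Bc[of I34] unfolding c
      by (simp_all add: B_def inner_add_left inner_diff_left Fr inner_axis' eq_neg_iff_add_eq_0)
    have "sec hodge ?v = - 2 * ((?v $ I34)\<^sup>2 + (?v $ I24)\<^sup>2 + (?v $ I23)\<^sup>2)"
      by (simp add: sec_hodge wedge_vol_def v power2_eq_square)
    also have "\<dots> \<le> 0" by (intro mult_nonpos_nonneg) simp_all
    finally have "sec hodge ?v \<le> 0" .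
    moreover have "sec hodge ?v = (c $ I12)\<^sup>2 + (c $ I13)\<^sup>2 + (c $ I14)\<^sup>2 + (c $ I23)\<^sup>2"
      by (simp add: secF sum_ix e e23 c0)
    ultimately have "(c $ I12)\<^sup>2 = 0 \<and> (c $ I13)\<^sup>2 = 0 \<and> (c $ I14)\<^sup>2 = 0 \<and> (c $ I23)\<^sup>2 = 0"
      by (smt (verit) zero_le_power2)
    then have "c $ i = 0" for i using c0 by (cases i) auto
    then show False using c(1) by (simp add: vec_eq_iff)
  qed
  have pos: "\<epsilon> I14 = 1"
  proof (rule ccontr)
    assume "\<epsilon> I14 \<noteq> 1"
    then have e14: "\<epsilon> I14 = -1" using \<epsilon> by blast
    have e: "\<epsilon> I23 = -1" "\<epsilon> I24 = -1" "\<epsilon> I34 = -1"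
      using \<epsilon>[of I23] \<epsilon>[of I24] \<epsilon>[of I34] mono[of I23 I14] mono[of I24 I14] mono[of I34 I14] e14 by auto
    define B :: endo where "B = (\<chi> r. case r of I34 \<Rightarrow> F $ I12 - F $ I34 | I24 \<Rightarrow> F $ I13 + F $ I24
      | I23 \<Rightarrow> F $ I14 - F $ I23 | I14 \<Rightarrow> 0 | I12 \<Rightarrow> axis I12 1 | I13 \<Rightarrow> axis I13 1)"
    have "det B = 0" by (rule det_zero_row(1)[of I14]) (simp add: B_def row_def vec_eq_iff)
    then obtain c where c: "c \<noteq> 0" "B *v c = 0" unfolding det_eq_0_kernel by blast
    have Bc: "(B *v c) $ r = B $ r \<bullet> c" for r by (simp add: matrix_vector_mul_component)
    let ?v = "F *v c"
    have Fr: "F $ r \<bullet> c = ?v $ r" for r by (simp add: matrix_vector_mul_component)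
    have v: "?v $ I12 = ?v $ I34" "?v $ I13 = - ?v $ I24" "?v $ I14 = ?v $ I23" and c0: "c $ I12 = 0" "c $ I13 = 0"
      using Bc[of I12] Bc[of I13] Bc[of I34] Bc[of I24] Bc[of I23] unfolding c
      by (simp_all add: B_def inner_add_left inner_diff_left Fr inner_axis' eq_neg_iff_add_eq_0)
    have "sec hodge ?v = 2 * ((?v $ I34)\<^sup>2 + (?v $ I24)\<^sup>2 + (?v $ I23)\<^sup>2)"
      by (simp add: sec_hodge wedge_vol_def v power2_eq_square)
    then have "sec hodge ?v \<ge> 0" by simp
    moreover have "sec hodge ?v = - ((c $ I14)\<^sup>2 + (c $ I23)\<^sup>2 + (c $ I24)\<^sup>2 + (c $ I34)\<^sup>2)"
      by (simp add: secF sum_ix e e14 c0)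
    ultimately have "(c $ I14)\<^sup>2 = 0 \<and> (c $ I23)\<^sup>2 = 0 \<and> (c $ I24)\<^sup>2 = 0 \<and> (c $ I34)\<^sup>2 = 0"
      by (smt (verit) zero_le_power2)
    then have "c $ i = 0" for i using c0 by (cases i) auto
    then show False using c(1) by (simp add: vec_eq_iff)
  qed
  have "\<epsilon> i = std_sign i" for i
    using pos neg mono[of I14 I12] mono[of I14 I13] mono[of I24 I23] mono[of I34 I23] \<epsilon>[of I24] \<epsilon>[of I34]
    by (cases i) (auto simp: std_sign_def)
  then have \<epsilon>s: "\<epsilon> = std_sign" by blast
  obtain N where N: "F ** N = mat 1" "N ** F = mat 1"
    using detF invertible_det_nz[of F] by (auto simp: invertible_def)
  have inv_congr: "transpose N ** (transpose F ** Y ** F) ** N = Y" for Y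
  proof -
    have "transpose N ** (transpose F ** Y ** F) ** N = transpose (F ** N) ** Y ** (F ** N)"
      by (simp add: matrix_transpose_mul matrix_mul_assoc)
    then show ?thesis by (simp add: N transpose_mat)
  qed
  show ?thesis
  proof (rule that)
    show "P = transpose N ** diag a ** N" using inv_congr[of P] by (simp add: FPF)
    show "std_pair N a" unfolding std_pair_def
      using inv_congr[of hodge] a xless by (simp add: FhF \<epsilon>s[symmetric] \<epsilon>a)
  qed
qed

text \<open>The projection along \<open>*\<close> onto the operators satisfying the Bianchi identity, translated by \<open>k Id\<close>
  (the factor 3 is \<open>bianchi hodge\<close>).\<close>

definition shift_bianchi :: "real \<Rightarrow> endo \<Rightarrow> endo" where
  "shift_bianchi k P = k *\<^sub>R mat 1 + P - (bianchi P / 3) *\<^sub>R hodge"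

lemma shift_bianchi_mem:
  assumes "transpose P = P"
  shows "shift_bianchi k P \<in> sym2_bianchi"
proof -
  have "transpose (shift_bianchi k P) = shift_bianchi k P"
    using assms transpose_hodge by (simp add: shift_bianchi_def transpose_def vec_eq_iff mat_def)
  moreover have "bianchi (shift_bianchi k P) = 0" by (simp add: shift_bianchi_def bianchi_linear)
  ultimately show ?thesis by (simp add: mem_sym2_bianchi)
qed

lemma shift_bianchi_pencil:
  "shift_bianchi k P - k *\<^sub>R mat 1 + x *\<^sub>R hodge = P + (x - bianchi P / 3) *\<^sub>R hodge"
  by (simp add: shift_bianchi_def scaleR_diff_left)

lemma transpose_diag: "transpose (diag a) = diag a"
  by (simp add: transpose_def diag_def vec_eq_iff)

lemma transpose_congruence:
  fixes N :: "real^'n^'n"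
  shows "transpose X = X \<Longrightarrow> transpose (transpose N ** X ** N) = transpose N ** X ** N"
  by (simp add: matrix_transpose_mul matrix_mul_assoc)

lemma sec_congruence: "sec (transpose N ** X ** N) v = sec X (N *v v)"
  unfolding sec_def by (metis dot_lmul_matrix matrix_vector_mul_assoc vector_transpose_matrix inner_commute)

lemma sec_diag: "sec (diag a) v = (\<Sum>i\<in>UNIV. a i * (v $ i)\<^sup>2)"
  by (simp add: sec_def diag_def inner_vec_def matrix_vector_mult_def if_distrib if_distribR power2_eq_square mult.assoc cong: if_cong)

lemma std_pair_det:
  assumes "std_pair N a"
  shows "det N \<noteq> 0"
proof
  assume "det N = 0"
  then have "det (transpose N ** diag std_sign ** N) = 0" by (simp add: det_mul)
  then show False using assms det_hodge_nonzero by (simp add: std_pair_def)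
qed

definition main_region :: "real \<Rightarrow> endo set" where
  "main_region k = {R \<in> sec_ge k. disc_poly k R > 0}"

lemma std_pair_main_region:
  assumes Na: "std_pair N a"
  shows "shift_bianchi k (transpose N ** diag a ** N) \<in> main_region k"
proof -
  let ?P = "transpose N ** diag a ** N"
  let ?R = "shift_bianchi k ?P"
  have a: "a i > 0" for i using Na by (simp add: std_pair_def)
  have h: "transpose N ** diag std_sign ** N = hodge" using Na by (simp add: std_pair_def)
  have sP: "transpose ?P = ?P" by (rule transpose_congruence) (rule transpose_diag)
  have V: "?R \<in> sym2_bianchi" by (rule shift_bianchi_mem[OF sP])
  have "sec ?P v > 0" if "v \<noteq> 0" for v
  proof -
    have "N *v v \<noteq> 0" using std_pair_det[OF Na] that unfolding det_eq_0_kernel by blast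
    then obtain i where i: "(N *v v) $ i \<noteq> 0" by (auto simp: vec_eq_iff)
    have "sec ?P v = (\<Sum>i\<in>UNIV. a i * ((N *v v) $ i)\<^sup>2)" by (simp only: sec_congruence sec_diag)
    also have "\<dots> > 0" using a i by (intro sum_pos2[of UNIV i]) (auto simp: less_imp_le)
    finally show ?thesis .
  qed
  then have "pos_def ?P" by (simp add: pos_def_def)
  then have pd: "pos_def (?R - k *\<^sub>R mat 1 + (bianchi ?P / 3) *\<^sub>R hodge)"
    by (simp add: shift_bianchi_pencil)
  then have "sec (?R - k *\<^sub>R mat 1 + (bianchi ?P / 3) *\<^sub>R hodge) v \<ge> 0" for v
    by (cases "v = 0") (auto simp: pos_def_def sec_def less_eq_real_def)
  with V have "?R \<in> sec_ge k" by (auto simp: mem_sec_ge_iff_psd)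
  \<comment> \<open>The roots of the pencil of \<open>?P\<close>, translated because
    \<open>shift_bianchi\<close> subtracts a multiple of \<open>hodge\<close>.\<close>
  define x where "x i = bianchi ?P / 3 - std_sign i * a i" for i
  have "disc_poly k ?R \<noteq> 0"
  proof (rule disc_poly_nonzeroI)
    have "inj x"
    proof (rule injI)
      fix i j assume "x i = x j"
      then have "std_sign i * a i = std_sign j * a j" by (simp add: x_def)
      then show "i = j" using Na unfolding std_pair_def by (metis less_irrefl nat_neq_iff idx_inj)
    qed
    then show "card (range x) = 6" by (simp add: card_image card_ix)
  next
    fix y assume "y \<in> range x"
    then obtain i where y: "y = x i" by blast
    have "?R - k *\<^sub>R mat 1 + y *\<^sub>R hodge = ?P - (std_sign i * a i) *\<^sub>R hodge"
      by (simp add: shift_bianchi_pencil y x_def)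
    also have "\<dots> = transpose N ** diag (\<lambda>j. a j - std_sign i * a i * std_sign j) ** N"
      unfolding vec_eq_iff
      by (subst h[symmetric]) (simp add: congruence_diag_nth sum_subtractf sum_distrib_left left_diff_distrib mult.assoc)
    also have "det \<dots> = 0"
    proof -
      have "det (diag (\<lambda>j. a j - std_sign i * a i * std_sign j)) = 0"
        by (rule det_zero_row(1)[of i])
          (simp add: diag_def row_def vec_eq_iff mult.commute mult.left_commute std.sign_sq)
      then show ?thesis by (simp add: det_mul)
    qed
    finally show "det (?R - k *\<^sub>R mat 1 + y *\<^sub>R hodge) = 0" .
  qed
  moreover have "transpose ?R = ?R" using V by (simp add: mem_sym2_bianchi)
  ultimately have "disc_poly k ?R > 0" using disc_poly_pos pd by blast
  with \<open>?R \<in> sec_ge k\<close> show ?thesis by (simp add: main_region_def)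
qed

lemma main_region_std_pair:
  assumes "R \<in> main_region k"
  obtains N a where "std_pair N a" "R = shift_bianchi k (transpose N ** diag a ** N)"
proof -
  have R: "R \<in> sec_ge k" "disc_poly k R \<noteq> 0" using assms by (auto simp: main_region_def)
  then have V: "transpose R = R" "bianchi R = 0" by (auto simp: mem_sec_ge_iff_psd mem_sym2_bianchi)
  obtain x where x: "pos_def (R - k *\<^sub>R mat 1 + x *\<^sub>R hodge)"
    using sec_ge_disc_nonzero_pos_def[OF R] by blast
  let ?P = "R - k *\<^sub>R mat 1 + x *\<^sub>R hodge"
  have sP: "transpose ?P = ?P" using V transpose_hodge by (simp add: transpose_def vec_eq_iff mat_def)
  define X where "X = (\<lambda>z. Re z - x) ` set (roots k R)"
  have real: "set (roots k R) \<subseteq> \<real>" by (rule roots_real[OF V(1) x])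
  have "inj_on (\<lambda>z. Re z - x) (set (roots k R))"
  proof (rule inj_onI)
    fix z w assume "z \<in> set (roots k R)" "w \<in> set (roots k R)" "Re z - x = Re w - x"
    then show "z = w" using real by (metis diff_add_cancel of_real_Re subsetD)
  qed
  then have "card X = 6" using R(2) unfolding disc_poly_nonzero_iff
    by (simp add: X_def card_image distinct_card length_roots)
  moreover have "det (?P + y *\<^sub>R hodge) = 0" if yX: "y \<in> X" for y
  proof -
    obtain z where z: "z \<in> set (roots k R)" "y = Re z - x" using yX unfolding X_def by blast
    then have "complex_of_real (x + y) \<in> set (roots k R)" using real by (metis add.commute diff_add_cancel of_real_Re subsetD)
    then have "det (R - k *\<^sub>R mat 1 + (x + y) *\<^sub>R hodge) = 0" by (simp only: set_roots_of_real)
    then show ?thesis by (simp only: scaleR_add_left add.assoc)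
  qed
  ultimately obtain N a where "std_pair N a" "?P = transpose N ** diag a ** N"
    using diagonalization[OF sP x] by metis
  moreover have "R = shift_bianchi k ?P" by (simp add: shift_bianchi_def bianchi_linear V)
  ultimately show ?thesis using that by metis
qed

lemma continuous_on_matrix_mult:
  fixes f g :: "'a::topological_space \<Rightarrow> real^'n^'n"
  assumes "continuous_on S f" "continuous_on S g"
  shows "continuous_on S (\<lambda>x. f x ** g x)"
  unfolding matrix_matrix_mult_def using assms
  by (intro continuous_on_vec_lambda continuous_intros)

lemma continuous_on_shift_bianchi:
  assumes "continuous_on S f"
  shows "continuous_on S (\<lambda>x. shift_bianchi k (f x))"
  unfolding shift_bianchi_def bianchi_def using assms by (intro continuous_intros) auto

lemma connected_main_region: "connected (main_region k)"
proof (cases "main_region k = {}")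
  case False
  then obtain R0 where "R0 \<in> main_region k" by blast
  then obtain N0 a0 where 0: "std_pair N0 a0" "R0 = shift_bianchi k (transpose N0 ** diag a0 ** N0)"
    by (rule main_region_std_pair)
  obtain M where M: "M ** N0 = mat 1" "N0 ** M = mat 1"
    using std_pair_det[OF 0(1)] invertible_det_nz[of N0] by (auto simp: invertible_def)
  have "connected_component (main_region k) R R0" if RC: "R \<in> main_region k" for R
  proof -
    obtain N a where Na: "std_pair N a" "R = shift_bianchi k (transpose N ** diag a ** N)"
      by (rule main_region_std_pair[OF RC])
    have h: "transpose N ** diag std_sign ** N = hodge" "transpose N0 ** diag std_sign ** N0 = hodge"
      using Na 0 by (auto simp: std_pair_def)
    \<comment> \<open>The change from \<open>N0\<close> to \<open>N\<close>. Both carry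
      \<open>diag std_sign\<close> to \<open>hodge\<close>, so \<open>?H\<close> preserves
      \<open>diag std_sign\<close>.\<close>
    let ?H = "N ** M"
    have "transpose ?H ** diag std_sign ** ?H = transpose M ** (transpose N ** diag std_sign ** N) ** M"
      by (simp add: matrix_transpose_mul matrix_mul_assoc)
    also have "\<dots> = transpose (N0 ** M) ** diag std_sign ** (N0 ** M)"
      unfolding h(1) h(2)[symmetric] by (simp add: matrix_transpose_mul matrix_mul_assoc)
    also have "\<dots> = diag std_sign" by (simp add: M transpose_mat)
    finally have HG: "?H \<in> std.G" by (simp add: mem_indefinite_orthogonal)
    obtain S where S: "connected_component std.G ?H S" "\<And>i j. i \<noteq> j \<Longrightarrow> S $ i $ j = 0" "\<And>i. S $ i $ i * S $ i $ i = 1"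
      using std.connected_to_sign_matrix[OF HG] by blast
    define \<phi> where "\<phi> H = shift_bianchi k (transpose (H ** N0) ** diag a ** (H ** N0))" for H
    have \<phi>: "\<phi> H \<in> main_region k" if "H \<in> std.G" for H
      unfolding \<phi>_def
    proof (rule std_pair_main_region)
      have "transpose (H ** N0) ** diag std_sign ** (H ** N0) = transpose N0 ** (transpose H ** diag std_sign ** H) ** N0"
        by (simp add: matrix_transpose_mul matrix_mul_assoc)
      also have "\<dots> = hodge" using that h by (simp add: mem_indefinite_orthogonal)
      finally show "std_pair (H ** N0) a" using Na(1) by (simp add: std_pair_def)
    qed
    have cont: "continuous_on std.G \<phi>"
      unfolding \<phi>_def transpose_def
      by (intro continuous_on_shift_bianchi continuous_on_matrix_mult continuous_on_vec_lambda continuous_intros) 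
    obtain T where T: "connected T" "T \<subseteq> std.G" "?H \<in> T" "S \<in> T"
      using S(1) unfolding connected_component_def by blast
    have "connected (\<phi> ` T)" by (rule connected_continuous_image[OF continuous_on_subset[OF cont T(2)] T(1)])
    then have 1: "connected_component (main_region k) (\<phi> ?H) (\<phi> S)"
      using T \<phi> unfolding connected_component_def by blast
    have H: "\<phi> ?H = R" by (simp add: \<phi>_def Na(2) matrix_mul_assoc[symmetric] M)
    have "transpose S ** diag a ** S = diag a"
    proof -
      have "(\<Sum>r\<in>UNIV. a r * S $ r $ p * S $ r $ q) = (if p = q then a p else 0)" for p q
        by (subst sum.remove[of _ p]) (use S(2,3) in \<open>auto intro!: sum.neutral simp: mult.assoc\<close>)
      then show ?thesis unfolding vec_eq_iff congruence_diag_nth by (simp add: diag_def)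
    qed
    then have \<phi>S: "\<phi> S = shift_bianchi k (transpose N0 ** diag a ** N0)"
      by (simp add: \<phi>_def matrix_transpose_mul matrix_mul_assoc) (metis matrix_mul_assoc)
    define \<psi> where "\<psi> t = shift_bianchi k (transpose N0 ** diag (\<lambda>i. (1 - t) * a i + t * a0 i) ** N0)" for t
    have \<psi>: "\<psi> t \<in> main_region k" if "t \<in> {0..1}" for t
      unfolding \<psi>_def
    proof (rule std_pair_main_region)
      have "(1 - t) * a i + t * a0 i > 0" for i
        using Na(1) 0(1) that convex_bound_lt[of "- a i" 0 "- a0 i" "1 - t" t] by (simp add: std_pair_def)
      moreover have "std_sign j * ((1 - t) * a j + t * a0 j) < std_sign i * ((1 - t) * a i + t * a0 i)" if "idx i < idx j" for i j
      proof -
        have "std_sign j * a j - std_sign i * a i < 0" "std_sign j * a0 j - std_sign i * a0 i < 0"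
          using Na(1) 0(1) that by (auto simp: std_pair_def)
        then have "(1 - t) * (std_sign j * a j - std_sign i * a i) + t * (std_sign j * a0 j - std_sign i * a0 i) < 0"
          using \<open>t \<in> {0..1}\<close> by (intro convex_bound_lt) auto
        then show ?thesis by (simp add: algebra_simps)
      qed
      ultimately show "std_pair N0 (\<lambda>i. (1 - t) * a i + t * a0 i)" using h by (simp add: std_pair_def)
    qed
    have "continuous_on {0..1} (\<lambda>t. if i = j then (1 - t) * a i + t * a0 i else 0)" for i j :: ix
      by (cases "i = j") (auto intro!: continuous_intros)
    then have "continuous_on {0..1} \<psi>"
      unfolding \<psi>_def diag_def
      by (intro continuous_on_shift_bianchi continuous_on_matrix_mult continuous_on_vec_lambda continuous_intros)
    then have "connected (\<psi> ` {0..1})" by (intro connected_continuous_image) auto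
    moreover have "\<psi> 0 \<in> \<psi> ` {0..1}" "\<psi> 1 \<in> \<psi> ` {0..1}" by auto
    moreover have "\<psi> ` {0..1} \<subseteq> main_region k" using \<psi> by blast
    ultimately have "connected_component (main_region k) (\<psi> 0) (\<psi> 1)"
      unfolding connected_component_def by blast
    moreover have "\<psi> 0 = \<phi> S" "\<psi> 1 = R0" by (simp_all add: \<psi>_def \<phi>S 0)
    ultimately show ?thesis using connected_component_trans 1 unfolding H by metis
  qed
  then show ?thesis unfolding connected_iff_connected_component
    by (blast intro: connected_component_trans connected_component_sym)
qed simp

text \<open>The diagonal entries agree on indices swapped by \<open>hodge\<close>, so the pencil
  splits into three blocks of size 2, with pairs of opposite roots of absolute values 1, 2 and
  3.\<close>

lemma example_main_region:
  "k *\<^sub>R mat 1 + diag (\<lambda>i. case i of I12 \<Rightarrow> 1 | I13 \<Rightarrow> 2 | I14 \<Rightarrow> 3 | I23 \<Rightarrow> 3 | I24 \<Rightarrow> 2 | I34 \<Rightarrow> 1) \<in> main_region k"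
proof -
  define D :: endo where "D = diag (\<lambda>i. case i of I12 \<Rightarrow> 1 | I13 \<Rightarrow> 2 | I14 \<Rightarrow> 3 | I23 \<Rightarrow> 3 | I24 \<Rightarrow> 2 | I34 \<Rightarrow> 1)"
  let ?R = "k *\<^sub>R mat 1 + D"
  have s: "transpose ?R = ?R" by (simp add: D_def transpose_def diag_def vec_eq_iff mat_def)
  have V: "?R \<in> sym2_bianchi"
    unfolding mem_sym2_bianchi by (simp only: s bianchi_linear) (simp add: D_def bianchi_def diag_def)
  have "sec D v > 0" if "v \<noteq> 0" for v
  proof -
    obtain i where i: "v $ i \<noteq> 0" using \<open>v \<noteq> 0\<close> by (auto simp: vec_eq_iff)
    show ?thesis unfolding D_def sec_diag
      by (rule sum_pos2[of UNIV i]) (use i in \<open>auto split: ix.splits\<close>)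
  qed
  then have pd: "pos_def (?R - k *\<^sub>R mat 1 + 0 *\<^sub>R hodge)" by (simp add: pos_def_def)
  then have "sec (?R - k *\<^sub>R mat 1 + 0 *\<^sub>R hodge) v \<ge> 0" for v
    by (cases "v = 0") (auto simp: pos_def_def sec_def less_eq_real_def)
  with V have S: "?R \<in> sec_ge k" unfolding mem_sec_ge_iff_psd by blast
  have "disc_poly k ?R \<noteq> 0"
  proof (rule disc_poly_nonzeroI[where X = "{1, -1, 2, -2, 3, -3}"])
    fix x :: real assume x: "x \<in> {1, -1, 2, -2, 3, -3}"
    define v :: "real^ix" where "v = (\<chi> i. if \<bar>x\<bar> = 1 then (case i of I12 \<Rightarrow> 1 | I34 \<Rightarrow> - x | _ \<Rightarrow> 0)
      else if \<bar>x\<bar> = 2 then (case i of I13 \<Rightarrow> 2 | I24 \<Rightarrow> x | _ \<Rightarrow> 0) else (case i of I14 \<Rightarrow> 3 | I23 \<Rightarrow> - x | _ \<Rightarrow> 0))"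
    have "(\<bar>x\<bar> = 1 \<longrightarrow> v $ I12 \<noteq> 0) \<and> (\<bar>x\<bar> = 2 \<longrightarrow> v $ I13 \<noteq> 0) \<and> (\<bar>x\<bar> = 3 \<longrightarrow> v $ I14 \<noteq> 0)" by (simp add: v_def)
    then have "v \<noteq> 0" using x by (auto simp: vec_eq_iff)
    moreover have "(D + x *\<^sub>R hodge) *v v = 0"
    proof -
      have "((D + x *\<^sub>R hodge) *v v) $ i = 0" for i
        using x by (cases i) (auto simp: D_def diag_def v_def hodge_def wedge_vol_def axis_def matrix_vector_mult_def sum_ix)
      then show ?thesis by (simp add: vec_eq_iff)
    qed
    ultimately show "det (?R - k *\<^sub>R mat 1 + x *\<^sub>R hodge) = 0" unfolding det_eq_0_kernel by auto
  qed simp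
  then have "disc_poly k ?R > 0" by (rule disc_poly_pos[OF s pd])
  with S show ?thesis by (simp add: main_region_def D_def)
qed

section \<open>The discriminant as a polynomial of degree 30\<close>

text \<open>Generic in the semiring, since monomials are evaluated at real numbers, at complex
  numbers and at polynomials.\<close>

definition mon_eval :: "(nat \<Rightarrow>\<^sub>0 nat) \<Rightarrow> (nat \<Rightarrow> 'a) \<Rightarrow> 'a::comm_semiring_1" where
  "mon_eval m x = (\<Prod>i\<in>Poly_Mapping.keys m. x i ^ Poly_Mapping.lookup m i)"

lemma mon_eval_superset:
  fixes x :: "nat \<Rightarrow> 'a::comm_semiring_1"
  assumes "finite S" "Poly_Mapping.keys m \<subseteq> S"
  shows "mon_eval m x = (\<Prod>i\<in>S. x i ^ Poly_Mapping.lookup m i)"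
  unfolding mon_eval_def by (rule prod.mono_neutral_left) (use assms in \<open>auto simp: in_keys_iff\<close>)

lemma mon_eval_add:
  fixes x :: "nat \<Rightarrow> 'a::comm_semiring_1"
  shows "mon_eval (m + m') x = mon_eval m x * mon_eval m' x"
proof -
  let ?S = "Poly_Mapping.keys m \<union> Poly_Mapping.keys m'"
  have "Poly_Mapping.keys (m + m') \<subseteq> ?S" by (rule Poly_Mapping.keys_add)
  then show ?thesis
    by (simp add: mon_eval_superset[of ?S] lookup_add power_add prod.distrib)
qed

definition mon_degree :: "(nat \<Rightarrow>\<^sub>0 nat) \<Rightarrow> nat" where
  "mon_degree m = (\<Sum>i\<in>Poly_Mapping.keys m. Poly_Mapping.lookup m i)"

lemma mon_degree_add: "mon_degree (m + m') = mon_degree m + mon_degree m'"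
proof -
  have s: "mon_degree l = (\<Sum>i\<in>S. Poly_Mapping.lookup l i)" if "finite S" "Poly_Mapping.keys l \<subseteq> S" for S l
    unfolding mon_degree_def by (rule sum.mono_neutral_left) (use that in \<open>auto simp: in_keys_iff\<close>)
  let ?S = "Poly_Mapping.keys m \<union> Poly_Mapping.keys m'"
  have "Poly_Mapping.keys (m + m') \<subseteq> ?S" by (rule Poly_Mapping.keys_add)
  then show ?thesis by (simp add: s[of ?S] lookup_add sum.distrib)
qed

lemma meval_mon_eval: "meval p x = (\<Sum>m\<in>Poly_Mapping.keys p. Poly_Mapping.lookup p m * mon_eval m x)"
  by (simp add: meval_def mon_eval_def)

lemma meval_superset:
  assumes "finite S" "Poly_Mapping.keys p \<subseteq> S"
  shows "meval p x = (\<Sum>m\<in>S. Poly_Mapping.lookup p m * mon_eval m x)"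
  unfolding meval_mon_eval by (rule sum.mono_neutral_left) (use assms in \<open>auto simp: in_keys_iff\<close>)

lemma mdegree_le_iff: "mdegree p \<le> d \<longleftrightarrow> (\<forall>m\<in>Poly_Mapping.keys p. mon_degree m \<le> d)"
  by (simp add: mdegree_def mon_degree_def)

text \<open>Only an upper bound on the degree, as an exact degree is not stable under sums.\<close>

definition is_poly :: "nat \<Rightarrow> nat \<Rightarrow> ((nat \<Rightarrow> real) \<Rightarrow> real) \<Rightarrow> bool" where
  "is_poly N d f \<longleftrightarrow> (\<exists>p. mvars p \<subseteq> {..<N} \<and> mdegree p \<le> d \<and> (\<forall>x. f x = meval p x))"

lemma is_poly_monomial:
  assumes "Poly_Mapping.keys m \<subseteq> {..<N}" "mon_degree m \<le> d"
  shows "is_poly N d (\<lambda>x. c * mon_eval m x)"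
  unfolding is_poly_def
  by (rule exI[of _ "Poly_Mapping.single m c"])
    (use assms in \<open>auto simp: mvars_def mdegree_le_iff meval_mon_eval split: if_splits\<close>)

lemma is_poly_const: "is_poly N d (\<lambda>x. c)"
  using is_poly_monomial[of 0 N d c] by (simp add: mon_eval_def mon_degree_def)

lemma is_poly_var:
  assumes "i < N"
  shows "is_poly N 1 (\<lambda>x. x i)"
  using is_poly_monomial[of "Poly_Mapping.single i 1" N 1 1] assms
  by (simp add: mon_eval_def mon_degree_def)

lemma is_poly_add:
  assumes "is_poly N d f" "is_poly N d g"
  shows "is_poly N d (\<lambda>x. f x + g x)"
proof -
  obtain p q where p: "mvars p \<subseteq> {..<N}" "mdegree p \<le> d" "\<And>x. f x = meval p x"
    and q: "mvars q \<subseteq> {..<N}" "mdegree q \<le> d" "\<And>x. g x = meval q x"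
    using assms unfolding is_poly_def by blast
  let ?S = "Poly_Mapping.keys p \<union> Poly_Mapping.keys q"
  have k: "Poly_Mapping.keys (p + q) \<subseteq> ?S" by (rule Poly_Mapping.keys_add)
  have "mvars (p + q) \<subseteq> {..<N}" using k p(1) q(1) unfolding mvars_def by blast
  moreover have "mdegree (p + q) \<le> d" using k p(2) q(2) unfolding mdegree_le_iff by blast
  moreover have "f x + g x = meval (p + q) x" for x
    using k by (simp add: p(3) q(3) meval_superset[of ?S] lookup_add distrib_right sum.distrib)
  ultimately show ?thesis unfolding is_poly_def by blast
qed

lemma is_poly_sum: "(\<And>i. i \<in> A \<Longrightarrow> is_poly N d (f i)) \<Longrightarrow> is_poly N d (\<lambda>x. \<Sum>i\<in>A. f i x)"
  by (induction A rule: infinite_finite_induct) (auto intro: is_poly_const is_poly_add)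

lemma is_poly_mult:
  assumes "is_poly N d f" "is_poly N e g"
  shows "is_poly N (d + e) (\<lambda>x. f x * g x)"
proof -
  obtain p q where p: "mvars p \<subseteq> {..<N}" "mdegree p \<le> d" "\<And>x. f x = meval p x"
    and q: "mvars q \<subseteq> {..<N}" "mdegree q \<le> e" "\<And>x. g x = meval q x"
    using assms unfolding is_poly_def by blast
  have "is_poly N (d + e) (\<lambda>x. \<Sum>m\<in>Poly_Mapping.keys p. \<Sum>m'\<in>Poly_Mapping.keys q.
      (Poly_Mapping.lookup p m * Poly_Mapping.lookup q m') * mon_eval (m + m') x)"
  proof (intro is_poly_sum is_poly_monomial)
    fix m m' assume m: "m \<in> Poly_Mapping.keys p" "m' \<in> Poly_Mapping.keys q"
    then show "Poly_Mapping.keys (m + m') \<subseteq> {..<N}"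
      using p(1) q(1) Poly_Mapping.keys_add[of m m'] unfolding mvars_def by blast
    show "mon_degree (m + m') \<le> d + e"
      using m p(2) q(2) by (simp add: mon_degree_add mdegree_le_iff add_mono)
  qed
  moreover have "f x * g x = (\<Sum>m\<in>Poly_Mapping.keys p. \<Sum>m'\<in>Poly_Mapping.keys q.
      (Poly_Mapping.lookup p m * Poly_Mapping.lookup q m') * mon_eval (m + m') x)" for x
    by (simp add: p(3) q(3) meval_mon_eval sum_product mon_eval_add mult_ac)
  ultimately show ?thesis by simp
qed

lemma is_poly_cmult: "is_poly N d f \<Longrightarrow> is_poly N d (\<lambda>x. c * f x)"
  using is_poly_mult[OF is_poly_const[of N 0 c]] by simp

lemma is_poly_prod:
  assumes "finite A" "\<And>i. i \<in> A \<Longrightarrow> is_poly N (d i) (f i)"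
  shows "is_poly N (\<Sum>i\<in>A. d i) (\<lambda>x. \<Prod>i\<in>A. f i x)"
  using assms by (induction A rule: finite_induct) (auto intro: is_poly_const is_poly_mult)

text \<open>The coefficients of a characteristic polynomial of degree \<open>d\<close> have weight \<open>d - j\<close>.\<close>

definition coeffs_poly :: "nat \<Rightarrow> nat \<Rightarrow> ((nat \<Rightarrow> real) \<Rightarrow> real poly) \<Rightarrow> bool" where
  "coeffs_poly N d F \<longleftrightarrow> (\<forall>j. is_poly N (d - j) (\<lambda>x. coeff (F x) j)) \<and> (\<forall>x. degree (F x) \<le> d)"

lemma coeffs_poly_mult:
  assumes "coeffs_poly N d F" "coeffs_poly N e G"
  shows "coeffs_poly N (d + e) (\<lambda>x. F x * G x)"
  unfolding coeffs_poly_def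
proof (intro conjI allI)
  fix j
  have "is_poly N (d + e - j) (\<lambda>x. coeff (F x) i * coeff (G x) (j - i))" if "i \<le> j" for i
  proof (cases "i \<le> d \<and> j - i \<le> e")
    case True
    then have "(d - i) + (e - (j - i)) = d + e - j" using that by arith
    then show ?thesis using is_poly_mult assms unfolding coeffs_poly_def by metis
  next
    case False
    \<comment> \<open>Here truncated subtraction would spoil the count of weights, but the degree
      bounds make the product vanish.\<close>
    have "coeff (F x) i * coeff (G x) (j - i) = 0" for x
    proof -
      have "degree (F x) < i \<or> degree (G x) < j - i"
        using False assms unfolding coeffs_poly_def by (meson leD le_less_linear order_le_less_trans)
      then show ?thesis by (auto simp: coeff_eq_0)
    qed
    then show ?thesis by (simp only: is_poly_const)
  qed
  then show "is_poly N (d + e - j) (\<lambda>x. coeff (F x * G x) j)"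
    unfolding coeff_mult by (intro is_poly_sum) simp
next
  fix x
  show "degree (F x * G x) \<le> d + e"
    using assms degree_mult_le[of "F x" "G x"] unfolding coeffs_poly_def by (meson add_mono order_trans)
qed

lemma coeffs_poly_prod:
  assumes "finite A" "\<And>i. i \<in> A \<Longrightarrow> coeffs_poly N (d i) (F i)"
  shows "coeffs_poly N (\<Sum>i\<in>A. d i) (\<lambda>x. \<Prod>i\<in>A. F i x)"
  using assms
proof (induction A rule: finite_induct)
  case empty
  then show ?case by (simp add: coeffs_poly_def is_poly_const)
qed (auto intro: coeffs_poly_mult)

lemma coeffs_poly_sum:
  assumes "\<And>i. i \<in> A \<Longrightarrow> coeffs_poly N d (F i)"
  shows "coeffs_poly N d (\<lambda>x. \<Sum>i\<in>A. F i x)"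
  using assms unfolding coeffs_poly_def
  by (auto simp: coeff_sum intro!: is_poly_sum) (cases "finite A"; auto intro: degree_sum_le)

lemma coeffs_poly_det:
  fixes M :: "(nat \<Rightarrow> real) \<Rightarrow> real poly^'n^'n"
  assumes "\<And>i j. coeffs_poly N 1 (\<lambda>x. M x $ i $ j)"
  shows "coeffs_poly N CARD('n) (\<lambda>x. det (M x))"
  unfolding det_def
proof (rule coeffs_poly_sum)
  fix p :: "'n \<Rightarrow> 'n"
  have "coeffs_poly N (\<Sum>i\<in>(UNIV :: 'n set). 1) (\<lambda>x. \<Prod>i\<in>UNIV. M x $ i $ p i)"
    by (rule coeffs_poly_prod) (use assms in auto)
  moreover have "coeffs_poly N 0 (\<lambda>x. of_int (sign p))"
    by (simp add: coeffs_poly_def is_poly_const)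
  ultimately have "coeffs_poly N (0 + (\<Sum>i\<in>(UNIV :: 'n set). 1)) (\<lambda>x. of_int (sign p) * (\<Prod>i\<in>UNIV. M x $ i $ p i))"
    by (intro coeffs_poly_mult)
  then show "coeffs_poly N CARD('n) (\<lambda>x. of_int (sign p) * (\<Prod>i\<in>UNIV. M x $ i $ p i))" by simp
qed

lemma is_poly_det:
  fixes M :: "(nat \<Rightarrow> real) \<Rightarrow> real^'n^'n"
  assumes "\<And>i j. is_poly N d (\<lambda>x. M x $ i $ j)"
  shows "is_poly N (CARD('n) * d) (\<lambda>x. det (M x))"
  unfolding det_def
proof (intro is_poly_sum is_poly_cmult)
  fix p :: "'n \<Rightarrow> 'n"
  have "is_poly N (\<Sum>i\<in>(UNIV :: 'n set). d) (\<lambda>x. \<Prod>i\<in>UNIV. M x $ i $ p i)"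
    by (rule is_poly_prod) (auto intro: assms)
  then show "is_poly N (CARD('n) * d) (\<lambda>x. \<Prod>i\<in>UNIV. M x $ i $ p i)" by simp
qed

section \<open>Polynomials in a matrix and the discriminant as a determinant\<close>

primrec mat_pow :: "'a::comm_ring_1^'n^'n \<Rightarrow> nat \<Rightarrow> 'a^'n^'n" where
  "mat_pow M 0 = mat 1"
| "mat_pow M (Suc j) = M ** mat_pow M j"

definition poly_mat :: "'a::comm_ring_1 poly \<Rightarrow> 'a^'n^'n \<Rightarrow> 'a^'n^'n" where
  "poly_mat q M = (\<chi> a b. \<Sum>j\<le>degree q. coeff q j * mat_pow M j $ a $ b)"

lemma poly_mat_nth:
  assumes "degree q \<le> n"
  shows "poly_mat q M $ a $ b = (\<Sum>j\<le>n. coeff q j * mat_pow M j $ a $ b)"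
  unfolding poly_mat_def vec_lambda_beta
  by (rule sum.mono_neutral_left) (use assms in \<open>auto simp: coeff_eq_0\<close>)

lemma is_poly_mat_pow:
  fixes M :: "(nat \<Rightarrow> real) \<Rightarrow> real^'n^'n"
  assumes "\<And>i j. is_poly N 1 (\<lambda>x. M x $ i $ j)"
  shows "is_poly N n (\<lambda>x. mat_pow (M x) n $ i $ j)"
proof (induction n arbitrary: i j)
  case 0
  then show ?case by (simp add: mat_def is_poly_const)
next
  case (Suc n)
  have "is_poly N (1 + n) (\<lambda>x. \<Sum>l\<in>UNIV. M x $ i $ l * mat_pow (M x) n $ l $ j)"
    by (intro is_poly_sum is_poly_mult assms Suc)
  then show ?case by (simp add: matrix_matrix_mult_def)
qed

lemma poly_mat_const: "poly_mat [:c:] M = (\<chi> a b. c * mat 1 $ a $ b)"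
  by (simp add: poly_mat_def vec_eq_iff)

lemma poly_mat_linear_mult:
  fixes M :: "'a::comm_ring_1^'n^'n"
  shows "poly_mat ([:-s, 1:] * q) M = (\<chi> a b. M $ a $ b - s * mat 1 $ a $ b) ** poly_mat q M"
proof -
  let ?n = "degree q"
  have d: "degree ([:-s, 1:] * q) \<le> Suc ?n"
    by (rule order_trans[OF degree_mult_le]) (simp add: degree_pCons_le)
  have "poly_mat ([:-s, 1:] * q) M $ a $ b = ((\<chi> a b. M $ a $ b - s * mat 1 $ a $ b) ** poly_mat q M) $ a $ b" for a b
  proof -
    have "(\<Sum>j\<le>Suc ?n. coeff ([:-s, 1:] * q) j * mat_pow M j $ a $ b)
        = (\<Sum>j\<le>Suc ?n. coeff (pCons 0 q) j * mat_pow M j $ a $ b) - s * (\<Sum>j\<le>Suc ?n. coeff q j * mat_pow M j $ a $ b)"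
      by (simp add: sum_subtractf[symmetric] sum_distrib_left algebra_simps del: sum.atMost_Suc)
    also have "(\<Sum>j\<le>Suc ?n. coeff (pCons 0 q) j * mat_pow M j $ a $ b) = (\<Sum>j\<le>?n. coeff q j * (M ** mat_pow M j) $ a $ b)"
      by (subst sum.atMost_Suc_shift) simp
    also have "\<dots> = (\<Sum>l\<in>UNIV. M $ a $ l * poly_mat q M $ l $ b)"
      unfolding poly_mat_nth[OF order_refl] matrix_matrix_mult_def
      by (simp add: sum_distrib_left) (subst sum.swap, simp add: mult_ac)
    also have "(\<Sum>j\<le>Suc ?n. coeff q j * mat_pow M j $ a $ b) = poly_mat q M $ a $ b"
      by (rule poly_mat_nth[symmetric]) simp
    also have "s * poly_mat q M $ a $ b = (\<Sum>l\<in>UNIV. s * mat 1 $ a $ l * poly_mat q M $ l $ b)"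
      by (simp add: mat_def if_distrib if_distribR cong: if_cong)
    finally show ?thesis
      unfolding poly_mat_nth[OF d] by (simp add: matrix_matrix_mult_def sum_subtractf[symmetric] left_diff_distrib)
  qed
  then show ?thesis by (simp add: vec_eq_iff)
qed

text \<open>Over the complex numbers \<open>q\<close> splits into linear factors, and the factor
  with root s contributes det (M - s Id), the product of all r - s.\<close>

lemma det_poly_mat:
  fixes M :: "complex^'n^'n"
  assumes rs: "length rs = CARD('n)" "\<And>x. det (\<chi> a b. x * mat 1 $ a $ b - M $ a $ b) = (\<Prod>r\<leftarrow>rs. x - r)"
  shows "det (poly_mat q M) = (\<Prod>r\<leftarrow>rs. poly q r)"
proof -
  have dm: "det (\<chi> a b. M $ a $ b - s * mat 1 $ a $ b) = (\<Prod>r\<leftarrow>rs. r - s)" for s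
  proof -
    have "(\<chi> a b. M $ a $ b - s * mat 1 $ a $ b) = (\<chi> a. (-1) *s (\<chi> a b. s * mat 1 $ a $ b - M $ a $ b) $ a)"
      by (simp add: vec_eq_iff)
    then have "det (\<chi> a b. M $ a $ b - s * mat 1 $ a $ b) = (-1) ^ CARD('n) * (\<Prod>r\<leftarrow>rs. s - r)"
      by (simp only: det_rows_mul rs(2) prod_constant vec_lambda_eta)
    also have "\<dots> = (\<Prod>r\<leftarrow>rs. r - s)"
      unfolding rs(1)[symmetric] by (induction rs) (auto simp: algebra_simps)
    finally show ?thesis .
  qed
  have const: "det (poly_mat [:c:] M) = c ^ length rs" for c
    unfolding poly_mat_const rs(1) by (subst det_diagonal) (simp_all add: mat_def)
  have "det (poly_mat (smult c (\<Prod>s\<leftarrow>ss. [:-s, 1:])) M) = (\<Prod>r\<leftarrow>rs. poly (smult c (\<Prod>s\<leftarrow>ss. [:-s, 1:])) r)" for c ss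
  proof (induction ss)
    case Nil
    have "smult c (\<Prod>s\<leftarrow>[]. [:-s, 1:]) = [:c:]" by simp
    moreover have "(\<Prod>r\<leftarrow>rs. poly [:c:] r) = c ^ length rs" by (induction rs) auto
    ultimately show ?case using const by metis
  next
    case (Cons s ss)
    let ?q = "smult c (\<Prod>s\<leftarrow>ss. [:-s, 1:])"
    have e: "smult c (\<Prod>s\<leftarrow>s # ss. [:-s, 1:]) = [:-s, 1:] * ?q" by (simp del: mult_pCons_left)
    have "(\<Prod>r\<leftarrow>xs. poly ([:-s, 1:] * ?q) r) = (\<Prod>r\<leftarrow>xs. r - s) * (\<Prod>r\<leftarrow>xs. poly ?q r)" for xs
      by (induction xs) (simp_all del: mult_pCons_left)
    then show ?case unfolding e poly_mat_linear_mult det_mul dm Cons by (simp only:)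
  qed
  moreover obtain ss where "mset ss = proots q" using ex_mset by blast
  then have "q = smult (lead_coeff q) (\<Prod>s\<leftarrow>ss. [:-s, 1:])"
    using complex_poly_decompose_multiset[of q] by (metis mset_map prod_mset_prod_list)
  ultimately show ?thesis by metis
qed

text \<open>The derivative at a root is the product of its differences to the other roots. Each pair
  occurs twice, with opposite signs, so the exponent of -1 is the number of pairs.\<close>

lemma prod_pderiv_roots:
  fixes rs :: "complex list"
  shows "(\<Prod>r\<leftarrow>rs. poly (pderiv (\<Prod>s\<leftarrow>rs. [:-s, 1:])) r) = (-1) ^ (\<Sum>i<length rs. i) * sqdiffs rs"
proof (induction rs)
  case (Cons r rs)
  let ?g = "\<Prod>s\<leftarrow>rs. [:-s, 1:]"
  have pd: "poly (pderiv ([:-r, 1:] * ?g)) x = poly ?g x + (x - r) * poly (pderiv ?g) x" for x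
    by (simp add: pderiv_mult pderiv_pCons del: mult_pCons_left)
  have g: "poly (\<Prod>s\<leftarrow>xs. [:-s, 1:]) x = (\<Prod>s\<leftarrow>xs. x - s)" for xs and x :: complex
    by (induction xs) (simp_all del: mult_pCons_left)
  have g0: "poly ?g x = 0" if "x \<in> set rs" for x unfolding g using that by (induction rs) auto
  have "(\<Prod>x\<leftarrow>rs. poly (pderiv ([:-r, 1:] * ?g)) x) = (\<Prod>x\<leftarrow>rs. (x - r) * poly (pderiv ?g) x)"
    by (intro arg_cong[of _ _ prod_list] map_cong) (simp_all add: pd g0 del: mult_pCons_left)
  also have "\<dots> = (\<Prod>x\<leftarrow>rs. x - r) * (\<Prod>x\<leftarrow>rs. poly (pderiv ?g) x)"
  proof -
    have "(\<Prod>x\<leftarrow>xs. (x - r) * h x) = (\<Prod>x\<leftarrow>xs. x - r) * (\<Prod>x\<leftarrow>xs. h x)" for h xs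
      by (induction xs) (simp_all add: mult_ac)
    then show ?thesis .
  qed
  finally have 1: "(\<Prod>x\<leftarrow>rs. poly (pderiv ([:-r, 1:] * ?g)) x) = (\<Prod>x\<leftarrow>rs. x - r) * (\<Prod>x\<leftarrow>rs. poly (pderiv ?g) x)" .
  have 2: "(\<Prod>x\<leftarrow>xs. r - x) * (\<Prod>x\<leftarrow>xs. x - r) = (-1) ^ length xs * (\<Prod>s\<leftarrow>xs. (r - s)\<^sup>2)" for xs
    by (induction xs) (auto simp: power2_eq_square algebra_simps)
  have "(\<Prod>x\<leftarrow>r # rs. poly (pderiv (\<Prod>s\<leftarrow>r # rs. [:-s, 1:])) x)
     = poly ?g r * ((\<Prod>x\<leftarrow>rs. x - r) * (\<Prod>x\<leftarrow>rs. poly (pderiv ?g) x))"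
    using 1 pd[of r] by (simp del: mult_pCons_left)
  also have "\<dots> = (-1) ^ length rs * (\<Prod>s\<leftarrow>rs. (r - s)\<^sup>2) * ((-1) ^ (\<Sum>i<length rs. i) * sqdiffs rs)"
    unfolding Cons 2[symmetric] g by simp
  finally show ?case by (simp add: power_add)
qed simp

lemma charp_complex_roots:
  "map_poly of_real (charp (charmat k R)) = (\<Prod>r\<leftarrow>roots k R. [:-r, 1:])"
proof -
  let ?f = "map_poly complex_of_real (charp (charmat k R))"
  have "map_poly complex_of_real (pencil_poly k R) = smult (of_real (det hodge)) ?f"
    by (simp add: pencil_poly_charp map_poly_smult)
  then have "mset (roots k R) = proots ?f"
    using det_hodge_nonzero by (simp add: mset_roots)
  moreover have "lead_coeff ?f = 1" using lead_coeff_charp[of "charmat k R"] by (simp add: coeff_map_poly degree_map_poly)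
  ultimately have "(\<Prod>x\<in>#mset (roots k R). [:-x, 1:]) = ?f"
    using complex_poly_decompose_multiset[of ?f] by simp
  then show ?thesis by (simp only: mset_map[symmetric] prod_mset_prod_list)
qed

lemma mat_pow_of_real:
  fixes M :: "real^'n^'n"
  shows "mat_pow (\<chi> a b. complex_of_real (M $ a $ b)) n $ i $ j = of_real (mat_pow M n $ i $ j)"
  by (induction n arbitrary: i j) (simp_all add: mat_def matrix_matrix_mult_def)

text \<open>The matrix whose eigenvalues are the roots is \<open>- charmat k R\<close>, because
  \<open>charp A\<close> is det (A + x Id). The sign is that of 15 pairs.\<close>

lemma disc_poly_det: "disc_poly k R = - det (poly_mat (pderiv (charp (charmat k R))) (- charmat k R))"
proof -
  let ?A = "charmat k R"
  let ?f = "charp ?A" and ?rs = "roots k R"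
  let ?M = "\<chi> a b. complex_of_real ((- ?A) $ a $ b)"
  have "det (\<chi> a b. x * mat 1 $ a $ b - ?M $ a $ b) = (\<Prod>r\<leftarrow>?rs. x - r)" for x
  proof -
    have "(\<Prod>r\<leftarrow>rs. x - r) = poly (\<Prod>r\<leftarrow>rs. [:-r, 1:]) x" for rs
      by (induction rs) (simp_all del: mult_pCons_left)
    then have "(\<Prod>r\<leftarrow>?rs. x - r) = poly (map_poly of_real ?f) x" by (simp add: charp_complex_roots)
    also have "\<dots> = det (\<chi> a b. x * mat 1 $ a $ b - ?M $ a $ b)"
      unfolding charp_def map_poly_of_real_det poly_det
      by (rule arg_cong[of _ _ det]) (simp add: vec_eq_iff map_poly_pCons mat_def)
    finally show ?thesis ..
  qed
  then have "det (poly_mat q ?M) = (\<Prod>r\<leftarrow>?rs. poly q r)" for q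
    by (intro det_poly_mat) (simp_all add: length_roots card_ix)
  then have "det (poly_mat (pderiv (map_poly of_real ?f)) ?M) = (-1) ^ (\<Sum>i<6. i) * sqdiffs ?rs"
    using prod_pderiv_roots[of ?rs] by (simp only: charp_complex_roots length_roots)
  moreover have "(-1 :: complex) ^ (\<Sum>i<6. i) = -1" by (simp add: eval_nat_numeral)
  moreover have "sqdiffs ?rs = of_real (disc_poly k R)"
    by (simp only: of_real_disc_poly prod_eq_sqdiffs[symmetric] length_roots)
  moreover have "det (poly_mat (pderiv (map_poly of_real ?f)) ?M) = of_real (det (poly_mat (pderiv ?f) (- ?A)))"
  proof -
    have pd: "pderiv (map_poly complex_of_real p) = map_poly of_real (pderiv p)" for p
      by (rule poly_eqI) (simp add: coeff_pderiv coeff_map_poly)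
    have "poly_mat (map_poly of_real q) ?M = (\<chi> a b. complex_of_real (poly_mat q (- ?A) $ a $ b))" for q
      unfolding poly_mat_def by (simp add: vec_eq_iff degree_map_poly coeff_map_poly mat_pow_of_real del: vector_uminus_component)
    then show ?thesis unfolding pd by (simp add: det_of_real)
  qed
  ultimately have "complex_of_real (disc_poly k R) = of_real (- det (poly_mat (pderiv ?f) (- ?A)))" by simp
  then show ?thesis by (simp only: of_real_eq_iff)
qed

text \<open>In degree j the matrix f'(M) combines the coefficient j + 1 of f, of weight 6 - (j + 1),
  with a power of M of degree j in the entries. Each summand has degree at most 5, and the
  determinant at most 6 * 5.\<close>

lemma is_poly_disc:
  assumes R: "\<And>I J. is_poly N 1 (\<lambda>x. R x $ I $ J)"
  shows "is_poly N 30 (\<lambda>x. disc_poly k (R x))"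
proof -
  have neg: "is_poly N d (\<lambda>x. - f x)" if "is_poly N d f" for d f
    using is_poly_cmult[OF that, of "-1"] by simp
  have A: "is_poly N 1 (\<lambda>x. charmat k (R x) $ I $ J)" for I J
  proof -
    have "is_poly N 1 (\<lambda>x. \<Sum>L\<in>UNIV. hodge $ I $ L * (R x $ L $ J + - (k * mat 1 $ L $ J)))"
      by (intro is_poly_sum is_poly_cmult is_poly_add R is_poly_const)
    then show ?thesis by (simp add: charmat_def matrix_matrix_mult_def)
  qed
  have "coeffs_poly N CARD(ix) (\<lambda>x. charp (charmat k (R x)))"
    unfolding charp_def
  proof (rule coeffs_poly_det)
    fix I J
    have "is_poly N (1 - j) (\<lambda>x. coeff [:charmat k (R x) $ I $ J, if I = J then 1 else 0:] j)" for j
      using A[of I J] by (cases j) (simp_all add: is_poly_const)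
    then show "coeffs_poly N 1 (\<lambda>x. (\<chi> I J. [:charmat k (R x) $ I $ J, if I = J then 1 else 0:]) $ I $ J)"
      by (simp add: coeffs_poly_def)
  qed
  then have c: "is_poly N (6 - j) (\<lambda>x. coeff (charp (charmat k (R x))) j)" for j
    by (simp add: coeffs_poly_def card_ix)
  have "is_poly N 5 (\<lambda>x. poly_mat (pderiv (charp (charmat k (R x)))) (- charmat k (R x)) $ I $ J)" for I J
  proof -
    have d: "degree (pderiv (charp (charmat k (R x)))) \<le> 5" for x by (simp add: degree_pderiv degree_charp)
    have "is_poly N 5 (\<lambda>x. coeff (pderiv (charp (charmat k (R x)))) j * mat_pow (- charmat k (R x)) j $ I $ J)" if "j \<le> 5" for j
    proof -
      have "is_poly N ((6 - Suc j) + j) (\<lambda>x. (of_nat (Suc j) * coeff (charp (charmat k (R x))) (Suc j)) * mat_pow (- charmat k (R x)) j $ I $ J)"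
        using A by (intro is_poly_mult is_poly_cmult c is_poly_mat_pow) (simp add: neg)
      then show ?thesis using that by (simp add: coeff_pderiv)
    qed
    then show ?thesis unfolding poly_mat_nth[OF d] by (intro is_poly_sum) simp
  qed
  from is_poly_det[OF this] have "is_poly N 30 (\<lambda>x. det (poly_mat (pderiv (charp (charmat k (R x)))) (- charmat k (R x))))"
    by (simp add: card_ix)
  then show ?thesis unfolding disc_poly_det by (rule neg)
qed

section \<open>Linear coordinates on a subspace\<close>

lemma is_basis_exists:
  fixes V :: "'a::euclidean_space set"
  assumes "subspace V"
  obtains b where "is_basis V b"
proof -
  obtain B where B: "B \<subseteq> V" "independent B" "V \<subseteq> span B" "card B = dim V" using basis_exists by blast
  have "finite B" using B(2) by (simp add: independent_imp_finite)
  then obtain b where b: "bij_betw b {0..<card B} B" using ex_bij_betw_nat_finite by blast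
  have "span B = V" using B assms by (metis span_eq_iff span_mono subset_antisym)
  moreover have "b ` {..<dim V} = B" "inj_on b {..<dim V}"
    using b B(4) by (auto simp: bij_betw_def atLeast0LessThan)
  ultimately show ?thesis using that[of b] B(2) by (simp add: is_basis_def)
qed

lemma coords_expansion:
  assumes b: "is_basis V b" and v: "v \<in> V"
  shows "v = (\<Sum>i<dim V. coords V b v i *\<^sub>R b i)"
proof -
  let ?B = "b ` {..<dim V}"
  have "(\<Sum>w\<in>?B. representation ?B v w *\<^sub>R w) = v"
    using b v by (intro sum_representation_eq) (auto simp: is_basis_def)
  moreover have "(\<Sum>w\<in>?B. representation ?B v w *\<^sub>R w) = (\<Sum>i<dim V. representation ?B v (b i) *\<^sub>R b i)"
    using b by (subst sum.reindex) (auto simp: is_basis_def)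
  ultimately show ?thesis by (simp add: coords_def)
qed

theorem disc_poly_degree_le:
  obtains n where "n \<le> 30" "poly_of_degree_on sym2_bianchi (disc_poly k) n"
proof -
  obtain b where b: "is_basis sym2_bianchi b" using is_basis_exists[OF subspace_sym2_bianchi] .
  let ?N = "dim sym2_bianchi"
  have "is_poly ?N 30 (\<lambda>x. disc_poly k (\<Sum>i<?N. x i *\<^sub>R b i))"
  proof (rule is_poly_disc)
    fix I J
    have "is_poly ?N 1 (\<lambda>x. \<Sum>i<?N. b i $ I $ J * x i)"
      by (intro is_poly_sum is_poly_cmult is_poly_var) simp
    then show "is_poly ?N 1 (\<lambda>x. (\<Sum>i<?N. x i *\<^sub>R b i) $ I $ J)" by (simp add: mult.commute)
  qed
  then obtain p where p: "mvars p \<subseteq> {..<?N}" "mdegree p \<le> 30" "\<And>x. disc_poly k (\<Sum>i<?N. x i *\<^sub>R b i) = meval p x"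
    unfolding is_poly_def by blast
  have "disc_poly k v = meval p (coords sym2_bianchi b v)" if "v \<in> sym2_bianchi" for v
    using coords_expansion[OF b that] p(3) by metis
  with b p show ?thesis by (intro that[of "mdegree p"]) (auto simp: poly_of_degree_on_def)
qed

section \<open>Complexification\<close>

definition eval_over :: "mpoly \<Rightarrow> (nat \<Rightarrow> 'a) \<Rightarrow> 'a::real_field" where
  "eval_over p z = (\<Sum>m\<in>Poly_Mapping.keys p. of_real (Poly_Mapping.lookup p m) * mon_eval m z)"

definition eval_curve :: "mpoly \<Rightarrow> (nat \<Rightarrow> 'a poly) \<Rightarrow> 'a::real_field poly" where
  "eval_curve p Q = (\<Sum>m\<in>Poly_Mapping.keys p. smult (of_real (Poly_Mapping.lookup p m)) (mon_eval m Q))"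

lemma eval_over_of_real: "eval_over p (\<lambda>i. of_real (x i)) = of_real (meval p x)"
  by (simp add: eval_over_def meval_mon_eval mon_eval_def)

lemma poly_mon_eval: "poly (mon_eval m Q) t = mon_eval m (\<lambda>i. poly (Q i) t)"
  by (simp add: mon_eval_def poly_prod)

lemma poly_eval_curve: "poly (eval_curve p Q) t = eval_over p (\<lambda>i. poly (Q i) t)"
  by (simp add: eval_over_def eval_curve_def poly_sum poly_mon_eval)

lemma degree_eval_curve:
  assumes "\<And>i. degree (Q i) \<le> 1"
  shows "degree (eval_curve p Q) \<le> mdegree p"
  unfolding eval_curve_def
proof (rule degree_sum_le)
  fix m assume m: "m \<in> Poly_Mapping.keys p"
  have "degree (mon_eval m Q) \<le> (\<Sum>i\<in>Poly_Mapping.keys m. degree (Q i ^ Poly_Mapping.lookup m i))"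
    unfolding mon_eval_def by (rule order_trans[OF degree_prod_sum_le]) simp_all
  also have "\<dots> \<le> mon_degree m" unfolding mon_degree_def
  proof (rule sum_mono)
    fix i
    have "degree (Q i ^ Poly_Mapping.lookup m i) \<le> degree (Q i) * Poly_Mapping.lookup m i" by (rule degree_power_le)
    also have "\<dots> \<le> 1 * Poly_Mapping.lookup m i" by (rule mult_right_mono[OF assms]) simp
    finally show "degree (Q i ^ Poly_Mapping.lookup m i) \<le> Poly_Mapping.lookup m i" by simp
  qed
  also have "\<dots> \<le> mdegree p" using m mdegree_le_iff[of p "mdegree p"] by blast
  finally show "degree (smult (of_real (Poly_Mapping.lookup p m)) (mon_eval m Q)) \<le> mdegree p"
    using degree_smult_le order_trans by blast
qed simp

text \<open>To first order, a polynomial is affine in the direction of a line.\<close>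

definition first_order :: "((nat \<Rightarrow> 'a) \<Rightarrow> 'a::real_field poly) \<Rightarrow> bool" where
  "first_order F \<longleftrightarrow> (\<forall>v w. coeff (F v) 0 = coeff (F w) 0) \<and>
     (\<forall>v w. coeff (F (\<lambda>i. v i + w i)) 1 = coeff (F v) 1 + coeff (F w) 1)"

lemma first_order_mult:
  assumes "first_order F" "first_order G"
  shows "first_order (\<lambda>v. F v * G v)"
proof -
  have c1: "coeff (p * q) 1 = coeff p 0 * coeff q 1 + coeff p 1 * coeff q 0" for p q :: "'a poly"
    by (simp add: coeff_mult)
  have c0: "coeff (p * q) 0 = coeff p 0 * coeff q 0" for p q :: "'a poly"
    by (simp add: coeff_mult)
  obtain a b where F: "\<And>v. coeff (F v) 0 = a" and G: "\<And>v. coeff (G v) 0 = b"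
    using assms unfolding first_order_def by metis
  show ?thesis using assms unfolding first_order_def c0 c1
    by (auto simp: F G algebra_simps)
qed

lemma first_order_one: "first_order (\<lambda>v. 1)"
  by (simp add: first_order_def)

lemma first_order_power: "first_order F \<Longrightarrow> first_order (\<lambda>v. F v ^ n)"
  by (induction n) (auto intro: first_order_one first_order_mult)

lemma first_order_prod: "(\<And>i. i \<in> A \<Longrightarrow> first_order (F i)) \<Longrightarrow> first_order (\<lambda>v. \<Prod>i\<in>A. F i v)"
  by (induction A rule: infinite_finite_induct) (auto intro: first_order_one first_order_mult)

lemma first_order_eval_curve: "first_order (\<lambda>v. eval_curve p (\<lambda>i. [:u i, v i:]))"
proof -
  have "first_order (\<lambda>v. mon_eval m (\<lambda>i. [:u i, v i:]))" for m
    unfolding mon_eval_def by (intro first_order_prod first_order_power) (simp add: first_order_def)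
  then show ?thesis unfolding first_order_def eval_curve_def
    by (auto simp: coeff_sum sum.distrib[symmetric] distrib_left intro!: sum.cong)
qed

text \<open>\<open>representation\<close> is 0 outside the span and thus not linear on the whole
  space; total linear functionals with the same values on \<open>V\<close> can be composed with
  other linear maps.\<close>

lemma coords_linear_extension:
  assumes "is_basis V b"
  obtains r where "\<And>i. linear (r i)" "\<And>v i. v \<in> V \<Longrightarrow> i < dim V \<Longrightarrow> coords V b v i = r i v"
proof -
  let ?B = "b ` {..<dim V}"
  have "\<exists>r. linear r \<and> (\<forall>x\<in>?B. r x = (if x = b i then 1 else 0 :: real))" for i
    using assms by (intro linear_independent_extend) (simp add: is_basis_def)
  then obtain r where r: "\<And>i. linear (r i)" "\<And>i x. x \<in> ?B \<Longrightarrow> r i x = (if x = b i then 1 else 0 :: real)" by metis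
  have "coords V b v i = r i v" if "v \<in> V" "i < dim V" for v i
  proof -
    have inj: "inj_on b {..<dim V}" using assms by (simp add: is_basis_def)
    have "r i v = (\<Sum>j<dim V. coords V b v j *\<^sub>R r i (b j))"
      by (subst coords_expansion[OF assms that(1)]) (simp add: linear_sum[OF r(1)] linear_cmul[OF r(1)])
    also have "\<dots> = (\<Sum>j<dim V. if j = i then coords V b v j else 0)"
      by (rule sum.cong) (use inj that(2) in \<open>auto simp: r(2) inj_on_eq_iff\<close>)
    also have "\<dots> = coords V b v i" using that(2) by simp
    finally show ?thesis by simp
  qed
  with r(1) show ?thesis by (rule that)
qed

lemma meval_cong:
  assumes "mvars p \<subseteq> {..<N}" "\<And>i. i < N \<Longrightarrow> x i = y i"
  shows "meval p x = meval p y"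
  unfolding meval_def
  by (intro sum.cong refl arg_cong2[of _ _ _ _ "(*)"] prod.cong) (use assms in \<open>auto simp: mvars_def\<close>)

lemma poly_of_degree_onE:
  assumes "poly_of_degree_on V f n"
  obtains p r where "mdegree p = n" "\<And>i. linear (r i)" "\<And>v. v \<in> V \<Longrightarrow> f v = meval p (\<lambda>i. r i v)"
proof -
  obtain b p where b: "is_basis V b" and p: "mvars p \<subseteq> {..<dim V}" "mdegree p = n"
      "\<And>v. v \<in> V \<Longrightarrow> f v = meval p (coords V b v)"
    using assms unfolding poly_of_degree_on_def by blast
  obtain r where r: "\<And>i. linear (r i)" "\<And>v i. v \<in> V \<Longrightarrow> i < dim V \<Longrightarrow> coords V b v i = r i v"
    using coords_linear_extension[OF b] by blast
  have "f v = meval p (\<lambda>i. r i v)" if "v \<in> V" for v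
    unfolding p(3)[OF that] by (rule meval_cong[OF p(1)]) (simp add: r(2)[OF that])
  with p(2) r(1) show ?thesis by (rule that)
qed

lemma poly_of_degree_on_continuous:
  assumes "poly_of_degree_on V f n"
  shows "continuous_on V f"
proof -
  obtain p r where pr: "\<And>i. linear (r i)" "\<And>v. v \<in> V \<Longrightarrow> f v = meval p (\<lambda>i. r i v)"
    using poly_of_degree_onE[OF assms] by metis
  have "continuous_on V (\<lambda>v. meval p (\<lambda>i. r i v))"
    unfolding meval_def by (intro continuous_intros linear_continuous_on) (use pr(1) in \<open>simp add: linear_conv_bounded_linear\<close>)
  then show ?thesis by (rule continuous_on_eq) (simp add: pr)
qed

lemma poly_of_degree_on_line:
  assumes f: "poly_of_degree_on V f n" and V: "subspace V" "A \<in> V" "B \<in> V"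
  obtains q :: "real poly" where "\<And>t. f (A + t *\<^sub>R B) = poly q t"
proof -
  obtain p r where pr: "\<And>i. linear (r i)" "\<And>v. v \<in> V \<Longrightarrow> f v = meval p (\<lambda>i. r i v)"
    using poly_of_degree_onE[OF f] by metis
  have "f (A + t *\<^sub>R B) = poly (eval_curve p (\<lambda>i. [:r i A, r i B:])) t" for t
  proof -
    have "A + t *\<^sub>R B \<in> V" using V by (simp add: subspace_add subspace_scale)
    then have "f (A + t *\<^sub>R B) = meval p (\<lambda>i. r i A + t * r i B)"
      using pr by (simp add: linear_add linear_cmul)
    also have "\<dots> = eval_over p (\<lambda>i. r i A + t * r i B)"
      using eval_over_of_real[of p "\<lambda>i. r i A + t * r i B", where ?'a = real] by simp
    finally show ?thesis by (simp add: poly_eval_curve)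
  qed
  then show ?thesis by (rule that)
qed

text \<open>A segment from \<open>R\<close> to a point with nonzero discriminant stays in the convex
  set \<open>sec_ge k\<close>. Along it the discriminant is a nonzero polynomial, so arbitrarily
  small \<open>t\<close> avoid its zeros.\<close>

lemma closure_main_region: "closure (main_region k) = sec_ge k"
proof
  show "closure (main_region k) \<subseteq> sec_ge k"
    by (rule closure_minimal[OF _ closed_sec_ge]) (auto simp: main_region_def)
  show "sec_ge k \<subseteq> closure (main_region k)"
  proof
    fix R assume R: "R \<in> sec_ge k"
    obtain R1 where R1: "R1 \<in> main_region k" using example_main_region by blast
    then have R1S: "R1 \<in> sec_ge k" "disc_poly k R1 > 0" by (auto simp: main_region_def)
    have V: "R \<in> sym2_bianchi" "R1 - R \<in> sym2_bianchi"
      using R R1S subspace_sym2_bianchi by (auto simp: sec_ge_def subspace_diff)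
    obtain n where n: "poly_of_degree_on sym2_bianchi (disc_poly k) n" using disc_poly_degree_le by blast
    obtain q where q: "\<And>t. disc_poly k (R + t *\<^sub>R (R1 - R)) = poly q t"
      using poly_of_degree_on_line[OF n subspace_sym2_bianchi V] by blast
    have "q \<noteq> 0" using q[of 1] R1S by auto
    then have fin: "finite {t. poly q t = 0}" by (rule poly_roots_finite)
    show "R \<in> closure (main_region k)" unfolding closure_approachable
    proof (intro allI impI)
      fix e :: real assume e: "e > 0"
      define \<delta> where "\<delta> = min 1 (e / (1 + norm (R1 - R)))"
      have p: "1 + norm (R1 - R) > 0" by (intro add_pos_nonneg) auto
      have \<delta>: "\<delta> > 0" using e p by (simp add: \<delta>_def)
      then have "infinite {0<..<\<delta>}" by simp
      then have "\<exists>t\<in>{0<..<\<delta>}. poly q t \<noteq> 0" using fin by (metis (mono_tags, lifting) finite_subset mem_Collect_eq subsetI)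
      then obtain t where t: "0 < t" "t < \<delta>" "poly q t \<noteq> 0" by auto
      let ?Q = "R + t *\<^sub>R (R1 - R)"
      have t1: "t < 1" "t * (1 + norm (R1 - R)) < e" using t(2) p by (auto simp: \<delta>_def field_simps)
      have "?Q = (1 - t) *\<^sub>R R + t *\<^sub>R R1" by (simp add: algebra_simps)
      also have "\<dots> \<in> sec_ge k" by (rule convexD[OF convex_sec_ge R R1S(1)]) (use t t1 in auto)
      finally have QS: "?Q \<in> sec_ge k" .
      have d: "disc_poly k ?Q \<noteq> 0" using t(3) by (simp add: q)
      obtain x where "pos_def (?Q - k *\<^sub>R mat 1 + x *\<^sub>R hodge)" using sec_ge_disc_nonzero_pos_def[OF QS d] by blast
      then have "disc_poly k ?Q > 0" using QS d by (intro disc_poly_pos) (auto simp: sec_ge_def mem_sym2_bianchi)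
      with QS have "?Q \<in> main_region k" by (simp add: main_region_def)
      moreover have "dist ?Q R < e"
      proof -
        have "dist ?Q R = t * norm (R1 - R)" using t by (simp add: dist_norm)
        also have "\<dots> \<le> t * (1 + norm (R1 - R))" using t by (intro mult_left_mono) auto
        finally show ?thesis using t1 by simp
      qed
      ultimately show "\<exists>y\<in>main_region k. dist y R < e" by blast
    qed
  qed
qed

text \<open>If \<open>g R\<close> were positive, a ball of \<open>V\<close> around \<open>R\<close>
  would lie in the positivity set and meet \<open>C\<close>. Being connected, it would lie in
  \<open>C\<close>, although it contains points \<open>R - \<delta> *\<^sub>R U\<close> outside the
  closure.\<close>

lemma defining_polynomial_boundary:
  fixes V :: "'a::euclidean_space set" and g :: "'a \<Rightarrow> real"
  assumes V: "subspace V" and g: "continuous_on V g" and C: "C \<in> components {v \<in> V. g v > 0}"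
    and R: "R \<in> closure C" "R \<in> V" and U: "U \<in> V" and out: "\<And>\<delta>. \<delta> > 0 \<Longrightarrow> R - \<delta> *\<^sub>R U \<notin> closure C"
  shows "g R = 0"
proof (rule ccontr)
  assume ne: "g R \<noteq> 0"
  let ?W = "{v \<in> V. g v > 0}"
  have CW: "C \<subseteq> ?W" using C by (rule in_components_subset)
  have "g R \<ge> 0"
  proof -
    have "closed V" by (rule closed_subspace[OF V])
    then have "closed {v \<in> V. 0 \<le> g v}"
      using continuous_closed_preimage[OF g, of "{0..}"] by (simp add: vimage_def Int_def conj_commute)
    moreover have "C \<subseteq> {v \<in> V. 0 \<le> g v}" using CW by auto
    ultimately show ?thesis using R(1) closure_minimal by blast
  qed
  with ne have gR: "g R > 0" by simp
  then obtain d where d: "d > 0" "\<And>v. v \<in> V \<Longrightarrow> dist v R < d \<Longrightarrow> dist (g v) (g R) < g R"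
    using g R(2) unfolding continuous_on_iff by metis
  let ?B = "V \<inter> ball R d"
  have BW: "?B \<subseteq> ?W"
  proof
    fix v assume "v \<in> ?B"
    then have "v \<in> V" "dist (g v) (g R) < g R" using d(2)[of v] by (auto simp: dist_commute)
    then show "v \<in> ?W" by (auto simp: dist_real_def abs_if split: if_splits)
  qed
  have "convex ?B" using V by (intro convex_Int subspace_imp_convex convex_ball) 
  then have conB: "connected ?B" by (rule convex_connected)
  obtain c where c: "c \<in> C" "dist c R < d" using R(1) d(1) unfolding closure_approachable by blast
  then have "c \<in> C \<inter> ?B" using CW by (auto simp: dist_commute)
  then have "?B \<subseteq> C" using components_maximal[OF C conB BW] by blast
  define \<delta> where "\<delta> = d / (1 + norm U)"
  have p: "1 + norm U > 0" by (intro add_pos_nonneg) auto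
  have \<delta>: "\<delta> > 0" using d p by (simp add: \<delta>_def)
  have "\<delta> * norm U < \<delta> * (1 + norm U)" using \<delta> by simp
  also have "\<dots> = d" using p by (simp add: \<delta>_def)
  finally have "\<delta> * norm U < d" .
  then have "R - \<delta> *\<^sub>R U \<in> ?B" using V R U \<delta> by (simp add: dist_norm subspace_diff subspace_scale)
  then have "R - \<delta> *\<^sub>R U \<in> closure C" using \<open>?B \<subseteq> C\<close> closure_subset by blast
  with out[OF \<delta>] show False by blast
qed

text \<open>The extension of \<open>c \<mapsto> g (shift_bianchi k (N\<^sup>T c N))\<close> to complex \<open>c\<close>, characterized by its
  values on real symmetric matrices and by its restrictions to polynomial curves and to lines.\<close>

definition complexification :: "real \<Rightarrow> endo \<Rightarrow> (endo \<Rightarrow> real) \<Rightarrow> nat \<Rightarrow> ((ix \<Rightarrow> ix \<Rightarrow> complex) \<Rightarrow> complex) \<Rightarrow> bool" where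
  "complexification k N g n G \<longleftrightarrow>
     (\<forall>c. transpose c = c \<longrightarrow>
        G (\<lambda>I J. of_real (c $ I $ J)) = of_real (g (shift_bianchi k (transpose N ** c ** N)))) \<and>
     (\<forall>M. \<exists>q. \<forall>t. G (\<lambda>I J. poly (M I J) t) = poly q t) \<and>
     (\<forall>A B. \<exists>q. degree q \<le> n \<and> (\<forall>t. G (\<lambda>I J. A I J + t * B I J) = poly q t)) \<and>
     (\<forall>A B B' q q' q''. (\<forall>t. G (\<lambda>I J. A I J + t * B I J) = poly q t) \<longrightarrow>
        (\<forall>t. G (\<lambda>I J. A I J + t * B' I J) = poly q' t) \<longrightarrow>
        (\<forall>t. G (\<lambda>I J. A I J + t * (B I J + B' I J)) = poly q'' t) \<longrightarrow>
        coeff q'' 1 = coeff q 1 + coeff q' 1)"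

lemma linear_matrix_expansion:
  assumes "linear (f :: endo \<Rightarrow> real)"
  shows "f c = (\<Sum>I\<in>UNIV. \<Sum>J\<in>UNIV. c $ I $ J * f (axis I (axis J 1)))"
proof -
  have c: "c = (\<Sum>I\<in>UNIV. \<Sum>J\<in>UNIV. (c $ I $ J) *\<^sub>R axis I (axis J 1))"
  proof -
    have "(\<Sum>I\<in>UNIV. \<Sum>J\<in>UNIV. (c $ I $ J) *\<^sub>R axis I (axis J 1)) $ K $ L = c $ K $ L" for K L
    proof -
      have "(\<Sum>I\<in>UNIV. \<Sum>J\<in>UNIV. (c $ I $ J) *\<^sub>R axis I (axis J 1)) $ K $ L
          = (\<Sum>I\<in>UNIV. \<Sum>J\<in>UNIV. if I = K then (if J = L then c $ I $ J else 0) else 0)"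
        by (simp only: sum_component) (intro sum.cong refl, auto simp: axis_def)
      also have "\<dots> = (\<Sum>I\<in>UNIV. if I = K then c $ I $ L else 0)"
        by (intro sum.cong refl) auto
      finally show ?thesis by simp
    qed
    then show ?thesis by (simp add: vec_eq_iff)
  qed
  show ?thesis
    by (subst c) (simp add: linear_sum[OF assms] linear_cmul[OF assms])
qed

text \<open>\<open>shift_bianchi\<close> is affine with constant part k Id, so the coordinates of
  its value are the affine forms \<open>\<alpha> i + \<Lambda> i c\<close> in the entries of
  \<open>c\<close>. These make sense for complex entries.\<close>

lemma complexification_exists:
  assumes g: "poly_of_degree_on sym2_bianchi g n"
  obtains G where "complexification k N g n G"
proof -
  obtain p r where p: "mdegree p = n" and r: "\<And>i. linear (r i)"
    and g: "\<And>v. v \<in> sym2_bianchi \<Longrightarrow> g v = meval p (\<lambda>i. r i v)"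
    using poly_of_degree_onE[OF g] by metis
  define \<rho> where "\<rho> i c = r i (transpose N ** c ** N - (bianchi (transpose N ** c ** N) / 3) *\<^sub>R hodge)" for i c
  have \<rho>: "linear (\<rho> i)" for i
  proof (rule linearI)
    show "\<rho> i (x + y) = \<rho> i x + \<rho> i y" for x y
    proof -
      have "transpose N ** (x + y) ** N = transpose N ** x ** N + transpose N ** y ** N"
        by (simp add: vec_eq_iff congruence_entry matrix_vector_mult_add_rdistrib inner_add_left)
      then show ?thesis
        by (simp add: \<rho>_def linear_add[OF r, symmetric] bianchi_add add_divide_distrib algebra_simps)
    qed
    show "\<rho> i (a *\<^sub>R x) = a *\<^sub>R \<rho> i x" for a x
    proof -
      have "transpose N ** (a *\<^sub>R x) ** N = a *\<^sub>R (transpose N ** x ** N)"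
        by (simp add: vec_eq_iff congruence_entry scaleR_matrix_vector_assoc[symmetric])
      then show ?thesis
        unfolding \<rho>_def by (simp only: linear_cmul[OF r, symmetric] bianchi_scaleR) (simp add: scaleR_diff_right)
    qed
  qed
  define \<beta> where "\<beta> i I J = complex_of_real (\<rho> i (axis I (axis J 1)))" for i I J
  define \<alpha> where "\<alpha> i = complex_of_real (r i (k *\<^sub>R mat 1))" for i
  define \<Lambda> where "\<Lambda> i c = (\<Sum>I\<in>UNIV. \<Sum>J\<in>UNIV. c I J * \<beta> i I J)" for i and c :: "ix \<Rightarrow> ix \<Rightarrow> complex"
  define G where "G c = eval_over p (\<lambda>i. \<alpha> i + \<Lambda> i c)" for c
  have line: "G (\<lambda>I J. A I J + t * B I J) = poly (eval_curve p (\<lambda>i. [:\<alpha> i + \<Lambda> i A, \<Lambda> i B:])) t" for A B t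
  proof -
    have "\<Lambda> i (\<lambda>I J. A I J + t * B I J) = \<Lambda> i A + t * \<Lambda> i B" for i
      by (simp add: \<Lambda>_def distrib_right sum.distrib sum_distrib_left mult.assoc)
    then show ?thesis by (simp add: G_def poly_eval_curve add.assoc)
  qed
  have "complexification k N g n G" unfolding complexification_def
  proof (intro conjI allI impI)
    fix c :: endo assume s: "transpose c = c"
    have V: "shift_bianchi k (transpose N ** c ** N) \<in> sym2_bianchi"
      by (rule shift_bianchi_mem[OF transpose_congruence[OF s]])
    have "\<alpha> i + \<Lambda> i (\<lambda>I J. of_real (c $ I $ J)) = of_real (r i (shift_bianchi k (transpose N ** c ** N)))" for i
    proof -
      have "\<Lambda> i (\<lambda>I J. of_real (c $ I $ J)) = of_real (\<rho> i c)"
        unfolding linear_matrix_expansion[OF \<rho>, of i c] by (simp add: \<Lambda>_def \<beta>_def)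
      moreover have "shift_bianchi k P = k *\<^sub>R mat 1 + (P - (bianchi P / 3) *\<^sub>R hodge)" for P
        by (simp add: shift_bianchi_def)
      ultimately show ?thesis by (simp only: \<alpha>_def \<rho>_def linear_add[OF r] of_real_add)
    qed
    then show "G (\<lambda>I J. of_real (c $ I $ J)) = of_real (g (shift_bianchi k (transpose N ** c ** N)))"
      by (simp add: G_def g[OF V] eval_over_of_real)
  next
    fix M :: "ix \<Rightarrow> ix \<Rightarrow> complex poly"
    have "G (\<lambda>I J. poly (M I J) t) = poly (eval_curve p (\<lambda>i. [:\<alpha> i:] + (\<Sum>I\<in>UNIV. \<Sum>J\<in>UNIV. smult (\<beta> i I J) (M I J)))) t" for t
      by (simp add: G_def \<Lambda>_def poly_eval_curve poly_sum mult.commute)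
    then show "\<exists>q. \<forall>t. G (\<lambda>I J. poly (M I J) t) = poly q t" by blast
  next
    fix A B
    have "degree (eval_curve p (\<lambda>i. [:\<alpha> i + \<Lambda> i A, \<Lambda> i B:])) \<le> n"
      unfolding p[symmetric] by (rule degree_eval_curve) (simp add: degree_pCons_le)
    then show "\<exists>q. degree q \<le> n \<and> (\<forall>t. G (\<lambda>I J. A I J + t * B I J) = poly q t)"
      using line by blast
  next
    fix A B B' q q' q''
    assume *: "\<forall>t. G (\<lambda>I J. A I J + t * B I J) = poly q t"
      "\<forall>t. G (\<lambda>I J. A I J + t * B' I J) = poly q' t"
      "\<forall>t. G (\<lambda>I J. A I J + t * (B I J + B' I J)) = poly q'' t"
    have eq: "q = eval_curve p (\<lambda>i. [:\<alpha> i + \<Lambda> i A, \<Lambda> i B:])" if "\<forall>t. G (\<lambda>I J. A I J + t * B I J) = poly q t" for q B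
      by (rule poly_eq_poly_eq_iff[THEN iffD1], rule ext) (metis line that)
    have "\<Lambda> i (\<lambda>I J. B I J + B' I J) = \<Lambda> i B + \<Lambda> i B'" for i
      by (simp add: \<Lambda>_def distrib_right sum.distrib)
    then have "q'' = eval_curve p (\<lambda>i. [:\<alpha> i + \<Lambda> i A, \<Lambda> i B + \<Lambda> i B':])"
      using eq[OF *(3)] by simp
    then show "coeff q'' 1 = coeff q 1 + coeff q' 1"
      unfolding eq[OF *(1)] eq[OF *(2)]
      using first_order_eval_curve[of p "\<lambda>i. \<alpha> i + \<Lambda> i A", unfolded first_order_def,
        THEN conjunct2, rule_format, of "\<lambda>i. \<Lambda> i B" "\<lambda>i. \<Lambda> i B'"]
      by simp
  qed
  then show ?thesis by (rule that)
qed

section \<open>Double roots at eigenvalue crossings\<close>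

lemma projection_mult:
  "(\<chi> I J. a * mat 1 $ I $ J - v $ I * v $ J) *v x = a *\<^sub>R x - (v \<bullet> x) *\<^sub>R v" for v :: "real^'n"
proof -
  have "(\<Sum>J\<in>UNIV. (a * mat 1 $ I $ J - v $ I * v $ J) * x $ J) = a * x $ I - v $ I * (\<Sum>J\<in>UNIV. v $ J * x $ J)" for I
  proof -
    have "(\<Sum>J\<in>UNIV. a * mat 1 $ I $ J * x $ J) = a * x $ I"
      by (simp add: mat_def if_distrib if_distribR cong: if_cong)
    then show ?thesis by (simp only: left_diff_distrib sum_subtractf) (simp add: sum_distrib_left mult.assoc)
  qed
  then show ?thesis by (simp add: vec_eq_iff matrix_vector_mult_def inner_vec_def mult.commute)
qed

text \<open>The added matrix is |v|^2 times the orthogonal projection off \<open>v\<close>. As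
  \<open>c\<close> kills \<open>v\<close>, only the component \<open>y\<close> orthogonal to
  \<open>v\<close> contributes to \<open>sec c x\<close>, and the projection dominates it for large
  \<open>t\<close>.\<close>

lemma pos_semidef_shift:
  assumes s: "transpose c = c" and cv: "c *v v = 0" and v: "v \<noteq> 0"
    and t: "t \<ge> 36 * norm c / (v \<bullet> v)"
  shows "sec (c + t *\<^sub>R (\<chi> I J. (v \<bullet> v) * mat 1 $ I $ J - v $ I * v $ J)) x \<ge> 0"
proof -
  let ?J = "(\<chi> I J. (v \<bullet> v) * mat 1 $ I $ J - v $ I * v $ J) :: endo"
  have vv: "v \<bullet> v > 0" using v by simp
  define y where "y = x - ((v \<bullet> x) / (v \<bullet> v)) *\<^sub>R v"
  have "y \<bullet> y = x \<bullet> x - (v \<bullet> x)\<^sup>2 / (v \<bullet> v)"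
    using vv by (simp add: y_def inner_diff_left inner_diff_right inner_commute power2_eq_square field_simps)
  then have yy: "(v \<bullet> v) * (y \<bullet> y) = (v \<bullet> v) * (x \<bullet> x) - (v \<bullet> x)\<^sup>2"
    using vv by (simp add: field_simps)
  have "?J *v x = (v \<bullet> v) *\<^sub>R x - (v \<bullet> x) *\<^sub>R v" by (rule projection_mult)
  then have J: "sec ?J x = (v \<bullet> v) * (y \<bullet> y)"
    by (simp add: sec_def yy inner_diff_left power2_eq_square)
  have "x = y + ((v \<bullet> x) / (v \<bullet> v)) *\<^sub>R v" by (simp add: y_def)
  then have "sec c x = sec c (y + ((v \<bullet> x) / (v \<bullet> v)) *\<^sub>R v)" by simp
  also have "\<dots> = sec c y"
    using symmetric_inner[OF s, of y v]
    by (simp add: sec_add_vec[OF s] sec_scaleR_vec cv) (simp add: sec_def cv)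
  finally have "sec c x = sec c y" .
  moreover have "sec c y \<ge> - (36 * norm c * (y \<bullet> y))" using abs_sec_le[of c y] by linarith
  moreover have "36 * norm c * (y \<bullet> y) \<le> t * ((v \<bullet> v) * (y \<bullet> y))"
  proof -
    have "36 * norm c \<le> t * (v \<bullet> v)" using t vv by (simp add: field_simps)
    then have "36 * norm c * (y \<bullet> y) \<le> t * (v \<bullet> v) * (y \<bullet> y)" by (rule mult_right_mono) simp
    then show ?thesis by (simp add: mult.assoc)
  qed
  ultimately show ?thesis by (simp only: sec_add sec_scaleR J)
qed

locale lower_bound =
  fixes k :: real and N :: endo and g :: "endo \<Rightarrow> real" and n :: nat
    and G :: "(ix \<Rightarrow> ix \<Rightarrow> complex) \<Rightarrow> complex" and C :: "endo set"
  assumes g: "poly_of_degree_on sym2_bianchi g n"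
    and C: "C \<in> components {v \<in> sym2_bianchi. g v > 0}" "sec_ge k = closure C"
    and N: "transpose N ** diag std_sign ** N = hodge"
    and G: "complexification k N g n G"
begin

lemma G_real: "transpose c = c \<Longrightarrow>
    G (\<lambda>I J. of_real (c $ I $ J)) = of_real (g (shift_bianchi k (transpose N ** c ** N)))"
  using G unfolding complexification_def by blast

lemma G_curve: obtains q where "\<And>t. G (\<lambda>I J. poly (M I J) t) = poly q t"
  using G unfolding complexification_def by metis

lemma G_line: obtains q where "degree q \<le> n" "\<And>t. G (\<lambda>I J. A I J + t * B I J) = poly q t"
  using G unfolding complexification_def by metis

lemma G_first_order:
  assumes "\<And>t. G (\<lambda>I J. A I J + t * B I J) = poly q t"
    and "\<And>t. G (\<lambda>I J. A I J + t * B' I J) = poly q' t"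
    and "\<And>t. G (\<lambda>I J. A I J + t * (B I J + B' I J)) = poly q'' t"
  shows "coeff q'' 1 = coeff q 1 + coeff q' 1"
  using G assms unfolding complexification_def by blast

lemma N_inverse: obtains M where "N ** M = mat 1"
proof -
  have "det N \<noteq> 0"
  proof
    assume "det N = 0"
    then have "det (transpose N ** diag std_sign ** N) = 0" by (simp add: det_mul)
    then show False using N det_hodge_nonzero by simp
  qed
  then show ?thesis using that invertible_det_nz[of N] by (auto simp: invertible_def)
qed

text \<open>The curvature bound holds with equality at the isotropic \<open>w\<close>, so
  subtracting any positive multiple of Id violates it: the operator is a boundary point.\<close>

lemma zero_on_semidefinite:
  assumes s: "transpose c = c" and psd: "\<And>x. sec c x \<ge> 0"
    and v: "c *v v = 0" "v \<noteq> 0" "(\<Sum>i\<in>UNIV. std_sign i * (v $ i)\<^sup>2) = 0"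
  shows "g (shift_bianchi k (transpose N ** c ** N)) = 0"
proof -
  let ?P = "transpose N ** c ** N"
  let ?R = "shift_bianchi k ?P"
  obtain M where M: "N ** M = mat 1" using N_inverse .
  define w where "w = M *v v"
  have Nw: "N *v w = v" by (simp add: w_def matrix_vector_mul_assoc M)
  have w0: "w \<noteq> 0" using Nw v(2) by auto
  have "sec hodge w = 0" unfolding N[symmetric] sec_congruence sec_diag Nw by (rule v(3))
  then have iso: "wedge_vol w w = 0" by (simp add: sec_hodge)
  have V: "?R \<in> sym2_bianchi" by (rule shift_bianchi_mem[OF transpose_congruence[OF s]])
  have "sec (?R - k *\<^sub>R mat 1 + (bianchi ?P / 3) *\<^sub>R hodge) x \<ge> 0" for x
    unfolding shift_bianchi_pencil by (simp add: sec_congruence psd)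
  with V have S: "?R \<in> sec_ge k" unfolding mem_sec_ge_iff_psd by blast
  have I: "mat 1 \<in> sym2_bianchi" by (simp add: mem_sym2_bianchi bianchi_linear transpose_mat)
  show ?thesis
  proof (rule defining_polynomial_boundary[OF subspace_sym2_bianchi poly_of_degree_on_continuous[OF g] C(1) _ V I])
    show "?R \<in> closure C" using S C(2) by simp
    fix \<delta> :: real assume \<delta>: "\<delta> > 0"
    have "sec (?R - k *\<^sub>R mat 1 + (bianchi ?P / 3) *\<^sub>R hodge) w = 0"
      unfolding shift_bianchi_pencil by (simp add: sec_congruence Nw) (simp add: sec_def v)
    then have "sec (?R - k *\<^sub>R mat 1) w = 0" by (simp add: sec_add sec_scaleR[of "bianchi ?P / 3"] sec_hodge iso)
    moreover have "?R - \<delta> *\<^sub>R mat 1 - k *\<^sub>R mat 1 = (?R - k *\<^sub>R mat 1) - \<delta> *\<^sub>R mat 1" by simp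
    ultimately have "sec (?R - \<delta> *\<^sub>R mat 1 - k *\<^sub>R mat 1) w = - (\<delta> * (w \<bullet> w))"
      by (simp only: sec_diff[of _ "\<delta> *\<^sub>R mat 1"] sec_scaleR[of \<delta>] sec_mat1)
    also have "\<dots> < 0" using \<delta> w0 by simp
    finally show "?R - \<delta> *\<^sub>R mat 1 \<notin> closure C"
      unfolding C(2)[symmetric] mem_sec_ge_iff_isotropic using iso by fastforce
  qed
qed

text \<open>Adding a large multiple of \<open>D\<close>, which also kills \<open>v\<close>, makes
  \<open>c\<close> semidefinite. The values on this line are polynomial in \<open>t\<close> and
  vanish for all large real \<open>t\<close>, hence also at 0.\<close>

lemma zero_on_isotropic_kernel:
  assumes s: "transpose c = c"
    and v: "c *v v = 0" "v \<noteq> 0" "(\<Sum>i\<in>UNIV. std_sign i * (v $ i)\<^sup>2) = 0"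
  shows "G (\<lambda>I J. of_real (c $ I $ J)) = 0"
proof -
  define D :: endo where "D = (\<chi> I J. (v \<bullet> v) * mat 1 $ I $ J - v $ I * v $ J)"
  have sD: "transpose D = D" by (simp add: D_def transpose_def vec_eq_iff mat_def mult.commute)
  have Dv: "D *v v = 0" unfolding D_def projection_mult by simp
  obtain q where q: "\<And>t. G (\<lambda>I J. of_real (c $ I $ J) + t * of_real (D $ I $ J)) = poly q t"
    by (rule G_line[of "\<lambda>I J. of_real (c $ I $ J)" "\<lambda>I J. of_real (D $ I $ J)"], rule that)
  have "poly q (of_real t) = 0" if "t \<ge> 36 * norm c / (v \<bullet> v)" for t
  proof -
    have "g (shift_bianchi k (transpose N ** (c + t *\<^sub>R D) ** N)) = 0"
    proof (rule zero_on_semidefinite)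
      show "transpose (c + t *\<^sub>R D) = c + t *\<^sub>R D" using s sD by (simp add: transpose_def vec_eq_iff)
      show "sec (c + t *\<^sub>R D) x \<ge> 0" for x unfolding D_def by (rule pos_semidef_shift[OF s v(1,2) that])
      show "(c + t *\<^sub>R D) *v v = 0"
        by (simp add: matrix_vector_mult_add_rdistrib scaleR_matrix_vector_assoc[symmetric] v Dv)
    qed (use v in auto)
    moreover have "transpose (c + t *\<^sub>R D) = c + t *\<^sub>R D" using s sD by (simp add: transpose_def vec_eq_iff)
    ultimately have "G (\<lambda>I J. of_real ((c + t *\<^sub>R D) $ I $ J)) = 0" by (simp only: G_real of_real_0)
    then show ?thesis using q[of "of_real t"] by simp
  qed
  then have "of_real ` {36 * norm c / (v \<bullet> v)..} \<subseteq> {z. poly q z = 0}" by auto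
  moreover have "infinite (complex_of_real ` {36 * norm c / (v \<bullet> v)..})"
    by (simp add: finite_image_iff inj_on_def infinite_Ici)
  ultimately have "q = 0" using poly_roots_finite finite_subset by blast
  then show ?thesis using q[of 0] by simp
qed

text \<open>Subtracting \<open>l *\<^sub>R diag std_sign\<close> produces a kernel vector. Under the
  congruence by \<open>N\<close> this subtracts a multiple of \<open>hodge\<close>, which
  \<open>shift_bianchi\<close> ignores.\<close>

lemma zero_on_isotropic_eigenvector:
  assumes s: "transpose c = c"
    and v: "\<And>i. (c *v v) $ i = l * std_sign i * v $ i" "v \<noteq> 0" "(\<Sum>i\<in>UNIV. std_sign i * (v $ i)\<^sup>2) = 0"
  shows "G (\<lambda>I J. of_real (c $ I $ J)) = 0"
proof -
  let ?d = "c - l *\<^sub>R diag std_sign"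
  have sd: "transpose ?d = ?d" using s transpose_diag[of std_sign] by (simp add: transpose_def vec_eq_iff)
  have "G (\<lambda>I J. of_real (?d $ I $ J)) = 0"
  proof (rule zero_on_isotropic_kernel[OF sd _ v(2,3)])
    have "(diag std_sign *v v) $ i = std_sign i * v $ i" for i
      by (simp add: diag_def matrix_vector_mult_def if_distrib if_distribR cong: if_cong)
    then show "?d *v v = 0"
      by (simp add: vec_eq_iff matrix_vector_mult_diff_rdistrib scaleR_matrix_vector_assoc[symmetric] v(1))
  qed
  moreover have "shift_bianchi k (transpose N ** ?d ** N) = shift_bianchi k (transpose N ** c ** N)"
  proof -
    have "transpose N ** ?d ** N = transpose N ** c ** N - l *\<^sub>R (transpose N ** diag std_sign ** N)"
      by (simp add: vec_eq_iff congruence_entry matrix_vector_mult_diff_rdistrib inner_diff_left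
          scaleR_matrix_vector_assoc[symmetric])
    then show ?thesis unfolding shift_bianchi_def N
      by (simp only: bianchi_linear) (simp add: diff_divide_distrib algebra_simps)
  qed
  ultimately show ?thesis using G_real[OF s] G_real[OF sd] by simp
qed

text \<open>The block \<open>(\<kappa>\<^sup>2, -\<kappa>; -\<kappa>, 1)\<close> in rows \<open>i, j\<close>, which annihilates \<open>e\<^sub>i + \<kappa> e\<^sub>j\<close>.\<close>

definition crossing :: "complex \<Rightarrow> ix \<Rightarrow> ix \<Rightarrow> ix \<Rightarrow> ix \<Rightarrow> complex" where
  "crossing \<kappa> i j I J = (if I = i \<and> J = i then \<kappa>\<^sup>2 else if I = j \<and> J = j then 1
     else if (I = i \<and> J = j) \<or> (I = j \<and> J = i) then - \<kappa> else 0)"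

text \<open>For opposite signs e_i + r e_j is a real isotropic vector. The block annihilates it, and
  the crossing condition on \<open>a\<close> makes it an eigenvector of the diagonal part.\<close>

lemma zero_on_crossing_opposite:
  assumes ij: "i \<noteq> j" and a: "std_sign i * a i = std_sign j * a j" and r: "r * r = 1"
    and opp: "std_sign j = - std_sign i"
  shows "G (\<lambda>I J. (if I = J then of_real (a I) else 0) + of_real s * crossing (of_real r) i j I J) = 0"
proof -
  define c :: endo where "c = (\<chi> I J. (if I = J then a I else 0) + s * (if I = i \<and> J = i then r\<^sup>2 else if I = j \<and> J = j then 1
     else if (I = i \<and> J = j) \<or> (I = j \<and> J = i) then - r else 0))"
  define v :: "real^ix" where "v = (\<chi> I. if I = i then 1 else if I = j then r else 0)"
  have sum: "(\<Sum>J\<in>UNIV. f J * v $ J) = f i + r * f j" for f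
  proof -
    have "(\<Sum>J\<in>UNIV. f J * v $ J) = (\<Sum>J\<in>UNIV. (if J = i then f J else 0) + (if J = j then r * f J else 0))"
      by (rule sum.cong) (use ij in \<open>auto simp: v_def\<close>)
    then show ?thesis by (simp add: sum.distrib)
  qed
  obtain l where l: "a i = l * std_sign i" "a j = l * std_sign j"
  proof
    show "a i = (std_sign i * a i) * std_sign i" using std.sign_sq[of i] by (simp add: mult.commute mult.left_commute)
    show "a j = (std_sign i * a i) * std_sign j" unfolding a using std.sign_sq[of j] by (simp add: mult.commute mult.left_commute)
  qed
  have "G (\<lambda>I J. of_real (c $ I $ J)) = 0"
  proof (rule zero_on_isotropic_eigenvector)
    have "c $ I $ J = c $ J $ I" for I J
      using ij by (cases "I = i"; cases "J = i"; cases "I = j"; cases "J = j") (simp_all add: c_def eq_commute[of I J])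
    then show "transpose c = c" by (simp add: transpose_def vec_eq_iff)
    show "(c *v v) $ I = l * std_sign I * v $ I" for I
    proof -
      have "(c *v v) $ I = c $ I $ i + r * c $ I $ j" by (simp add: matrix_vector_mult_def sum)
      also have "\<dots> = l * std_sign I * v $ I"
        using ij r by (cases "I = i"; cases "I = j") (simp_all add: c_def v_def l power2_eq_square algebra_simps)
      finally show ?thesis .
    qed
    have "v $ i = 1" by (simp add: v_def)
    then show "v \<noteq> 0" by auto
    have "(\<Sum>I\<in>UNIV. std_sign I * (v $ I)\<^sup>2) = (\<Sum>I\<in>UNIV. (std_sign I * v $ I) * v $ I)"
      by (simp add: power2_eq_square mult.assoc)
    also have "\<dots> = 0" unfolding sum using ij r opp by (simp add: v_def algebra_simps)
    finally show "(\<Sum>I\<in>UNIV. std_sign I * (v $ I)\<^sup>2) = 0" .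
  qed
  moreover have "complex_of_real (c $ I $ J) = (if I = J then of_real (a I) else 0) + of_real s * crossing (of_real r) i j I J" for I J
    using ij by (cases "I = i"; cases "J = i"; cases "I = j"; cases "J = j") (simp_all add: c_def crossing_def)
  ultimately show ?thesis by simp
qed

text \<open>For equal signs e_i + \<kappa> e_j is isotropic only over the complex numbers. An index
  \<open>m\<close> of opposite sign gives the real isotropic vectors (1 - u^2, 2u, 1 + u^2), which
  become 2 (e_i + \<kappa> e_j) at u = \<kappa>; vanishing at all real u carries over to
  \<kappa>.\<close>

lemma zero_on_crossing_same:
  assumes ij: "i \<noteq> j" and a: "std_sign i * a i = std_sign j * a j" and \<kappa>: "\<kappa>\<^sup>2 = -1"
    and same: "std_sign j = std_sign i"
  shows "G (\<lambda>I J. (if I = J then of_real (a I) else 0) + of_real s * crossing \<kappa> i j I J) = 0"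
proof -
  obtain m where m: "std_sign m = - std_sign i"
  proof (cases "idx i < 3")
    case True
    then show ?thesis by (intro that[of I34]) (simp add: std_sign_def)
  next
    case False
    then show ?thesis by (intro that[of I12]) (simp add: std_sign_def)
  qed
  have mi: "m \<noteq> i" "m \<noteq> j" using m same std.sign_sq[of i] by auto
  \<comment> \<open>\<open>v u\<close> parametrizes the real isotropic vectors in the coordinates \<open>i, j, m\<close>; \<open>x u\<close> and \<open>y u\<close>
    are orthogonal to it. At \<open>u = \<kappa> = \<plusminus>\<i>\<close> the matrix \<open>c u\<close> becomes the wanted one.\<close>
  define l where "l = std_sign i * a i"
  \<comment> \<open>\<open>b\<close> corrects the diagonal only where \<open>v u\<close> vanishes,
    so \<open>v u\<close> remains an eigenvector; the correction \<open>e\<close> at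
    \<open>m\<close> is left to the \<open>y\<close> term.\<close>
  define b where "b I = (if I = i \<or> I = j \<or> I = m then 0 else a I - l * std_sign I)" for I
  define e where "e = a m - l * std_sign m"
  define x where "x u I = (if I = i then u else if I = j then (u\<^sup>2 - 1) / 2 else 0)" for u :: real and I
  define y where "y u I = (if I = i then - (1 + u\<^sup>2) else if I = j then - (u * (1 + u\<^sup>2) / 2) else if I = m then 1 else 0)" for u :: real and I
  define v :: "real \<Rightarrow> real^ix" where "v u = (\<chi> I. if I = i then 1 - u\<^sup>2 else if I = j then 2 * u else if I = m then 1 + u\<^sup>2 else 0)" for u
  define c :: "real \<Rightarrow> endo" where "c u = (\<chi> I J. (if I = J then l * std_sign I + b I else 0) + s * (x u I * x u J) + e * (y u I * y u J))" for u
  have sum: "(\<Sum>J\<in>UNIV. f J * v u $ J) = (1 - u\<^sup>2) * f i + 2 * u * f j + (1 + u\<^sup>2) * f m" for f u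
  proof -
    have "(\<Sum>J\<in>UNIV. f J * v u $ J) = (\<Sum>J\<in>UNIV. (if J = i then (1 - u\<^sup>2) * f J else 0)
        + (if J = j then 2 * u * f J else 0) + (if J = m then (1 + u\<^sup>2) * f J else 0))"
      by (rule sum.cong) (use ij mi in \<open>auto simp: v_def\<close>)
    then show ?thesis by (simp add: sum.distrib)
  qed
  have xv: "(\<Sum>J\<in>UNIV. x u J * v u $ J) = 0" for u
    unfolding sum using ij mi by (simp add: x_def field_simps)
  have yv: "(\<Sum>J\<in>UNIV. y u J * v u $ J) = 0" for u
    unfolding sum using ij mi by (simp add: y_def field_simps) (simp add: power2_eq_square power4_eq_xxxx algebra_simps)
  have real: "G (\<lambda>I J. of_real (c u $ I $ J)) = 0" for u
  proof (rule zero_on_isotropic_eigenvector)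
    show "transpose (c u) = c u" by (simp add: c_def transpose_def vec_eq_iff mult.commute)
    show "(c u *v v u) $ I = l * std_sign I * v u $ I" for I
    proof -
      have "(c u *v v u) $ I = (\<Sum>J\<in>UNIV. (if I = J then l * std_sign I + b I else 0) * v u $ J)
         + s * x u I * (\<Sum>J\<in>UNIV. x u J * v u $ J) + e * y u I * (\<Sum>J\<in>UNIV. y u J * v u $ J)"
        by (simp only: c_def matrix_vector_mult_def vec_lambda_beta distrib_right sum.distrib sum_distrib_left mult.assoc)
      also have "\<dots> = (l * std_sign I + b I) * v u $ I"
        unfolding xv yv by (simp add: if_distrib if_distribR cong: if_cong)
      also have "\<dots> = l * std_sign I * v u $ I" by (simp add: b_def v_def)
      finally show ?thesis .
    qed
    have "1 + u\<^sup>2 > 0" by (intro add_pos_nonneg) auto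
    then have "v u $ m \<noteq> 0" using mi by (simp add: v_def)
    then show "v u \<noteq> 0" by auto
    have "(\<Sum>I\<in>UNIV. std_sign I * (v u $ I)\<^sup>2) = (\<Sum>I\<in>UNIV. (std_sign I * v u $ I) * v u $ I)"
      by (simp add: power2_eq_square mult.assoc)
    also have "\<dots> = 0" unfolding sum using ij mi m same by (simp add: v_def power2_eq_square algebra_simps)
    finally show "(\<Sum>I\<in>UNIV. std_sign I * (v u $ I)\<^sup>2) = 0" .
  qed
  define X where "X I = (if I = i then [:0, 1:] else if I = j then [:-1/2, 0, 1/2:] else 0 :: complex poly)" for I
  define Y where "Y I = (if I = i then [:-1, 0, -1:] else if I = j then [:0, -1/2, 0, -1/2:] else if I = m then 1 else 0 :: complex poly)" for I
  define M where "M I J = [:if I = J then of_real (l * std_sign I + b I) else 0:] + smult (of_real s) (X I * X J) + smult (of_real e) (Y I * Y J)" for I J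
  have X: "poly (X I) (of_real u) = of_real (x u I)" for I u
    by (simp add: X_def x_def power2_eq_square field_simps)
  have Y: "poly (Y I) (of_real u) = of_real (y u I)" for I u
    by (simp add: Y_def y_def power2_eq_square field_simps)
  have M: "poly (M I J) (of_real u) = of_real (c u $ I $ J)" for I J u
    by (simp add: M_def c_def X Y)
  obtain q where q: "\<And>t. G (\<lambda>I J. poly (M I J) t) = poly q t" using G_curve[of M] by blast
  have "poly q (of_real u) = 0" for u using q[of "of_real u"] real[of u] by (simp add: M)
  then have "of_real ` UNIV \<subseteq> {z. poly q z = 0}" by auto
  moreover have "infinite (complex_of_real ` UNIV)"
    by (simp add: finite_image_iff inj_on_def infinite_UNIV_char_0)
  ultimately have "q = 0" using poly_roots_finite finite_subset by blast
  then have "G (\<lambda>I J. poly (M I J) \<kappa>) = 0" using q by simp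
  moreover have "poly (M I J) \<kappa> = (if I = J then of_real (a I) else 0) + of_real s * crossing \<kappa> i j I J" for I J
  proof -
    \<comment> \<open>At \<kappa> the factors 1 + u^2 vanish: \<open>x\<close> becomes (\<kappa>,
      -1), whose outer square is the block \<open>crossing\<close>, and \<open>y\<close> becomes the
      unit vector at \<open>m\<close>.\<close>
    have XK: "poly (X I) \<kappa> = (if I = i then \<kappa> else if I = j then -1 else 0)" for I
      using \<kappa> by (simp add: X_def power2_eq_square)
    have YK: "poly (Y I) \<kappa> = (if I = m then 1 else 0)" for I
      using \<kappa> ij mi by (simp add: Y_def power2_eq_square)
    have "a i = l * std_sign i" using std.sign_sq[of i] by (simp add: l_def mult.commute mult.left_commute)
    moreover have "a j = l * std_sign j" unfolding l_def a using std.sign_sq[of j] by (simp add: mult.commute mult.left_commute)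
    ultimately have ab: "l * std_sign I + b I + (if I = m then e else 0) = a I" for I
      using mi by (simp add: b_def e_def)
    have "poly (M I J) \<kappa> = (if I = J then of_real (l * std_sign I + b I + (if I = m then e else 0)) else 0)
        + of_real s * (poly (X I) \<kappa> * poly (X J) \<kappa>)"
      by (auto simp: M_def YK)
    also have "poly (X I) \<kappa> * poly (X J) \<kappa> = crossing \<kappa> i j I J"
      using ij by (cases "I = i"; cases "J = i"; cases "I = j"; cases "J = j")
        (simp_all add: XK crossing_def power2_eq_square)
    finally show ?thesis unfolding ab .
  qed
  ultimately show ?thesis by simp
qed

lemma zero_on_crossing:
  assumes ij: "i \<noteq> j" and a: "std_sign i * a i = std_sign j * a j"
    and \<kappa>: "\<kappa>\<^sup>2 = - of_real (std_sign i * std_sign j)"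
  shows "G (\<lambda>I J. (if I = J then of_real (a I) else 0) + of_real s * crossing \<kappa> i j I J) = 0"
proof (cases "std_sign j = std_sign i")
  case True
  then show ?thesis using \<kappa> std.sign_sq[of i] by (intro zero_on_crossing_same[OF ij a]) simp_all
next
  case False
  then have opp: "std_sign j = - std_sign i" using std.signs[of i] std.signs[of j] by auto
  then have "\<kappa>\<^sup>2 = 1" using \<kappa> std.sign_sq[of i] by simp
  then have "\<kappa> = 1 \<or> \<kappa> = -1" by (simp add: power2_eq_1_iff)
  then obtain r where "\<kappa> = of_real r" "r * r = 1" by (metis mult_1 mult_minus1 of_real_1 of_real_minus minus_minus)
  then show ?thesis using zero_on_crossing_opposite[OF ij a _ opp] by simp
qed

text \<open>The linear term is additive in the direction, so it can be computed from directions in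
  which \<open>G\<close> vanishes identically, although \<open>d\<close> itself may leave the zero
  set.\<close>

lemma double_root:
  assumes ij: "i \<noteq> j" and a: "std_sign i * a i = std_sign j * a j"
    and q: "\<And>t. G (\<lambda>I J. (if I = J then of_real (a I) else 0) + t * (if I = J then of_real (d I) else 0)) = poly q t"
  shows "coeff q 0 = 0" "coeff q 1 = 0"
proof -
  define \<sigma> where "\<sigma> = std_sign i * std_sign j"
  have \<sigma>: "\<sigma> * std_sign i = std_sign j" "\<sigma> * std_sign j = std_sign i" "\<sigma> * \<sigma> = 1"
    using std.sign_sq[of i] std.sign_sq[of j] unfolding \<sigma>_def by (auto simp: mult_ac)
  obtain \<kappa> where \<kappa>: "\<kappa>\<^sup>2 = - complex_of_real \<sigma>" using power2_csqrt by blast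
  have "poly q 0 = G (\<lambda>I J. (if I = J then of_real (a I) else 0) + of_real 0 * crossing \<kappa> i j I J)"
    using q[of 0] by simp
  also have "\<dots> = 0" by (rule zero_on_crossing[OF ij a]) (use \<kappa> in \<open>simp add: \<sigma>_def\<close>)
  finally show "coeff q 0 = 0" by (simp add: poly_0_coeff_0)
  \<comment> \<open>Up to the multiples of \<open>\<plusminus>\<kappa>\<close> off the diagonal, \<open>d\<close> splits into a direction \<open>d'\<close> preserving
    the crossing and a multiple of the block \<open>crossing (\<plusminus>\<kappa>)\<close>; the two signs average to \<open>d\<close>.\<close>
  define \<mu> where "\<mu> = (d j - \<sigma> * d i) / 2"
  define d' where "d' I = d I + (if I = i then \<mu> * \<sigma> else if I = j then - \<mu> else 0)" for I
  have d': "std_sign i * d' i = std_sign j * d' j"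
  proof -
    have "2 * \<mu> = d j - \<sigma> * d i" by (simp add: \<mu>_def)
    then have "std_sign i * (d i + \<mu> * \<sigma>) = std_sign j * (d j - \<mu>)" using \<sigma> by algebra
    then show ?thesis using ij by (simp add: d'_def)
  qed
  let ?A = "\<lambda>I J. if I = J then complex_of_real (a I) else 0"
  define B where "B K I J = (if I = J then of_real (d' I) else 0) + of_real \<mu> * crossing K i j I J" for K I J
  \<comment> \<open>For real \<open>h\<close> the diagonal \<open>a + h * d'\<close> keeps the
    crossing of \<open>i\<close> and \<open>j\<close>, so the whole line lies in the zero
    set.\<close>
  have vanish: "q' = 0" if K: "K\<^sup>2 = - complex_of_real \<sigma>" and q': "\<And>t. G (\<lambda>I J. ?A I J + t * B K I J) = poly q' t" for K q'
  proof -
    have "poly q' (of_real h) = 0" for h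
    proof -
      have "poly q' (of_real h) = G (\<lambda>I J. (if I = J then of_real (a I + h * d' I) else 0) + of_real (h * \<mu>) * crossing K i j I J)"
        unfolding q'[symmetric] by (rule arg_cong[of _ _ G]) (auto simp: fun_eq_iff B_def algebra_simps)
      also have "\<dots> = 0"
      proof (rule zero_on_crossing[OF ij])
        show "std_sign i * (a i + h * d' i) = std_sign j * (a j + h * d' j)"
          using a d' by (simp add: distrib_left mult.left_commute)
      qed (use K in \<open>simp add: \<sigma>_def\<close>)
      finally show ?thesis .
    qed
    then have "of_real ` UNIV \<subseteq> {z. poly q' z = 0}" by auto
    moreover have "infinite (complex_of_real ` UNIV)"
      by (simp add: finite_image_iff inj_on_def infinite_UNIV_char_0)
    ultimately show "q' = 0" using poly_roots_finite finite_subset by blast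
  qed
  obtain q1 where q1: "\<And>t. G (\<lambda>I J. ?A I J + t * B \<kappa> I J) = poly q1 t" by (rule G_line[of ?A "B \<kappa>"], rule that)
  obtain q2 where q2: "\<And>t. G (\<lambda>I J. ?A I J + t * B (-\<kappa>) I J) = poly q2 t" by (rule G_line[of ?A "B (-\<kappa>)"], rule that)
  obtain q3 where q3: "\<And>t. G (\<lambda>I J. ?A I J + t * (B \<kappa> I J + B (-\<kappa>) I J)) = poly q3 t"
    by (rule G_line[of ?A "\<lambda>I J. B \<kappa> I J + B (-\<kappa>) I J"], rule that)
  have "q1 = 0" "q2 = 0" using vanish[OF _ q1] vanish[OF _ q2] \<kappa> by simp_all
  then have "coeff q3 1 = 0" using G_first_order[OF q1 q2 q3] by simp
  moreover have "coeff q3 1 = coeff q 1 + coeff q 1"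
  proof (rule G_first_order[OF q q])
    have "B \<kappa> I J + B (-\<kappa>) I J = (if I = J then of_real (d I) else 0) + (if I = J then of_real (d I) else 0)" for I J
      using \<kappa> ij by (cases "I = i"; cases "J = i"; cases "I = j"; cases "J = j")
        (simp_all add: B_def d'_def crossing_def algebra_simps)
    then show "G (\<lambda>I J. ?A I J + t * ((if I = J then of_real (d I) else 0) + (if I = J then of_real (d I) else 0))) = poly q3 t" for t
      using q3[of t] by simp
  qed
  ultimately show "coeff q 1 = 0" by simp
qed

end

definition index_pairs :: "(ix \<times> ix) set" where
  "index_pairs = {(I12, I13), (I12, I14), (I12, I23), (I12, I24), (I12, I34), (I13, I14), (I13, I23),
     (I13, I24), (I13, I34), (I14, I23), (I14, I24), (I14, I34), (I23, I24), (I23, I34), (I24, I34)}"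

lemma card_index_pairs: "card index_pairs = 15"
  by (simp add: index_pairs_def)

lemma index_pairs_idx: "(i, j) \<in> index_pairs \<Longrightarrow> idx i < idx j"
  by (auto simp: index_pairs_def)

text \<open>For generic directions \<open>\<delta>\<close> the 15 crossings \<open>\<alpha>\<^sub>i + t \<delta>\<^sub>i = \<alpha>\<^sub>j + t \<delta>\<^sub>j\<close> occur at different times \<open>t\<close>;
  the moment curve \<open>\<delta>\<^sub>i = s ^ idx i\<close> contains such directions.\<close>

lemma generic_direction:
  fixes \<alpha> :: "ix \<Rightarrow> real"
  assumes \<alpha>: "\<And>i j. i \<noteq> j \<Longrightarrow> \<alpha> i \<noteq> \<alpha> j"
  obtains \<delta> :: "ix \<Rightarrow> real" where "\<And>i j. i \<noteq> j \<Longrightarrow> \<delta> i \<noteq> \<delta> j"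
    "\<And>i j i' j'. (i, j) \<in> index_pairs \<Longrightarrow> (i', j') \<in> index_pairs \<Longrightarrow> (i, j) \<noteq> (i', j') \<Longrightarrow>
       (\<alpha> i - \<alpha> j) * (\<delta> i' - \<delta> j') \<noteq> (\<alpha> i' - \<alpha> j') * (\<delta> i - \<delta> j)"
proof -
  define m where "m i = (monom 1 (idx i) :: real poly)" for i
  have cm: "coeff (m i) (idx j) = (if i = j then 1 else 0)" for i j by (simp add: m_def idx_inj)
  define F where "F x = (case x of ((i, j), (i', j')) \<Rightarrow> smult (\<alpha> i - \<alpha> j) (m i' - m j') - smult (\<alpha> i' - \<alpha> j') (m i - m j))" for x
  define X where "X = {x \<in> index_pairs \<times> index_pairs. fst x \<noteq> snd x}"
  define Y where "Y = {x :: ix \<times> ix. fst x \<noteq> snd x}"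
  have F0: "F x \<noteq> 0" if "x \<in> X" for x
  proof -
    obtain i j i' j' where x: "x = ((i, j), (i', j'))" by (metis prod.exhaust)
    have p: "(i, j) \<in> index_pairs" "(i', j') \<in> index_pairs" "(i, j) \<noteq> (i', j')" using that by (auto simp: X_def x)
    have ne: "i \<noteq> j" "i' \<noteq> j'" using index_pairs_idx p by fastforce+
    \<comment> \<open>Two different ordered pairs do not have the same members. At an index of the
      first pair outside the second, only the term with factor
      \<open>\<alpha> i' - \<alpha> j'\<close> contributes to the coefficient of
      \<open>F x\<close>.\<close>
    have "\<exists>l. (l = i \<or> l = j) \<and> l \<noteq> i' \<and> l \<noteq> j'"
    proof (cases "i = i' \<or> i = j'")
      case False
      then show ?thesis by (intro exI[of _ i]) simp
    next
      case True
      have "j \<noteq> i'" using True index_pairs_idx[OF p(1)] index_pairs_idx[OF p(2)] by (elim disjE) auto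
      moreover have "j \<noteq> j'" using True p(3) index_pairs_idx[OF p(1)] by (elim disjE) auto
      ultimately show ?thesis by (intro exI[of _ j]) simp
    qed
    then obtain l where l: "l = i \<or> l = j" "l \<noteq> i'" "l \<noteq> j'" by blast
    have "coeff (F x) (idx l) \<noteq> 0"
      using l ne \<alpha>[OF ne(2)] by (auto simp: F_def x cm)
    then show ?thesis by auto
  qed
  have m0: "m (fst x) - m (snd x) \<noteq> 0" if "x \<in> Y" for x
  proof -
    have "coeff (m (fst x) - m (snd x)) (idx (fst x)) \<noteq> 0" using that by (simp add: Y_def cm)
    then show ?thesis by auto
  qed
  have "finite (\<Union>x\<in>X. {s. poly (F x) s = 0})"
    using F0 by (intro finite_UN_I poly_roots_finite) (auto intro: finite_subset[OF subset_UNIV])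
  moreover have "finite (\<Union>x\<in>Y. {s. poly (m (fst x) - m (snd x)) s = 0})"
    using m0 by (intro finite_UN_I poly_roots_finite) (auto intro: finite_subset[OF subset_UNIV])
  ultimately obtain s where s: "s \<notin> (\<Union>x\<in>X. {s. poly (F x) s = 0}) \<union> (\<Union>x\<in>Y. {s. poly (m (fst x) - m (snd x)) s = 0})"
    using ex_new_if_finite[OF infinite_UNIV_char_0 finite_UnI] by blast
  have pm: "poly (m i) s = s ^ idx i" for i by (simp add: m_def poly_monom)
  show ?thesis
  proof (rule that[of "\<lambda>i. s ^ idx i"])
    fix i j :: ix assume "i \<noteq> j"
    then have "(i, j) \<in> Y" by (simp add: Y_def)
    then have "poly (m i - m j) s \<noteq> 0" using s by force
    then show "s ^ idx i \<noteq> s ^ idx j" by (simp add: pm)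
  next
    fix i j i' j' assume "(i, j) \<in> index_pairs" "(i', j') \<in> index_pairs" "(i, j) \<noteq> (i', j')"
    then have "((i, j), (i', j')) \<in> X" by (simp add: X_def)
    then have "poly (F ((i, j), (i', j'))) s \<noteq> 0" using s by blast
    then show "(\<alpha> i - \<alpha> j) * (s ^ idx i' - s ^ idx j') \<noteq> (\<alpha> i' - \<alpha> j') * (s ^ idx i - s ^ idx j)"
      by (simp add: F_def pm)
  qed
qed

lemma degree_ge_double_roots:
  fixes q :: "'a::idom poly"
  assumes "q \<noteq> 0" "finite T" "\<And>x. x \<in> T \<Longrightarrow> [:-x, 1:]\<^sup>2 dvd q"
  shows "2 * card T \<le> degree q"
proof -
  have o: "2 \<le> count (proots q) x" if "x \<in> T" for x
    using assms(1) assms(3)[OF that] by (simp add: order_divides)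
  have "T \<subseteq> set_mset (proots q)" using o by (metis count_greater_zero_iff not_numeral_le_zero not_gr_zero subsetI)
  then have "(\<Sum>x\<in>T. count (proots q) x) \<le> (\<Sum>x\<in>set_mset (proots q). count (proots q) x)"
    by (intro sum_mono2) auto
  moreover have "(\<Sum>x\<in>T. 2) \<le> (\<Sum>x\<in>T. count (proots q) x)" by (rule sum_mono) (rule o)
  ultimately show ?thesis using size_proots_le[of q] by (simp add: size_multiset_overloaded_eq)
qed

section \<open>The degree bound and the main theorem\<close>

theorem defining_polynomial_degree:
  assumes g: "poly_of_degree_on sym2_bianchi g n"
    and C: "C \<in> components {v \<in> sym2_bianchi. g v > 0}" and S: "sec_ge k = closure C"
  shows "30 \<le> n"
proof -
  have "C \<noteq> {}" "C \<subseteq> {v \<in> sym2_bianchi. g v > 0}"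
    using in_components_nonempty[OF C] in_components_subset[OF C] by auto
  then obtain R1 where R1: "R1 \<in> C" "R1 \<in> sym2_bianchi" "g R1 > 0" by blast
  \<comment> \<open>\<open>R1\<close> itself need not have a normal form; a nearby point of
    \<open>main_region k\<close> has one, and \<open>g\<close> is still nonzero there.\<close>
  then have "R1 \<in> closure (main_region k)" using S closure_subset closure_main_region by blast
  moreover obtain e where e: "e > 0" "\<And>v. v \<in> sym2_bianchi \<Longrightarrow> dist v R1 < e \<Longrightarrow> dist (g v) (g R1) < g R1"
    using poly_of_degree_on_continuous[OF g] R1 unfolding continuous_on_iff by metis
  ultimately obtain R2 where R2: "R2 \<in> main_region k" "dist R2 R1 < e"
    unfolding closure_approachable by blast
  have "R2 \<in> sym2_bianchi" using R2(1) by (auto simp: main_region_def sec_ge_def)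
  then have "g R2 \<noteq> 0" using e(2)[OF _ R2(2)] by auto
  obtain N a where Na: "std_pair N a" "R2 = shift_bianchi k (transpose N ** diag a ** N)"
    using R2(1) by (rule main_region_std_pair)
  obtain G where G: "complexification k N g n G" using complexification_exists[OF g] by blast
  interpret lower_bound k N g n G C
    by standard (use g C S G Na(1) in \<open>auto simp: std_pair_def\<close>)
  define \<alpha> where "\<alpha> i = std_sign i * a i" for i
  have "\<alpha> i \<noteq> \<alpha> j" if "i \<noteq> j" for i j
  proof -
    have "idx i < idx j \<or> idx j < idx i" using that idx_inj[of i j] by linarith
    then show ?thesis using Na(1) unfolding std_pair_def \<alpha>_def by (metis less_irrefl)
  qed
  then obtain \<delta> where \<delta>: "\<And>i j. i \<noteq> j \<Longrightarrow> \<delta> i \<noteq> \<delta> j"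
    "\<And>i j i' j'. (i, j) \<in> index_pairs \<Longrightarrow> (i', j') \<in> index_pairs \<Longrightarrow> (i, j) \<noteq> (i', j') \<Longrightarrow>
       (\<alpha> i - \<alpha> j) * (\<delta> i' - \<delta> j') \<noteq> (\<alpha> i' - \<alpha> j') * (\<delta> i - \<delta> j)"
    using generic_direction[of \<alpha>] by metis
  define d where "d i = std_sign i * \<delta> i" for i
  obtain q where q: "degree q \<le> n"
    "\<And>t. G (\<lambda>I J. (if I = J then of_real (a I) else 0) + t * (if I = J then of_real (d I) else 0)) = poly q t"
    by (rule G_line[of "\<lambda>I J. if I = J then of_real (a I) else 0" "\<lambda>I J. if I = J then of_real (d I) else 0"], rule that)
  have "poly q 0 \<noteq> 0"
  proof -
    have "(\<lambda>I J. (if I = J then of_real (a I) else 0) + 0 * (if I = J then of_real (d I) else 0)) = (\<lambda>I J. complex_of_real (diag a $ I $ J))"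
      by (auto simp: fun_eq_iff diag_def)
    then have "poly q 0 = G (\<lambda>I J. complex_of_real (diag a $ I $ J))" using q(2)[of 0] by simp
    then show ?thesis using G_real[OF transpose_diag, of a] \<open>g R2 \<noteq> 0\<close> by (simp add: Na(2))
  qed
  then have q0: "q \<noteq> 0" by auto
  define \<tau> where "\<tau> x = (case x of (i, j) \<Rightarrow> - (\<alpha> i - \<alpha> j) / (\<delta> i - \<delta> j))" for x
  have ne: "\<delta> i - \<delta> j \<noteq> 0" if "(i, j) \<in> index_pairs" for i j
    using \<delta>(1)[of i j] index_pairs_idx[OF that] by auto
  have "inj_on \<tau> index_pairs"
  proof (rule inj_onI, rule ccontr)
    fix x y assume xy: "x \<in> index_pairs" "y \<in> index_pairs" "\<tau> x = \<tau> y" "x \<noteq> y"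
    obtain i j where x: "x = (i, j)" by (cases x)
    obtain i' j' where y: "y = (i', j')" by (cases y)
    have "(\<alpha> i - \<alpha> j) * (\<delta> i' - \<delta> j') = (\<alpha> i' - \<alpha> j') * (\<delta> i - \<delta> j)"
    proof -
      have "- (\<alpha> i - \<alpha> j) / (\<delta> i - \<delta> j) = - (\<alpha> i' - \<alpha> j') / (\<delta> i' - \<delta> j')"
        using xy(3) by (simp add: x y \<tau>_def)
      moreover have "\<delta> i - \<delta> j \<noteq> 0" "\<delta> i' - \<delta> j' \<noteq> 0" using ne xy(1,2) x y by auto
      ultimately have "- (\<alpha> i - \<alpha> j) * (\<delta> i' - \<delta> j') = - (\<alpha> i' - \<alpha> j') * (\<delta> i - \<delta> j)"
        by (metis frac_eq_eq)
      then show ?thesis by linarith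
    qed
    then show False using \<delta>(2) xy x y by blast
  qed
  then have card: "card ((\<lambda>x. complex_of_real (\<tau> x)) ` index_pairs) = 15"
    by (subst card_image) (auto simp: card_index_pairs inj_on_def)
  have "2 * card ((\<lambda>x. complex_of_real (\<tau> x)) ` index_pairs) \<le> degree q"
  proof (rule degree_ge_double_roots[OF q0])
    show "finite ((\<lambda>x. complex_of_real (\<tau> x)) ` index_pairs)" by (simp add: index_pairs_def)
    fix z assume "z \<in> (\<lambda>x. complex_of_real (\<tau> x)) ` index_pairs"
    then obtain i j where ij: "(i, j) \<in> index_pairs" "z = of_real (\<tau> (i, j))" by auto
    define t0 where "t0 = \<tau> (i, j)"
    \<comment> \<open>The crossing is moved to 0, where \<open>double_root\<close> gives the two
      lowest coefficients.\<close>
    let ?q = "pcompose q [:z, 1:]"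
    have "i \<noteq> j" using index_pairs_idx[OF ij(1)] by auto
    moreover have "std_sign i * (a i + t0 * d i) = std_sign j * (a j + t0 * d j)"
    proof -
      have s: "std_sign i * (a i + t0 * d i) = \<alpha> i + t0 * \<delta> i" for i
      proof -
        have "std_sign i * (a i + t0 * d i) = \<alpha> i + t0 * ((std_sign i * std_sign i) * \<delta> i)"
          by (simp add: d_def \<alpha>_def algebra_simps)
        then show ?thesis by (simp only: std.sign_sq mult_1)
      qed
      have "t0 * (\<delta> i - \<delta> j) = - (\<alpha> i - \<alpha> j)" using ne[OF ij(1)] by (simp add: t0_def \<tau>_def)
      then show ?thesis unfolding s by (simp add: algebra_simps)
    qed
    moreover have "G (\<lambda>I J. (if I = J then of_real (a I + t0 * d I) else 0) + t * (if I = J then of_real (d I) else 0)) = poly ?q t" for t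
    proof -
      have "(\<lambda>I J. (if I = J then of_real (a I + t0 * d I) else 0) + t * (if I = J then of_real (d I) else 0))
         = (\<lambda>I J. (if I = J then of_real (a I) else 0) + (z + t) * (if I = J then of_real (d I) else 0))"
        by (auto simp: fun_eq_iff ij(2) t0_def algebra_simps)
      then show ?thesis using q(2)[of "z + t"] by (simp add: poly_pcompose)
    qed
    ultimately have c: "coeff ?q 0 = 0" "coeff ?q 1 = 0" by (rule double_root)+
    obtain u0 r0 where r0: "?q = pCons u0 r0" by (cases ?q)
    obtain u1 r where r: "r0 = pCons u1 r" by (cases r0)
    have "?q = [:0, 1:]\<^sup>2 * r" using c unfolding r0 r by (simp add: power2_eq_square)
    then have "pcompose ?q [:-z, 1:] = pcompose ([:0, 1:]\<^sup>2 * r) [:-z, 1:]" by simp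
    moreover have "pcompose ?q [:-z, 1:] = q"
      by (simp add: pcompose_assoc[symmetric] pcompose_pCons)
    moreover have "pcompose ([:0, 1:]\<^sup>2 * r) [:-z, 1:] = [:-z, 1:]\<^sup>2 * pcompose r [:-z, 1:]"
      by (simp only: power2_eq_square pcompose_mult) (simp add: pcompose_pCons)
    ultimately show "[:-z, 1:]\<^sup>2 dvd q" by (metis dvd_triv_left)
  qed
  then show ?thesis using card q(1) by simp
qed

text \<open>In a connected set between the region and the positivity set, the region is closed
  because \<open>sec_ge k\<close> is, and open because a definite member of the pencil stays
  definite nearby.\<close>

lemma main_region_component: "main_region k \<in> components {R \<in> sym2_bianchi. disc_poly k R > 0}"
proof -
  let ?W = "{R \<in> sym2_bianchi. disc_poly k R > 0}"
  have ne: "main_region k \<noteq> {}" using example_main_region by blast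
  have sub: "main_region k \<subseteq> ?W" by (auto simp: main_region_def sec_ge_def)
  have max: "D = main_region k" if D: "main_region k \<subseteq> D" "D \<subseteq> ?W" "connected D" for D
  proof -
    have eq: "main_region k = D \<inter> sec_ge k" using D by (auto simp: main_region_def)
    have "closedin (top_of_set D) (main_region k)"
      unfolding eq by (rule closedin_closed_Int[OF closed_sec_ge])
    moreover have "openin (top_of_set D) (main_region k)"
      unfolding openin_euclidean_subtopology_iff
    proof (intro conjI ballI)
      fix R assume R: "R \<in> main_region k"
      then obtain x where x: "pos_def (R - k *\<^sub>R mat 1 + x *\<^sub>R hodge)"
        using sec_ge_disc_nonzero_pos_def[of R k] by (auto simp: main_region_def)
      obtain e where e: "e > 0" "\<And>R'. R' \<in> sym2_bianchi \<Longrightarrow> dist R' R < e \<Longrightarrow> R' \<in> sec_ge k"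
        using sec_ge_nhd[OF x] by blast
      then show "\<exists>e>0. \<forall>R'\<in>D. dist R' R < e \<longrightarrow> R' \<in> main_region k"
        unfolding eq using D(2) by (intro exI[of _ e]) auto
    qed (rule D(1))
    ultimately show ?thesis using D(3) ne unfolding connected_clopen by blast
  qed
  show ?thesis unfolding in_components_maximal
    using ne sub connected_main_region max by blast
qed

lemma disc_poly_defining_polynomial: "defining_polynomial sym2_bianchi (sec_ge k) (disc_poly k)"
proof -
  obtain n where "poly_of_degree_on sym2_bianchi (disc_poly k) n" using disc_poly_degree_le by blast
  then show ?thesis unfolding defining_polynomial_def
    using main_region_component closure_main_region by metis
qed

lemma identity_mem_sym2_bianchi: "c *\<^sub>R mat 1 \<in> sym2_bianchi"
  by (rule subspace_scale[OF subspace_sym2_bianchi])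
    (simp add: mem_sym2_bianchi bianchi_mat1 transpose_mat)

lemma identity_pos_def: "pos_def ((k + 1) *\<^sub>R mat 1 - k *\<^sub>R mat 1 + 0 *\<^sub>R hodge)"
  by (simp add: pos_def_def sec_mat1 algebra_simps)

theorem theoremC:
  fixes k :: real
  shows "algebraic_interior sym2_bianchi (sec_ge k) \<and>
    minimal_defining_polynomial sym2_bianchi (sec_ge k) (disc_poly k) \<and>
    (\<exists>C \<in> components {R \<in> sym2_bianchi. disc_poly k R > 0}.
       (k + 1) *\<^sub>R mat 1 \<in> closure C \<and>
       (\<forall>C' \<in> components {R \<in> sym2_bianchi. disc_poly k R > 0}.
          (k + 1) *\<^sub>R mat 1 \<in> closure C' \<longrightarrow> C' = C) \<and>
       sec_ge k = closure C)"
proof (intro conjI)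
  show "algebraic_interior sym2_bianchi (sec_ge k)"
    using closed_sec_ge disc_poly_defining_polynomial unfolding algebraic_interior_def by blast
  obtain n where n: "n \<le> 30" "poly_of_degree_on sym2_bianchi (disc_poly k) n" using disc_poly_degree_le .
  have "n \<le> m" if "defining_polynomial sym2_bianchi (sec_ge k) g" "poly_of_degree_on sym2_bianchi g m" for g m
    using that n(1) defining_polynomial_degree[OF that(2)] unfolding defining_polynomial_def
    by (meson order_trans)
  then show "minimal_defining_polynomial sym2_bianchi (sec_ge k) (disc_poly k)"
    using n(2) disc_poly_defining_polynomial unfolding minimal_defining_polynomial_def by blast
  obtain e where e: "e > 0" "\<And>R. R \<in> sym2_bianchi \<Longrightarrow> dist R ((k + 1) *\<^sub>R mat 1) < e \<Longrightarrow> R \<in> sec_ge k"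
    using sec_ge_nhd[OF identity_pos_def[of k]] by blast
  have mem: "(k + 1) *\<^sub>R mat 1 \<in> closure (main_region k)"
    unfolding closure_main_region using e(1) by (intro e(2) identity_mem_sym2_bianchi) simp
  \<comment> \<open>All Bianchi operators near (k+1) Id satisfy the curvature bound, so
    \<open>C'\<close> meets \<open>main_region k\<close>. The point itself lies in no component,
    since det (Id + x hodge) has the triple roots 1 and -1.\<close>
  have "C' = main_region k"
    if C': "C' \<in> components {R \<in> sym2_bianchi. disc_poly k R > 0}" "(k + 1) *\<^sub>R mat 1 \<in> closure C'" for C'
  proof -
    obtain R where R: "R \<in> C'" "dist R ((k + 1) *\<^sub>R mat 1) < e"
      using C'(2) e(1) unfolding closure_approachable by blast
    moreover have "R \<in> {R \<in> sym2_bianchi. disc_poly k R > 0}" using R(1) in_components_subset[OF C'(1)] by blast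
    ultimately have "R \<in> main_region k" using e(2) by (simp add: main_region_def)
    with R(1) show ?thesis using components_eq[OF C'(1) main_region_component] by blast
  qed
  then show "\<exists>C \<in> components {R \<in> sym2_bianchi. disc_poly k R > 0}.
       (k + 1) *\<^sub>R mat 1 \<in> closure C \<and>
       (\<forall>C' \<in> components {R \<in> sym2_bianchi. disc_poly k R > 0}.
          (k + 1) *\<^sub>R mat 1 \<in> closure C' \<longrightarrow> C' = C) \<and>
       sec_ge k = closure C"
    using mem main_region_component closure_main_region by blast
qed

end
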